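(* Let $n\ge 2$ and $m\ge 1$ be integers, $k=n-1$, and $\rho(z,w)=|z|^2+|w|^{2m}-1$ on $\mathbb C^k\times\mathbb C$. On $\partial E_{n,m}$ one has $$M(\rho)=m^2|w|^{2m-2}.$$ Consequently, with $a=2(m-1)/(n+1)$, $$\Phi^*d\mu_F=\frac{m^{2/(n+1)}}{2}\,r^{a+1}(1-r^{2m})^{k-1}\,d\sigma_{S^{2k-1}}(\xi)\,d\theta\,dr ,$$ where $\Phi$ is the parametrization $\Phi(\xi,r,\theta)=\bigl((1-r^{2m})^{1/2}\xi,\,re^{i\theta}\bigr)$ of $\partial E_{n,m}$ (up to the measure-zero set $\{z=0\}$), with $\xi\in S^{2k-1}\subset\mathbb C^k$, $0\le r\le 1$, $\theta\in\mathbb R/2\pi\mathbb Z$.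
   Context: $E_{n,m}=\{(z,w)\in\mathbb C^{k}\times\mathbb C: |z|^2+|w|^{2m}<1\}$ with $k=n-1$. For a defining function $\rho$, with $\mathbb C^n$ coordinates $(z_1,\dots,z_k,w)$ numbered $1,\dots,n$ and subscripts denoting holomorphic/antiholomorphic partial derivatives, $$M(\rho)=-\det\begin{pmatrix}0&\rho_{\bar 1}&\cdots&\rho_{\bar n}\\ \rho_1&\rho_{1\bar 1}&\cdots&\rho_{1\bar n}\\ \vdots&\vdots&\ddots&\vdots\\ \rho_n&\rho_{n\bar 1}&\cdots&\rho_{n\bar n}\end{pmatrix}\quad\text{on }\partial E_{n,m}.$$ The (normalized) Fefferman measure on $\partial E_{n,m}$ is $d\mu_F=M(\rho)^{1/(n+1)}\,\dfrac{d\sigma}{|\nabla\rho|}$, where $d\sigma$ is Euclidean hypersurface measure on $\partial E_{n,m}$ and $|\nabla\rho|$ is the Euclidean length of the real gradient of $\rho$. $d\sigma_{S^{2k-1}}$ is the standard (unnormalized) surface measure on the unit sphere. For $m=1$, $|w|^{2m-2}$ is read as $1$. *)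

theory Defs
  imports "HOL-Analysis.Analysis"
begin

definition partial_deriv ::
  "('a::euclidean_space \<Rightarrow> 'b::real_normed_vector) \<Rightarrow> 'a \<Rightarrow> 'a \<Rightarrow> 'b" where
  "partial_deriv f b p = vector_derivative (\<lambda>t. f (p + t *\<^sub>R b)) (at 0)"

definition real_gradient :: "('a::euclidean_space \<Rightarrow> real) \<Rightarrow> 'a \<Rightarrow> 'a" where
  "real_gradient f p = (\<Sum>b\<in>Basis. partial_deriv f b p *\<^sub>R b)"

text \<open>
  Points of \<open>\<complex>\<^sup>k \<times> \<complex>\<close> are pairs of type \<open>(complex ^ 'k) \<times> complex\<close> with \<open>CARD('k) = k\<close>.
  The \<open>n = k + 1\<close> complex coordinates are indexed by \<open>'k option\<close>: the index \<open>Some j\<close> stands for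
  \<open>z\<^sub>j\<close> and \<open>None\<close> for \<open>w\<close>. \<open>coord_vec i c\<close> is \<open>c\<close> times the \<open>i\<close>-th complex coordinate vector.
\<close>

fun coord_vec :: "'k::finite option \<Rightarrow> complex \<Rightarrow> (complex ^ 'k) \<times> complex" where
  "coord_vec (Some j) c = (axis j c, 0)"
| "coord_vec None c = (0, c)"

definition d_hol ::
  "'k::finite option \<Rightarrow> ((complex ^ 'k) \<times> complex \<Rightarrow> complex) \<Rightarrow> (complex ^ 'k) \<times> complex \<Rightarrow> complex"
  where
  "d_hol i f p =
     (partial_deriv f (coord_vec i 1) p - \<i> * partial_deriv f (coord_vec i \<i>) p) / 2"

definition d_antihol ::
  "'k::finite option \<Rightarrow> ((complex ^ 'k) \<times> complex \<Rightarrow> complex) \<Rightarrow> (complex ^ 'k) \<times> complex \<Rightarrow> complex"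
  where
  "d_antihol i f p =
     (partial_deriv f (coord_vec i 1) p + \<i> * partial_deriv f (coord_vec i \<i>) p) / 2"

text \<open>
  The \<open>n + 1\<close> rows and columns are indexed by \<open>'k option option\<close>; the outer \<open>None\<close> is the border.
\<close>

definition bordered_hessian ::
  "((complex ^ 'k::finite) \<times> complex \<Rightarrow> real) \<Rightarrow> (complex ^ 'k) \<times> complex
     \<Rightarrow> complex ^ 'k option option ^ 'k option option" where
  "bordered_hessian \<rho> p =
     (let \<rho>c = (\<lambda>q. complex_of_real (\<rho> q)) in
      \<chi> r c. case (r, c) of
          (None, None) \<Rightarrow> 0
        | (None, Some j) \<Rightarrow> d_antihol j \<rho>c p
        | (Some i, None) \<Rightarrow> d_hol i \<rho>c p
        | (Some i, Some j) \<Rightarrow> d_hol i (d_antihol j \<rho>c) p)"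

definition fefferman_M ::
  "((complex ^ 'k::finite) \<times> complex \<Rightarrow> real) \<Rightarrow> (complex ^ 'k) \<times> complex \<Rightarrow> complex" where
  "fefferman_M \<rho> p = - det (bordered_hessian \<rho> p)"

text \<open>
  Lebesgue measure of the coordinate hyperplane orthogonal to \<open>b \<in> Basis\<close>, as a Borel measure on
  the whole space concentrated on that hyperplane.
\<close>

definition hyperplane_lborel :: "'a::euclidean_space \<Rightarrow> 'a measure" where
  "hyperplane_lborel b =
     distr (\<Pi>\<^sub>M i\<in>Basis - {b}. lborel) borel (\<lambda>f. \<Sum>i\<in>Basis - {b}. f i *\<^sub>R i)"

text \<open>
  A triple \<open>(b, U, g)\<close> describes the graph \<open>{x + g x *\<^sub>R b | x \<in> U, x \<bullet> b = 0}\<close> of a \<open>C\<^sup>1\<close> function over an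
  open piece of the hyperplane orthogonal to \<open>b\<close>. Only the values of \<open>g\<close> on that piece matter;
  letting \<open>g\<close> live on an open subset of the whole space is no restriction (extend it constantly
  along \<open>b\<close>).
\<close>

definition graph_patches ::
  "'a::euclidean_space set \<Rightarrow> ('a \<times> 'a set \<times> ('a \<Rightarrow> real)) set" where
  "graph_patches S =
     {(b, U, g). b \<in> Basis \<and> open U \<and>
        g differentiable_on U \<and> (\<forall>i\<in>Basis. continuous_on U (partial_deriv g i)) \<and>
        (\<forall>x\<in>U. x \<bullet> b = 0 \<longrightarrow> x + g x *\<^sub>R b \<in> S)}"

text \<open>Surface area on such a graph: \<open>d\<sigma> = sqrt (1 + |\<nabla>g|\<^sup>2) dx\<close>.\<close>

definition graph_area_measure ::
  "'a::euclidean_space \<Rightarrow> 'a set \<Rightarrow> ('a \<Rightarrow> real) \<Rightarrow> 'a measure" where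
  "graph_area_measure b U g =
     distr
       (density (restrict_space (hyperplane_lborel b) U)
          (\<lambda>x. ennreal (sqrt (1 + (\<Sum>i\<in>Basis - {b}. (partial_deriv g i x)\<^sup>2)))))
       borel (\<lambda>x. x + g x *\<^sub>R b)"

text \<open>
  The surface measure of a \<open>C\<^sup>1\<close> hypersurface \<open>S\<close>, as a Borel measure on the ambient space
  concentrated on \<open>S\<close>. Near each point \<open>S\<close> is a \<open>C\<^sup>1\<close> graph over a coordinate hyperplane, and the
  area measures of two such graphs agree on the overlap. Hence their supremum in the complete
  lattice of measures glues them: it restricts to \<open>graph_area_measure b U g\<close> on every graph
  contained in \<open>S\<close>.
\<close>

definition hypersurface_measure :: "'a::euclidean_space set \<Rightarrow> 'a measure" where
  "hypersurface_measure S = (SUP (b, U, g)\<in>graph_patches S. graph_area_measure b U g)"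

text \<open>
  \<open>n = CARD('k option)\<close>. \<open>Re\<close> is only a coercion to the reals; \<open>fefferman_M \<rho> p\<close> is real for
  smooth \<open>\<rho>\<close> since its bordered Hessian is Hermitian.
\<close>

definition fefferman_measure ::
  "((complex ^ 'k::finite) \<times> complex) set \<Rightarrow> ((complex ^ 'k) \<times> complex \<Rightarrow> real)
     \<Rightarrow> ((complex ^ 'k) \<times> complex) measure" where
  "fefferman_measure S \<rho> =
     density (hypersurface_measure S)
       (\<lambda>p. ennreal (Re (fefferman_M \<rho> p) powr (1 / (real CARD('k option) + 1))
                       / norm (real_gradient \<rho> p)))"

text \<open>
  \<open>B \<mapsto> \<mu> (\<Phi> ` B)\<close> on the measurable space of \<open>N\<close>, for \<open>\<Phi>\<close> injective up to null sets. The completion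
  is needed because \<open>\<Phi> ` B\<close> need not be Borel where \<open>\<Phi>\<close> collapses fibres (onto null sets).
\<close>

definition pullback_measure ::
  "('a \<Rightarrow> 'b) \<Rightarrow> 'a measure \<Rightarrow> 'b measure \<Rightarrow> 'a measure" where
  "pullback_measure \<Phi> N \<mu> =
     measure_of (space N) (sets N) (\<lambda>B. emeasure (completion \<mu>) (\<Phi> ` B))"

definition egg :: "nat \<Rightarrow> ((complex ^ 'k::finite) \<times> complex) set" where
  "egg m = {(z, w). (norm z)\<^sup>2 + norm w ^ (2 * m) < 1}"

definition egg_rho :: "nat \<Rightarrow> (complex ^ 'k::finite) \<times> complex \<Rightarrow> real" where
  "egg_rho m = (\<lambda>(z, w). (norm z)\<^sup>2 + norm w ^ (2 * m) - 1)"

definition egg_param ::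
  "nat \<Rightarrow> (complex ^ 'k::finite) \<times> real \<times> real \<Rightarrow> (complex ^ 'k) \<times> complex" where
  "egg_param m = (\<lambda>(\<xi>, r, \<theta>). (sqrt (1 - r ^ (2 * m)) *\<^sub>R \<xi>, of_real r * cis \<theta>))"

text \<open>
  The product measure \<open>d\<sigma>(\<xi>) dr d\<theta>\<close> on \<open>S\<^sup>2\<^sup>k\<^sup>-\<^sup>1 \<times> [0,1] \<times> \<real>/2\<pi>\<int>\<close>, with the fundamental domain
  \<open>[0, 2\<pi>)\<close> in place of \<open>\<real>/2\<pi>\<int>\<close>.
\<close>

definition egg_param_measure :: "((complex ^ 'k::finite) \<times> real \<times> real) measure" where
  "egg_param_measure =
     restrict_space (hypersurface_measure (sphere 0 1)) (sphere 0 1) \<Otimes>\<^sub>M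
       (restrict_space lborel {0..1} \<Otimes>\<^sub>M restrict_space lborel {0..<2 * pi})"

end

theory Submission
  imports Defs
begin

text \<open>
  A surface measure given as a supremum over graphs is made accessible through a cone measure. Let
  \<open>S\<close> be the level set \<open>|Px|\<^sup>2 + q x = 1\<close>, where \<open>P\<close> projects onto some of the coordinates and \<open>q\<close>
  depends only on the others. Scaling the coordinates seen by \<open>P\<close> turns each \<open>B \<subseteq> S\<close> into a cone, and
  the Lebesgue measure of that cone can be computed over any graph contained in \<open>S\<close> by a
  one-dimensional substitution along the direction of the graph: it is the integral over \<open>B\<close> of
  \<open>2 |Px|\<^sup>2 / |\<nabla>\<rho>|\<close> against surface area, divided by the rank of \<open>P\<close>. Hence the area measures of
  all graphs are restrictions of one measure, and so is their supremum.

  The unit sphere of \<open>\<complex>\<^sup>k\<close> is the case \<open>P = id\<close>, \<open>q = 0\<close>, and \<open>\<partial>E\<close> is the case \<open>P (z, w) = (z, 0)\<close>,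
  \<open>q (z, w) = |w|\<^sup>2\<^sup>m\<close>. Slicing the cone over a subset of \<open>\<partial>E\<close> at fixed \<open>w\<close> gives cones over subsets of
  the sphere, so \<open>d\<sigma> / |\<nabla>\<rho>|\<close> becomes \<open>(1 - |w|\<^sup>2\<^sup>m)\<^sup>k\<^sup>-\<^sup>1 / 2\<close> times \<open>d\<sigma>(\<xi>) dw\<close>; polar coordinates in
  \<open>w\<close> finish the computation. The determinant is a bordered diagonal one.
\<close>

section \<open>Change of variables on the line\<close>

text \<open>A supremum over all graphs gives no formula for its value, and comparing two graphs over
  different hyperplanes directly would require their transition map. The volume of a cone does not
  depend on how its base is described, so every graph is compared with the same
  \<open>cone_measure\<close>; all substitutions then take place on lines, and injectivity is read
  off from \<open>cyl_gauge\<close>. Dilating only z keeps q constant along the rays, which makes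
  the level set homogeneous although different powers of |z| and |w| occur in it. The price is that
  the cones degenerate where z = 0. That set has no area: the z-block has at least two real
  coordinates, so every graph direction leaves another coordinate of z, which vanishes only on a
  null set. The gradient length enters the surface area and, inverted, the Fefferman measure, so it
  cancels and leaves the power of M over 2 |z|^2. Since |z| = R there, the exponent k - 1 is what
  remains of R^(2k), the volume factor of a ball in z-space, after division by R^2.\<close>

lemma emeasure_differentiable_inj_image:
  fixes h h' :: "real \<Rightarrow> real"
  assumes X: "X \<in> sets borel"
    and deriv: "\<And>t. t \<in> X \<Longrightarrow> (h has_field_derivative h' t) (at t within X)"
    and inj: "inj_on h X"
    and meas: "(\<lambda>t. indicator X t * h' t) \<in> borel_measurable borel"
  shows "emeasure lebesgue (h ` X) = (\<integral>\<^sup>+t. indicator X t * ennreal \<bar>h' t\<bar> \<partial>lborel)"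
proof -
  have X': "X \<in> sets lebesgue"
    using X by simp
  have "h differentiable_on X"
    using deriv by (auto simp: differentiable_on_def intro: differentiableI has_field_derivative_imp_has_derivative)
  then have hX: "h ` X \<in> sets lebesgue"
    by (intro differentiable_image_in_sets_lebesgue[OF X']) auto
  note cov = has_absolute_integral_change_of_variables_1'[OF X' deriv inj, where f = "\<lambda>_. 1", simplified]
  have ind: "indicator X t * ennreal \<bar>h' t\<bar> = ennreal (norm (indicator X t * h' t))" for t
    by (auto simp: indicator_def)
  show ?thesis
  proof (cases "h ` X \<in> lmeasurable")
    case True
    then have "(\<lambda>_. 1 :: real) absolutely_integrable_on h ` X"
      using absolutely_integrable_on_const by blast
    then have *: "(\<lambda>t. \<bar>h' t\<bar>) absolutely_integrable_on X"
      and "integral X (\<lambda>t. \<bar>h' t\<bar>) = integral (h ` X) (\<lambda>_. 1)"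
      using cov by blast+
    then have eq: "integral X (\<lambda>t. \<bar>h' t\<bar>) = measure lebesgue (h ` X)"
      using lmeasure_integral[OF True] by simp
    have "((\<lambda>t. \<bar>h' t\<bar>) has_integral measure lebesgue (h ` X)) X"
      using * eq by (metis integrable_integral set_lebesgue_integral_eq_integral(1))
    then have "(\<integral>\<^sup>+t. ennreal \<bar>h' t\<bar> * indicator X t \<partial>lborel) = ennreal (measure lebesgue (h ` X))"
      by (rule nn_integral_has_integral_lebesgue'[rotated]) simp
    moreover have "emeasure lebesgue (h ` X) = ennreal (measure lebesgue (h ` X))"
      using True by (intro emeasure_eq_ennreal_measure) (auto simp: fmeasurable_def)
    ultimately show ?thesis
      by (simp add: mult.commute)
  next
    \<comment> \<open>The image now has infinite measure. \<open>cov\<close> is an equivalence of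
      integrability, so a finite right-hand side would make the constant 1 integrable over the
      image; hence both sides are infinite.\<close>
    case False
    have "(\<integral>\<^sup>+t. indicator X t * ennreal \<bar>h' t\<bar> \<partial>lborel) = \<infinity>"
    proof (rule ccontr)
      assume "\<not> ?thesis"
      then have "integrable lborel (\<lambda>t. indicator X t * h' t)"
        using meas by (intro integrableI_bounded) (auto simp: ind top.not_eq_extremum)
      then have "integrable lebesgue (\<lambda>t. indicator X t * h' t)"
        using integrable_completion by (metis borel_measurable_integrable)
      then have "h' absolutely_integrable_on X"
        by (simp add: set_integrable_def)
      then have "(\<lambda>t. \<bar>h' t\<bar>) absolutely_integrable_on X"
        by (rule set_integrable_abs)
      then have "(\<lambda>_. 1 :: real) absolutely_integrable_on h ` X"
        using cov by blast
      then have "h ` X \<in> lmeasurable"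
        by (simp add: lmeasurable_iff_integrable set_integrable_def)
      with False show False by simp
    qed
    moreover have "emeasure lebesgue (h ` X) = \<infinity>"
      using False hX by (auto simp: fmeasurable_def less_top[symmetric])
    ultimately show ?thesis by simp
  qed
qed

text \<open>It suffices to compare two measures on Borel sets E: Lebesgue measure on the image of
  \<open>A\<close>, and the push-forward of the density |h'| on \<open>A\<close>. For each E the
  preceding lemma applies to the part of \<open>A\<close> that \<open>h\<close> carries into E.
  \<open>h0\<close> stands in for \<open>h\<close> because nothing is known about \<open>h\<close>
  off \<open>A\<close>.\<close>

lemma nn_integral_differentiable_inj_image:
  fixes h h' :: "real \<Rightarrow> real" and F :: "real \<Rightarrow> ennreal"
  assumes A: "A \<in> sets borel"
    and deriv: "\<And>t. t \<in> A \<Longrightarrow> (h has_field_derivative h' t) (at t within A)"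
    and inj: "inj_on h A"
    and meas: "(\<lambda>t. indicator A t * h' t) \<in> borel_measurable borel"
    and hA[measurable]: "h ` A \<in> sets borel"
    and F[measurable]: "F \<in> borel_measurable borel"
  shows "(\<integral>\<^sup>+s. indicator (h ` A) s * F s \<partial>lborel)
       = (\<integral>\<^sup>+t. indicator A t * (ennreal \<bar>h' t\<bar> * F (h t)) \<partial>lborel)"
proof -
  define h0 where "h0 = (\<lambda>t. if t \<in> A then h t else 0)"
  have "continuous_on A h"
    using deriv by (meson DERIV_continuous continuous_on_eq_continuous_within)
  then have h0[measurable]: "h0 \<in> borel_measurable borel"
    unfolding h0_def using A
    by (subst measurable_If_restrict_space_iff) (auto intro: borel_measurable_continuous_on_restrict)
  have ind: "indicator A t * ennreal \<bar>h' t\<bar> = ennreal \<bar>indicator A t * h' t\<bar>" for t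
    by (auto simp: indicator_def)
  have w[measurable]: "(\<lambda>t. indicator A t * ennreal \<bar>h' t\<bar>) \<in> borel_measurable borel"
    unfolding ind using meas by measurable
  have "density lborel (indicator (h ` A)) =
        distr (density lborel (\<lambda>t. indicator A t * ennreal \<bar>h' t\<bar>)) borel h0"
  proof (rule measure_eqI)
    fix E assume "E \<in> sets (density lborel (indicator (h ` A)))"
    then have E[measurable]: "E \<in> sets borel" by simp
    define X where "X = A \<inter> h0 -` E"
    have X: "X \<in> sets borel"
      unfolding X_def using A measurable_sets[OF h0 E] by simp
    have hX: "h ` X = h ` A \<inter> E"
      by (auto simp: X_def h0_def)
    have "X \<subseteq> A" by (auto simp: X_def)
    have "emeasure (density lborel (indicator (h ` A))) E = emeasure lborel (h ` X)"
      by (simp add: emeasure_density hX flip: indicator_inter_arith)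
    also have "\<dots> = emeasure lebesgue (h ` X)"
      by (simp add: hX)
    also have "\<dots> = (\<integral>\<^sup>+t. indicator X t * ennreal \<bar>h' t\<bar> \<partial>lborel)"
    proof (rule emeasure_differentiable_inj_image[OF X])
      show "(h has_field_derivative h' t) (at t within X)" if "t \<in> X" for t
        using that \<open>X \<subseteq> A\<close> deriv DERIV_subset by blast
      show "inj_on h X"
        using inj \<open>X \<subseteq> A\<close> inj_on_subset by blast
      have "(\<lambda>t. indicator X t * h' t) = (\<lambda>t. indicator X t * (indicator A t * h' t))"
        using \<open>X \<subseteq> A\<close> by (auto simp: indicator_def fun_eq_iff)
      then show "(\<lambda>t. indicator X t * h' t) \<in> borel_measurable borel"
        using X meas by simp
    qed
    also have "\<dots> = (\<integral>\<^sup>+t. indicator A t * ennreal \<bar>h' t\<bar> * indicator E (h0 t) \<partial>lborel)"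
      by (intro nn_integral_cong) (auto simp: X_def indicator_def)
    also have "\<dots> = emeasure (distr (density lborel (\<lambda>t. indicator A t * ennreal \<bar>h' t\<bar>)) borel h0) E"
      using measurable_sets[OF h0 E]
      by (simp add: emeasure_distr emeasure_density) (auto intro!: nn_integral_cong simp: indicator_def)
    finally show "emeasure (density lborel (indicator (h ` A))) E = \<dots>" .
  qed simp
  then have "(\<integral>\<^sup>+s. F s \<partial>density lborel (indicator (h ` A))) =
     (\<integral>\<^sup>+s. F s \<partial>distr (density lborel (\<lambda>t. indicator A t * ennreal \<bar>h' t\<bar>)) borel h0)"
    by simp
  then show ?thesis
    by (simp add: nn_integral_density nn_integral_distr)
       (auto intro!: nn_integral_cong simp: h0_def indicator_def)
qed

text \<open>This is the integral along the rays of a cone when n coordinates are dilated; the factor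
  in \<open>cone_measure\<close> is chosen to cancel it.\<close>

lemma nn_integral_power_unit: "0 < n \<Longrightarrow>
  of_nat n * (\<integral>\<^sup>+t. indicator {0<..<1} t * ennreal (t ^ (n - 1)) \<partial>lborel) = 1"
proof -
  assume n: "0 < n"
  have "(\<integral>\<^sup>+t. indicator {0<..<1} t * ennreal (t ^ (n - 1)) \<partial>lborel)
     = (\<integral>\<^sup>+t. ennreal (t ^ (n - 1)) * indicator {0..1} t \<partial>lborel)"
  proof (rule nn_integral_cong_AE)
    show "AE t in lborel. indicator {0<..<1} t * ennreal (t ^ (n - 1)) = ennreal (t ^ (n - 1)) * indicator {0..1} t"
      using AE_lborel_singleton[of "0::real"] AE_lborel_singleton[of "1::real"]
      by eventually_elim (auto simp: indicator_def)
  qed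
  also have "\<dots> = ennreal (1 ^ n / n - 0 ^ n / n)"
    using n
    by (intro nn_integral_FTC_Icc) (auto intro!: derivative_eq_intros simp: has_real_derivative_iff_has_vector_derivative[symmetric])
  also have "\<dots> = ennreal (1 / n)"
    using n by (simp add: power_0_left)
  finally show ?thesis
    using n by (simp add: ennreal_of_nat_eq_real_of_nat flip: ennreal_mult')
qed

section \<open>Lebesgue measure on coordinate hyperplanes\<close>

definition hyper_proj :: "'a::euclidean_space \<Rightarrow> 'a \<Rightarrow> 'a" where
  "hyper_proj b x = x - (x \<bullet> b) *\<^sub>R b"

lemma hyper_proj_inner: "b \<in> Basis \<Longrightarrow> i \<in> Basis \<Longrightarrow> hyper_proj b x \<bullet> i = (if i = b then 0 else x \<bullet> i)"
  by (auto simp: hyper_proj_def inner_diff_left inner_Basis)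

lemma borel_measurable_hyper_proj [measurable]: "hyper_proj b \<in> borel_measurable borel"
  unfolding hyper_proj_def by measurable

lemma sets_hyperplane_lborel [simp, measurable_cong]: "sets (hyperplane_lborel b) = sets borel"
  by (simp add: hyperplane_lborel_def)

lemma space_hyperplane_lborel [simp]: "space (hyperplane_lborel b) = UNIV"
  by (simp add: hyperplane_lborel_def)

lemma lborel_eq_distr_PiM: 
  "(lborel :: 'a::euclidean_space measure) = distr (\<Pi>\<^sub>M b\<in>Basis. lborel) borel (\<lambda>f. \<Sum>b\<in>Basis. f b *\<^sub>R b)"
  by (subst lborel_def) (simp add: lborel_eq_real)

lemma nn_integral_lborel_hyperplane:
  fixes b :: "'a::euclidean_space" and F :: "'a \<Rightarrow> ennreal"
  assumes b: "b \<in> Basis" and F[measurable]: "F \<in> borel_measurable borel"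
  shows "(\<integral>\<^sup>+x. F x \<partial>lborel) = (\<integral>\<^sup>+y. (\<integral>\<^sup>+s. F (y + s *\<^sub>R b) \<partial>lborel) \<partial>hyperplane_lborel b)"
proof -
  interpret product_sigma_finite "\<lambda>_::'a. lborel :: real measure" ..
  have B: "insert b (Basis - {b}) = Basis" using b by auto
  have "(\<integral>\<^sup>+x. F x \<partial>lborel) = (\<integral>\<^sup>+f. F (\<Sum>i\<in>Basis. f i *\<^sub>R i) \<partial>(\<Pi>\<^sub>M i\<in>insert b (Basis - {b}). lborel))"
    unfolding B by (subst lborel_eq_distr_PiM) (simp add: nn_integral_distr)
  also have "\<dots> = (\<integral>\<^sup>+f. (\<integral>\<^sup>+s. F (\<Sum>i\<in>Basis. (f(b := s)) i *\<^sub>R i) \<partial>lborel) \<partial>(\<Pi>\<^sub>M i\<in>Basis - {b}. lborel))"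
    by (rule product_nn_integral_insert) (auto simp: B)
  also have "\<dots> = (\<integral>\<^sup>+f. (\<integral>\<^sup>+s. F ((\<Sum>i\<in>Basis - {b}. f i *\<^sub>R i) + s *\<^sub>R b) \<partial>lborel) \<partial>(\<Pi>\<^sub>M i\<in>Basis - {b}. lborel))"
  proof -
    have "(\<Sum>i\<in>Basis. (f(b := s)) i *\<^sub>R i) = (\<Sum>i\<in>Basis - {b}. f i *\<^sub>R i) + s *\<^sub>R b" for f s
      using b by (subst sum.remove[of _ b]) (auto simp: add.commute intro!: sum.cong)
    then show ?thesis by simp
  qed
  also have "\<dots> = (\<integral>\<^sup>+y. (\<integral>\<^sup>+s. F (y + s *\<^sub>R b) \<partial>lborel) \<partial>hyperplane_lborel b)"
    unfolding hyperplane_lborel_def by (subst nn_integral_distr) auto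
  finally show ?thesis .
qed

lemma AE_hyperplane_lborel: "b \<in> Basis \<Longrightarrow> AE y in hyperplane_lborel b. y \<bullet> b = 0"
  unfolding hyperplane_lborel_def
  by (subst AE_distr_iff) (auto simp: inner_sum_left inner_Basis intro!: sum.neutral)

text \<open>Thickening the hyperplane by a unit interval in direction \<open>b\<close> costs the
  factor 1. Integrals over the hyperplane thereby become integrals against \<open>lborel\<close>,
  from which they inherit Fubini and the scaling law.\<close>

lemma nn_integral_hyperplane_lborel:
  fixes b :: "'a::euclidean_space" and F :: "'a \<Rightarrow> ennreal"
  assumes b: "b \<in> Basis" and F[measurable]: "F \<in> borel_measurable borel"
  shows "(\<integral>\<^sup>+y. F y \<partial>hyperplane_lborel b)
       = (\<integral>\<^sup>+x. indicator {0..1} (x \<bullet> b) * F (hyper_proj b x) \<partial>lborel)"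
proof -
  have "(\<integral>\<^sup>+x. indicator {0..1} (x \<bullet> b) * F (hyper_proj b x) \<partial>lborel) =
    (\<integral>\<^sup>+y. (\<integral>\<^sup>+s. indicator {0..1} ((y + s *\<^sub>R b) \<bullet> b) * F (hyper_proj b (y + s *\<^sub>R b)) \<partial>lborel) \<partial>hyperplane_lborel b)"
    by (rule nn_integral_lborel_hyperplane[OF b]) measurable
  also have "\<dots> = (\<integral>\<^sup>+y. (\<integral>\<^sup>+s. indicator {0..1::real} s * F y \<partial>lborel) \<partial>hyperplane_lborel b)"
    using AE_hyperplane_lborel[OF b] b
    by (intro nn_integral_cong_AE) (auto simp: hyper_proj_def inner_add_left)
  also have "\<dots> = (\<integral>\<^sup>+y. F y \<partial>hyperplane_lborel b)"
    by (intro nn_integral_cong) (simp add: nn_integral_multc)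
  finally show ?thesis ..
qed

lemma nn_integral_hyperplane_Fubini:
  fixes b :: "'a::euclidean_space" and F :: "'a \<Rightarrow> real \<Rightarrow> ennreal"
  assumes b: "b \<in> Basis" and F[measurable]: "case_prod F \<in> borel_measurable (borel \<Otimes>\<^sub>M borel)"
  shows "(\<integral>\<^sup>+y. (\<integral>\<^sup>+t. F y t \<partial>lborel) \<partial>hyperplane_lborel b)
       = (\<integral>\<^sup>+t. (\<integral>\<^sup>+y. F y t \<partial>hyperplane_lborel b) \<partial>lborel)"
proof -
  have "(\<integral>\<^sup>+y. (\<integral>\<^sup>+t. F y t \<partial>lborel) \<partial>hyperplane_lborel b)
     = (\<integral>\<^sup>+x. (\<integral>\<^sup>+t. indicator {0..1} (x \<bullet> b) * F (hyper_proj b x) t \<partial>lborel) \<partial>lborel)"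
    by (simp add: nn_integral_hyperplane_lborel[OF b] nn_integral_cmult)
  also have "\<dots> = (\<integral>\<^sup>+t. (\<integral>\<^sup>+x. indicator {0..1} (x \<bullet> b) * F (hyper_proj b x) t \<partial>lborel) \<partial>lborel)"
    by (rule lborel_pair.Fubini') measurable
  also have "\<dots> = (\<integral>\<^sup>+t. (\<integral>\<^sup>+y. F y t \<partial>hyperplane_lborel b) \<partial>lborel)"
    by (simp add: nn_integral_hyperplane_lborel[OF b])
  finally show ?thesis .
qed

lemma AE_hyperplane_lborel_inner_neq_0:
  assumes b: "b \<in> Basis" and i: "i \<in> Basis" "i \<noteq> b"
  shows "AE y in hyperplane_lborel b. y \<bullet> i \<noteq> 0"
proof (rule AE_I')
  let ?N = "{y. y \<bullet> i = 0}"
  have meas[measurable]: "?N \<in> sets borel" by measurable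
  have null: "AE x in lborel. x \<bullet> i \<noteq> 0"
    using AE_lborel_inner_neq[OF i(1), of 0] .
  have "emeasure (hyperplane_lborel b) ?N = (\<integral>\<^sup>+y. indicator ?N y \<partial>hyperplane_lborel b)"
    by (simp add: nn_integral_indicator)
  also have "\<dots> = (\<integral>\<^sup>+x. indicator {0..1} (x \<bullet> b) * indicator ?N (hyper_proj b x) \<partial>lborel)"
    by (rule nn_integral_hyperplane_lborel[OF b]) measurable
  also have "\<dots> = (\<integral>\<^sup>+x. 0 \<partial>(lborel::'a measure))"
    by (rule nn_integral_cong_AE) (use null in \<open>auto simp: hyper_proj_inner[OF b i(1)] i(2)\<close>)
  finally show "?N \<in> null_sets (hyperplane_lborel b)"
    by (intro null_setsI) auto
qed auto

section \<open>Cone measures\<close>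

lemma partial_deriv_has_derivative:
  assumes "(f has_derivative f') (at p)"
  shows "partial_deriv f b p = f' b"
proof -
  have "((\<lambda>t. p + t *\<^sub>R b) has_derivative (\<lambda>t. t *\<^sub>R b)) (at 0)"
    by (rule has_derivative_eq_rhs, rule has_derivative_add[OF has_derivative_const has_derivative_scaleR_left[OF has_derivative_ident]]) simp
  from has_derivative_compose[OF this, of f f'] assms
  have "((\<lambda>t. f (p + t *\<^sub>R b)) has_derivative (\<lambda>t. f' (t *\<^sub>R b))) (at 0)"
    by simp
  then have "((\<lambda>t. f (p + t *\<^sub>R b)) has_vector_derivative f' b) (at 0)"
    using linear_scale[OF has_derivative_linear[OF assms]] by (simp add: has_vector_derivative_def)
  then show ?thesis
    by (simp add: partial_deriv_def vector_derivative_at)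
qed

lemma has_derivative_partial_deriv:
  assumes "f differentiable (at p)"
  shows "(f has_derivative (\<lambda>v. \<Sum>i\<in>Basis. (v \<bullet> i) *\<^sub>R partial_deriv f i p)) (at p)"
proof -
  from assms obtain f' where f': "(f has_derivative f') (at p)"
    by (auto simp: differentiable_def)
  have "f' v = (\<Sum>i\<in>Basis. (v \<bullet> i) *\<^sub>R partial_deriv f i p)" for v
  proof -
    have "f' v = f' (\<Sum>i\<in>Basis. (v \<bullet> i) *\<^sub>R i)"
      by (simp add: euclidean_representation)
    also have "\<dots> = (\<Sum>i\<in>Basis. f' ((v \<bullet> i) *\<^sub>R i))"
      by (rule linear_sum[OF has_derivative_linear[OF f']])
    also have "\<dots> = (\<Sum>i\<in>Basis. (v \<bullet> i) *\<^sub>R f' i)"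
      by (simp only: linear_scale[OF has_derivative_linear[OF f']])
    finally show ?thesis
      by (simp only: partial_deriv_has_derivative[OF f'])
  qed
  then have "f' = (\<lambda>v. \<Sum>i\<in>Basis. (v \<bullet> i) *\<^sub>R partial_deriv f i p)" by auto
  with f' show ?thesis by simp
qed

text \<open>By \<open>q_cong\<close>, dilating the coordinates in \<open>I\<close> leaves
  \<open>q\<close> unchanged. Two coordinates in \<open>I\<close> guarantee that for every graph
  direction another one remains. The derivative conditions make the defining function continuously
  differentiable, so that the explicit sheets of its level set are admissible patches.\<close>

locale cylindrical =
  fixes I :: "'a::euclidean_space set" and q :: "'a \<Rightarrow> real"
  assumes I: "I \<subseteq> Basis" and card_I: "2 \<le> card I"
    and q_cong: "\<And>x y. (\<And>i. i \<in> Basis - I \<Longrightarrow> x \<bullet> i = y \<bullet> i) \<Longrightarrow> q x = q y"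
    and q_differentiable: "\<And>x. q differentiable (at x)"
    and q_partial_continuous: "\<And>i. i \<in> Basis \<Longrightarrow> continuous_on UNIV (partial_deriv q i)"
begin

text \<open>
  \<open>cyl_gauge\<close> is homogeneous of degree one under \<open>dil\<close> and equals \<open>1\<close> exactly on the part of the
  hypersurface in \<open>cyl_dom\<close>, so \<open>radial\<close> projects \<open>cyl_dom\<close> onto that part. Outside \<open>cyl_dom\<close> both have
  junk values.
\<close>

definition proj :: "'a \<Rightarrow> 'a" where "proj x = (\<Sum>i\<in>I. (x \<bullet> i) *\<^sub>R i)"
definition dil :: "real \<Rightarrow> 'a \<Rightarrow> 'a" where "dil t x = t *\<^sub>R proj x + (x - proj x)"
definition rho :: "'a \<Rightarrow> real" where "rho x = (norm (proj x))\<^sup>2 + q x - 1"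
definition cyl_dom :: "'a set" where "cyl_dom = {x. proj x \<noteq> 0 \<and> q x < 1}"
definition cyl_gauge :: "'a \<Rightarrow> real" where "cyl_gauge x = norm (proj x) / sqrt (1 - q x)"
definition radial :: "'a \<Rightarrow> 'a" where "radial x = dil (1 / cyl_gauge x) x"
definition unit_dom :: "'a set" where "unit_dom = {x \<in> cyl_dom. cyl_gauge x < 1}"
text \<open>Along the rays of a cone the volume grows like t^(card I - 1), whose integral over the
  unit interval is 1 / card I. The factor \<open>card I\<close> cancels this, so that
  \<open>area_density\<close> carries no dimensional constant.\<close>

definition cone_measure :: "'a measure" where
  "cone_measure = distr (density lborel (\<lambda>x. of_nat (card I) * indicator unit_dom x)) borel radial"

lemma finite_I: "finite I"
  using I finite_Basis finite_subset by blast

lemma proj_inner: "i \<in> Basis \<Longrightarrow> proj x \<bullet> i = (if i \<in> I then x \<bullet> i else 0)"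
proof -
  assume i: "i \<in> Basis"
  have "proj x \<bullet> i = (\<Sum>j\<in>I. if j = i then x \<bullet> j else 0)"
    unfolding proj_def inner_sum_left using I i by (intro sum.cong) (auto simp: inner_Basis)
  then show ?thesis by (simp add: finite_I)
qed

lemma borel_measurable_proj [measurable]: "proj \<in> borel_measurable borel"
  unfolding proj_def by measurable

lemma dil_inner: "i \<in> Basis \<Longrightarrow> dil t x \<bullet> i = (if i \<in> I then t * (x \<bullet> i) else x \<bullet> i)"
  by (simp add: dil_def inner_add_left inner_diff_left proj_inner)

lemma proj_dil: "proj (dil t x) = t *\<^sub>R proj x"
  by (rule euclidean_eqI) (use I in \<open>auto simp: proj_inner dil_inner\<close>)

lemma dil_dil: "dil s (dil t x) = dil (s * t) x"
  by (rule euclidean_eqI) (use I in \<open>auto simp: dil_inner\<close>)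

lemma dil_1 [simp]: "dil 1 x = x"
  by (simp add: dil_def)

lemma dil_scale: "b \<in> Basis \<Longrightarrow> dil t (x + s *\<^sub>R b) = dil t x + ((if b \<in> I then t else 1) * s) *\<^sub>R b"
  by (rule euclidean_eqI) (auto simp: dil_inner inner_add_left inner_Basis algebra_simps)

lemma q_dil: "q (dil t x) = q x"
  by (rule q_cong) (auto simp: dil_inner)

lemma continuous_on_q: "continuous_on A q"
  using q_differentiable by (intro differentiable_imp_continuous_on) (auto simp: differentiable_on_def intro: differentiable_at_withinI)

lemma borel_measurable_q [measurable]: "q \<in> borel_measurable borel"
  by (intro borel_measurable_continuous_onI continuous_on_q)

lemma measurable_dil [measurable]:
  "f \<in> borel_measurable M \<Longrightarrow> g \<in> borel_measurable M \<Longrightarrow> (\<lambda>x. dil (f x) (g x)) \<in> borel_measurable M"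
  unfolding dil_def by (intro borel_measurable_add borel_measurable_scaleR borel_measurable_diff
    measurable_compose[OF _ borel_measurable_proj])

lemma borel_measurable_rho [measurable]: "rho \<in> borel_measurable borel"
  unfolding rho_def by measurable

lemma borel_measurable_cyl_gauge [measurable]: "cyl_gauge \<in> borel_measurable borel"
  unfolding cyl_gauge_def by measurable

lemma borel_measurable_radial [measurable]: "radial \<in> borel_measurable borel"
  unfolding radial_def by measurable

lemma sets_cyl_dom [measurable]: "cyl_dom \<in> sets borel"
  unfolding cyl_dom_def by measurable

lemma sets_unit_dom [measurable]: "unit_dom \<in> sets borel"
  unfolding unit_dom_def by measurable

lemma dil_in_cyl_dom: "x \<in> cyl_dom \<Longrightarrow> t \<noteq> 0 \<Longrightarrow> dil t x \<in> cyl_dom"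
  by (simp add: cyl_dom_def proj_dil q_dil)

lemma cyl_gauge_pos: "x \<in> cyl_dom \<Longrightarrow> 0 < cyl_gauge x"
  by (simp add: cyl_dom_def cyl_gauge_def)

lemma cyl_gauge_dil: "0 < t \<Longrightarrow> cyl_gauge (dil t x) = t * cyl_gauge x"
  by (simp add: cyl_gauge_def proj_dil q_dil)

lemma rho_eq_0_imp_cyl_dom: "rho x = 0 \<Longrightarrow> proj x \<noteq> 0 \<Longrightarrow> x \<in> cyl_dom"
proof -
  assume "rho x = 0" "proj x \<noteq> 0"
  moreover from this have "0 < (norm (proj x))\<^sup>2" by simp
  ultimately have "q x < 1" unfolding rho_def by linarith
  with \<open>proj x \<noteq> 0\<close> show ?thesis by (simp add: cyl_dom_def)
qed

lemma cyl_gauge_eq_1_iff: "x \<in> cyl_dom \<Longrightarrow> cyl_gauge x = 1 \<longleftrightarrow> rho x = 0"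
proof -
  assume x: "x \<in> cyl_dom"
  then have pos: "0 < sqrt (1 - q x)"
    by (simp add: cyl_dom_def)
  then have "cyl_gauge x = 1 \<longleftrightarrow> norm (proj x) = sqrt (1 - q x)"
    by (auto simp: cyl_gauge_def)
  also have "\<dots> \<longleftrightarrow> sqrt ((norm (proj x))\<^sup>2) = sqrt (1 - q x)"
    by simp
  also have "\<dots> \<longleftrightarrow> rho x = 0"
    unfolding real_sqrt_eq_iff rho_def by argo
  finally show ?thesis .
qed

lemma radial_in_cyl_dom: "x \<in> cyl_dom \<Longrightarrow> radial x \<in> cyl_dom"
  using cyl_gauge_pos[of x] by (auto simp: radial_def intro: dil_in_cyl_dom)

lemma rho_radial: "x \<in> cyl_dom \<Longrightarrow> rho (radial x) = 0"
  using cyl_gauge_pos[of x] radial_in_cyl_dom[of x]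
  by (simp flip: cyl_gauge_eq_1_iff) (simp add: radial_def cyl_gauge_dil)

lemma sets_cone_measure [simp, measurable_cong]: "sets cone_measure = sets borel"
  by (simp add: cone_measure_def)

lemma space_cone_measure [simp]: "space cone_measure = UNIV"
  by (simp add: cone_measure_def)

lemma nn_integral_cone_measure:
  assumes [measurable]: "f \<in> borel_measurable borel"
  shows "(\<integral>\<^sup>+x. f x \<partial>cone_measure) =
    of_nat (card I) * (\<integral>\<^sup>+x. indicator unit_dom x * f (radial x) \<partial>lborel)"
  unfolding cone_measure_def
  by (simp add: nn_integral_distr nn_integral_density mult.assoc nn_integral_cmult)

lemma AE_cone_measure: "AE x in cone_measure. x \<in> cyl_dom \<and> rho x = 0"
  unfolding cone_measure_def
  by (simp add: AE_distr_iff AE_density)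
     (auto simp: unit_dom_def indicator_def radial_in_cyl_dom rho_radial)

text \<open>On the hyperplane the dilation scales exactly the coordinates in \<open>I - {b}\<close>,
  which accounts for the power of t.\<close>

lemma nn_integral_hyperplane_dil:
  assumes b: "b \<in> Basis" and t: "0 < t" and F[measurable]: "F \<in> borel_measurable borel"
  shows "(\<integral>\<^sup>+y. F (dil (1 / t) y) \<partial>hyperplane_lborel b)
       = ennreal (t ^ card (I - {b})) * (\<integral>\<^sup>+y. F y \<partial>hyperplane_lborel b)"
proof -
  \<comment> \<open>Coordinate \<open>b\<close> stays unscaled so that the unit interval that
    thickens the hyperplane is preserved.\<close>
  define c where "c = (\<lambda>j. if j \<in> I - {b} then t else 1)"
  define T where "T = (\<lambda>x. 0 + (\<Sum>j\<in>Basis. (c j * (x \<bullet> j)) *\<^sub>R j))"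
  have T_inner: "T x \<bullet> i = c i * (x \<bullet> i)" if "i \<in> Basis" for x i
    using that by (simp add: T_def)
  have T[measurable]: "T \<in> borel_measurable borel"
    unfolding T_def by measurable
  have "(\<Prod>j\<in>Basis. \<bar>c j\<bar>) = (\<Prod>j\<in>I - {b}. t)"
    using I t by (intro prod.mono_neutral_cong_right) (auto simp: c_def)
  then have pr: "(\<Prod>j\<in>Basis. \<bar>c j\<bar>) = t ^ card (I - {b})"
    by simp
  have lb: "lborel = density (distr lborel borel T) (\<lambda>_. ennreal (t ^ card (I - {b})))"
    unfolding pr[symmetric] T_def by (rule lborel_affine_euclidean) (use t in \<open>simp add: c_def\<close>)
  have eq: "dil (1 / t) (hyper_proj b (T x)) = hyper_proj b x" for x
    by (rule euclidean_eqI) (use t b I in \<open>auto simp: dil_inner hyper_proj_inner T_inner c_def\<close>)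
  have "(\<integral>\<^sup>+y. F (dil (1 / t) y) \<partial>hyperplane_lborel b)
    = (\<integral>\<^sup>+x. indicator {0..1} (x \<bullet> b) * F (dil (1 / t) (hyper_proj b x)) \<partial>lborel)"
    by (rule nn_integral_hyperplane_lborel[OF b]) measurable
  also have "\<dots> = (\<integral>\<^sup>+x. ennreal (t ^ card (I - {b})) *
      (indicator {0..1} (T x \<bullet> b) * F (dil (1 / t) (hyper_proj b (T x)))) \<partial>lborel)"
    by (subst lb) (simp add: nn_integral_density nn_integral_distr)
  also have "\<dots> = ennreal (t ^ card (I - {b})) * (\<integral>\<^sup>+x. indicator {0..1} (x \<bullet> b) * F (hyper_proj b x) \<partial>lborel)"
    using b by (subst nn_integral_cmult) (auto simp: eq T_inner c_def)
  also have "\<dots> = ennreal (t ^ card (I - {b})) * (\<integral>\<^sup>+y. F y \<partial>hyperplane_lborel b)"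
    by (simp add: nn_integral_hyperplane_lborel[OF b])
  finally show ?thesis .
qed

end

section \<open>Graphs inside the hypersurface\<close>

locale cylindrical_patch = cylindrical +
  fixes b :: 'a and U :: "'a set" and g :: "'a \<Rightarrow> real"
  assumes patch: "(b, U, g) \<in> graph_patches {x. rho x = 0}"
begin

text \<open>
  Nothing is known about \<open>g\<close> off \<open>U\<close>, hence the extensions by zero. Up to a power of \<open>t\<close>, \<open>jac\<close> is the
  derivative of \<open>t \<mapsto> height y t\<close> below.
\<close>

definition ext :: "('a \<Rightarrow> real) \<Rightarrow> 'a \<Rightarrow> real" where
  "ext f = (\<lambda>x. if x \<in> U then f x else 0)"
definition slope :: "'a \<Rightarrow> 'a \<Rightarrow> real" where
  "slope i = ext (partial_deriv g i)"
definition lift :: "'a \<Rightarrow> 'a" where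
  "lift x = x + ext g x *\<^sub>R b"
definition graph :: "'a set" where
  "graph = {y. hyper_proj b y \<in> U \<and> y \<bullet> b = ext g (hyper_proj b y)}"
definition jac :: "'a \<Rightarrow> real" where
  "jac x = (if b \<in> I then ext g x else 0) - (\<Sum>i\<in>I. (x \<bullet> i) * slope i x)"

lemma b: "b \<in> Basis" and open_U: "open U" and g_differentiable: "g differentiable_on U"
  and g_partial_continuous: "i \<in> Basis \<Longrightarrow> continuous_on U (partial_deriv g i)"
  and rho_on_patch: "x \<in> U \<Longrightarrow> x \<bullet> b = 0 \<Longrightarrow> rho (x + g x *\<^sub>R b) = 0"
  using patch by (auto simp: graph_patches_def)

lemma sets_U [measurable]: "U \<in> sets borel"
  using open_U by simp

lemma borel_measurable_ext: "continuous_on U f \<Longrightarrow> ext f \<in> borel_measurable borel"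
  unfolding ext_def using sets_U
  by (subst measurable_If_restrict_space_iff) (auto intro: borel_measurable_continuous_on_restrict)

lemma borel_measurable_ext_g [measurable]: "ext g \<in> borel_measurable borel"
  using g_differentiable by (intro borel_measurable_ext differentiable_imp_continuous_on)

lemma borel_measurable_slope [measurable]: "i \<in> Basis \<Longrightarrow> slope i \<in> borel_measurable borel"
  unfolding slope_def by (intro borel_measurable_ext g_partial_continuous)

lemma borel_measurable_lift [measurable]: "lift \<in> borel_measurable borel"
  unfolding lift_def by measurable

lemma borel_measurable_jac [measurable]: "jac \<in> borel_measurable borel"
proof -
  have "(\<lambda>x. \<Sum>i\<in>I. (x \<bullet> i) * slope i x) \<in> borel_measurable borel"
    using I by (intro borel_measurable_sum borel_measurable_times) auto
  then show ?thesis
    unfolding jac_def by (intro borel_measurable_diff) auto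
qed

lemma sets_graph [measurable]: "graph \<in> sets borel"
  unfolding graph_def by measurable

lemma lift_eq: "x \<in> U \<Longrightarrow> lift x = x + g x *\<^sub>R b"
  by (simp add: lift_def ext_def)

lemma hyper_proj_lift: "x \<bullet> b = 0 \<Longrightarrow> hyper_proj b (lift x) = x"
  using b by (simp add: hyper_proj_def lift_def inner_add_left)

lemma lift_in_graph_iff: "x \<bullet> b = 0 \<Longrightarrow> lift x \<in> graph \<longleftrightarrow> x \<in> U"
  using b by (simp add: graph_def hyper_proj_lift) (auto simp: lift_def inner_add_left)

lemma lift_hyper_proj: "y \<in> graph \<Longrightarrow> lift (hyper_proj b y) = y"
  by (simp add: graph_def lift_def) (simp add: hyper_proj_def)

lemma rho_lift: "x \<in> U \<Longrightarrow> x \<bullet> b = 0 \<Longrightarrow> rho (lift x) = 0"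
  by (simp add: lift_eq rho_on_patch)

lemma dil_inner_b: "y \<bullet> b = 0 \<Longrightarrow> dil t y \<bullet> b = 0"
  using b by (simp add: dil_inner)

lemma g_has_derivative:
  "x \<in> U \<Longrightarrow> (g has_derivative (\<lambda>v. \<Sum>i\<in>Basis. (v \<bullet> i) *\<^sub>R slope i x)) (at x)"
  using has_derivative_partial_deriv[of g x] g_differentiable open_U
  by (simp add: slope_def ext_def differentiable_on_eq_differentiable_at)

text \<open>If \<open>b\<close> lies in \<open>I\<close>, the dilation multiplies the height by t,
  which cancels the factor 1 / t that the chain rule produces for \<open>dil (1 / t) y\<close>;
  otherwise that factor remains.\<close>

definition weight :: "real \<Rightarrow> real" where "weight t = (if b \<in> I then 1 else 1 / t)"
definition height :: "'a \<Rightarrow> real \<Rightarrow> real" where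
  "height y t = (if b \<in> I then t else 1) * ext g (dil (1 / t) y)"

lemma dil_lift: "0 < t \<Longrightarrow> dil t (lift (dil (1 / t) y)) = y + height y t *\<^sub>R b"
  unfolding lift_def height_def by (simp add: dil_scale[OF b] dil_dil)

lemma height_has_derivative:
  assumes t: "0 < t" and x: "dil (1 / t) y \<in> U"
  shows "(height y has_field_derivative weight t * jac (dil (1 / t) y)) (at t)"
proof -
  define x where "x = dil (1 / t) y"
  define D where "D = (\<Sum>i\<in>I. (x \<bullet> i) * slope i x)"
  have "((\<lambda>s. dil (1 / s) y) has_vector_derivative (- 1 / t\<^sup>2) *\<^sub>R proj y) (at t)"
  proof -
    have "((\<lambda>s. 1 / s) has_field_derivative - 1 / t\<^sup>2) (at t)"
      using t by (auto intro!: derivative_eq_intros simp: power2_eq_square)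
    from has_vector_derivative_add[OF has_vector_derivative_scaleR[OF this has_vector_derivative_const]
        has_vector_derivative_const]
    show ?thesis
      unfolding dil_def by (simp only: scaleR_zero_right add_0_left add_0_right)
  qed
  then have c: "((\<lambda>s. dil (1 / s) y) has_derivative (\<lambda>h. h *\<^sub>R (- 1 / t\<^sup>2) *\<^sub>R proj y)) (at t)"
    by (simp add: has_vector_derivative_def)
  \<comment> \<open>As \<open>proj y\<close> is t times \<open>proj x\<close>, the curve has
    velocity - (1 / t) \<open>proj x\<close> at t, whence the derivative - (D / t) of g along
    it.\<close>
  have py: "proj y \<bullet> i = (if i \<in> I then t * (x \<bullet> i) else 0)" if "i \<in> Basis" for i
    using that t by (auto simp: proj_inner x_def dil_inner)
  have sum_eq: "(\<Sum>i\<in>Basis. ((h *\<^sub>R (- 1 / t\<^sup>2) *\<^sub>R proj y) \<bullet> i) *\<^sub>R slope i x) = - (D / t) * h" for h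
  proof -
    have "(\<Sum>i\<in>Basis. ((h *\<^sub>R (- 1 / t\<^sup>2) *\<^sub>R proj y) \<bullet> i) *\<^sub>R slope i x)
        = (\<Sum>i\<in>I. - (h / t) * ((x \<bullet> i) * slope i x))"
      using I t by (intro sum.mono_neutral_cong_right) (auto simp: py power2_eq_square)
    also have "\<dots> = - (h / t) * D"
      unfolding D_def by (rule sum_distrib_left[symmetric])
    finally show ?thesis
      by simp
  qed
  have g: "((\<lambda>s. g (dil (1 / s) y)) has_field_derivative - (D / t)) (at t)"
    using has_derivative_compose[OF c g_has_derivative[OF x]]
    by (simp only: x_def[symmetric] sum_eq has_field_derivative_def)
  have "((\<lambda>s. (if b \<in> I then s else 1) * g (dil (1 / s) y)) has_field_derivative weight t * jac x) (at t)"
    using t x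
    by (auto intro!: derivative_eq_intros g simp: weight_def jac_def ext_def x_def[symmetric] D_def[symmetric])
  \<comment> \<open>\<open>height\<close> uses the extension of g by zero. Because \<open>U\<close>
    is open, the extension agrees with g for parameters near t.\<close>
  moreover have "eventually (\<lambda>s. dil (1 / s) y \<in> U) (nhds t)"
  proof -
    have "continuous (at t) (\<lambda>s. dil (1 / s) y)"
      using c has_derivative_continuous by blast
    then show ?thesis
      using open_U x topological_tendstoD by (fastforce simp: continuous_at eventually_nhds_conv_at)
  qed
  then have "eventually (\<lambda>s. height y s = (if b \<in> I then s else 1) * g (dil (1 / s) y)) (nhds t)"
    by eventually_elim (simp add: height_def ext_def)
  ultimately show ?thesis
    unfolding x_def by (subst DERIV_cong_ev[OF refl _ refl])
qed

text \<open>The part above \<open>y\<close> of the cone over the graph is swept out by \<open>t \<mapsto> y + height y t *\<^sub>R b\<close>.\<close>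

lemma nn_integral_fibre:
  assumes y: "y \<bullet> b = 0" and f[measurable]: "f \<in> borel_measurable borel"
  shows "(\<integral>\<^sup>+s. indicator unit_dom (y + s *\<^sub>R b) *
            (indicator graph (radial (y + s *\<^sub>R b)) * f (radial (y + s *\<^sub>R b))) \<partial>lborel)
     = (\<integral>\<^sup>+t. indicator {0<..<1} t * (indicator U (dil (1 / t) y) * indicator cyl_dom (lift (dil (1 / t) y)) *
          (ennreal (weight t * \<bar>jac (dil (1 / t) y)\<bar>) * f (lift (dil (1 / t) y)))) \<partial>lborel)"
proof -
  define A where "A = {t. 0 < t \<and> t < 1 \<and> dil (1 / t) y \<in> U \<and> lift (dil (1 / t) y) \<in> cyl_dom}"
  have A[measurable]: "A \<in> sets borel"
    unfolding A_def by measurable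
  have gauge: "cyl_gauge (y + height y t *\<^sub>R b) = t"
    and rad: "radial (y + height y t *\<^sub>R b) = lift (dil (1 / t) y)"
    and dom: "y + height y t *\<^sub>R b \<in> cyl_dom" if "t \<in> A" for t
  proof -
    let ?p = "lift (dil (1 / t) y)"
    have t: "0 < t" and p: "?p \<in> cyl_dom" "rho ?p = 0"
      using that y by (auto simp: A_def intro!: rho_lift dil_inner_b)
    have eq: "y + height y t *\<^sub>R b = dil t ?p"
      using dil_lift[OF t] by simp
    show 1: "cyl_gauge (y + height y t *\<^sub>R b) = t"
      using p t by (simp add: eq cyl_gauge_dil flip: cyl_gauge_eq_1_iff)
    show "radial (y + height y t *\<^sub>R b) = ?p"
      unfolding radial_def 1 using t by (simp add: eq dil_dil)
    show "y + height y t *\<^sub>R b \<in> cyl_dom"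
      unfolding eq using p t by (intro dil_in_cyl_dom) auto
  qed
  have image: "height y ` A = {s. y + s *\<^sub>R b \<in> unit_dom \<and> radial (y + s *\<^sub>R b) \<in> graph}"
  proof (intro subset_antisym subsetI)
    fix s assume "s \<in> height y ` A"
    then obtain t where t: "t \<in> A" "s = height y t" by auto
    then have "lift (dil (1 / t) y) \<in> graph" "t < 1"
      using y by (simp_all add: A_def lift_in_graph_iff dil_inner_b)
    then show "s \<in> {s. y + s *\<^sub>R b \<in> unit_dom \<and> radial (y + s *\<^sub>R b) \<in> graph}"
      using gauge[OF t(1)] rad[OF t(1)] dom[OF t(1)] by (simp add: t(2) unit_dom_def)
  next
    fix s assume "s \<in> {s. y + s *\<^sub>R b \<in> unit_dom \<and> radial (y + s *\<^sub>R b) \<in> graph}"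
    then have s: "y + s *\<^sub>R b \<in> cyl_dom" "cyl_gauge (y + s *\<^sub>R b) < 1"
      and gr: "radial (y + s *\<^sub>R b) \<in> graph"
      by (auto simp: unit_dom_def)
    \<comment> \<open>Dilating a graph point by t multiplies its gauge 1 by t, so the gauge is the
      only candidate for the parameter.\<close>
    define t where "t = cyl_gauge (y + s *\<^sub>R b)"
    have t: "0 < t" "t < 1"
      using s cyl_gauge_pos by (auto simp: t_def)
    have rad_eq: "radial (y + s *\<^sub>R b) = dil (1 / t) y + ((if b \<in> I then 1 / t else 1) * s) *\<^sub>R b"
      by (simp add: radial_def t_def dil_scale[OF b])
    then have hp: "hyper_proj b (radial (y + s *\<^sub>R b)) = dil (1 / t) y"
      using b dil_inner_b[OF y] by (simp add: hyper_proj_def inner_add_left)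
    then have U: "dil (1 / t) y \<in> U"
      using gr by (simp add: graph_def)
    have lift: "lift (dil (1 / t) y) = radial (y + s *\<^sub>R b)"
      using lift_hyper_proj[OF gr] hp by simp
    have "t \<in> A"
      using t U lift radial_in_cyl_dom[OF s(1)] by (simp add: A_def)
    moreover have "y + height y t *\<^sub>R b = y + s *\<^sub>R b"
      unfolding dil_lift[OF t(1), symmetric] lift using t(1) by (simp add: radial_def t_def[symmetric] dil_dil)
    then have "height y t = s"
      using b by auto
    ultimately show "s \<in> height y ` A" by blast
  qed
  \<comment> \<open>The image is Borel by its description through \<open>unit_dom\<close> and
    \<open>graph\<close>.\<close>
  have [measurable]: "height y ` A \<in> sets borel"
    unfolding image by measurable
  \<comment> \<open>The gauge recovers t from the point of height \<open>height y t\<close> above y,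
    so equal heights have equal parameters whatever the shape of g.\<close>
  have inj: "inj_on (height y) A"
  proof (rule inj_onI)
    fix t t' assume t: "t \<in> A" and t': "t' \<in> A" and eq: "height y t = height y t'"
    show "t = t'"
      using gauge[OF t] gauge[OF t'] unfolding eq by (rule trans[OF sym])
  qed
  have deriv: "(height y has_field_derivative weight t * jac (dil (1 / t) y)) (at t within A)" if "t \<in> A" for t
    by (rule has_field_derivative_at_within, rule height_has_derivative) (use that in \<open>auto simp: A_def\<close>)
  have meas: "(\<lambda>t. indicator A t * (weight t * jac (dil (1 / t) y))) \<in> borel_measurable borel"
    unfolding weight_def by measurable
  have "(\<integral>\<^sup>+s. indicator unit_dom (y + s *\<^sub>R b) *
            (indicator graph (radial (y + s *\<^sub>R b)) * f (radial (y + s *\<^sub>R b))) \<partial>lborel)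
     = (\<integral>\<^sup>+s. indicator (height y ` A) s * f (radial (y + s *\<^sub>R b)) \<partial>lborel)"
  proof (rule nn_integral_cong)
    fix s
    show "indicator unit_dom (y + s *\<^sub>R b) * (indicator graph (radial (y + s *\<^sub>R b)) * f (radial (y + s *\<^sub>R b)))
      = indicator (height y ` A) s * f (radial (y + s *\<^sub>R b))"
      by (cases "y + s *\<^sub>R b \<in> unit_dom"; cases "radial (y + s *\<^sub>R b) \<in> graph") (simp_all add: image)
  qed
  also have "\<dots> = (\<integral>\<^sup>+t. indicator A t * (ennreal \<bar>weight t * jac (dil (1 / t) y)\<bar> *
      f (radial (y + height y t *\<^sub>R b))) \<partial>lborel)"
    by (rule nn_integral_differentiable_inj_image[OF A deriv inj meas]) measurable
  also have "\<dots> = (\<integral>\<^sup>+t. indicator {0<..<1} t * (indicator U (dil (1 / t) y) * indicator cyl_dom (lift (dil (1 / t) y)) *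
          (ennreal (weight t * \<bar>jac (dil (1 / t) y)\<bar>) * f (lift (dil (1 / t) y)))) \<partial>lborel)"
  proof (rule nn_integral_cong)
    fix t
    show "indicator A t * (ennreal \<bar>weight t * jac (dil (1 / t) y)\<bar> * f (radial (y + height y t *\<^sub>R b)))
      = indicator {0<..<1} t * (indicator U (dil (1 / t) y) * indicator cyl_dom (lift (dil (1 / t) y)) *
          (ennreal (weight t * \<bar>jac (dil (1 / t) y)\<bar>) * f (lift (dil (1 / t) y))))"
    proof (cases "t \<in> A")
      case True
      then have "0 < t" by (simp add: A_def)
      with True show ?thesis
        by (simp add: rad) (simp add: A_def weight_def abs_mult)
    qed (auto simp: A_def indicator_def)
  qed
  finally show ?thesis .
qed

text \<open>Fubini in direction \<open>b\<close> reduces the cone to the fibres of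
  \<open>nn_integral_fibre\<close>. After exchanging the integrals, each t contributes a dilated
  copy of one fixed hyperplane integral, so the integral over t splits off and is the one of
  \<open>nn_integral_power_unit\<close>.\<close>

lemma nn_integral_cone_measure_graph:
  assumes f[measurable]: "f \<in> borel_measurable borel" and f0: "\<And>x. x \<notin> cyl_dom \<Longrightarrow> f x = 0"
  shows "(\<integral>\<^sup>+x. indicator graph x * f x \<partial>cone_measure)
       = (\<integral>\<^sup>+x. indicator U x * (ennreal \<bar>jac x\<bar> * f (lift x)) \<partial>hyperplane_lborel b)"
proof -
  let ?F = "\<lambda>x. indicator U x * (ennreal \<bar>jac x\<bar> * f (lift x))"
  let ?n = "card I"
  have "(\<integral>\<^sup>+x. indicator graph x * f x \<partial>cone_measure)
    = of_nat ?n * (\<integral>\<^sup>+x. indicator unit_dom x * (indicator graph (radial x) * f (radial x)) \<partial>lborel)"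
    by (rule nn_integral_cone_measure) measurable
  also have "(\<integral>\<^sup>+x. indicator unit_dom x * (indicator graph (radial x) * f (radial x)) \<partial>lborel)
    = (\<integral>\<^sup>+y. (\<integral>\<^sup>+s. indicator unit_dom (y + s *\<^sub>R b) *
            (indicator graph (radial (y + s *\<^sub>R b)) * f (radial (y + s *\<^sub>R b))) \<partial>lborel) \<partial>hyperplane_lborel b)"
    by (rule nn_integral_lborel_hyperplane[OF b]) measurable
  also have "\<dots> = (\<integral>\<^sup>+y. (\<integral>\<^sup>+t. indicator {0<..<1} t * (ennreal (weight t) * ?F (dil (1 / t) y)) \<partial>lborel) \<partial>hyperplane_lborel b)"
  proof (rule nn_integral_cong_AE, rule AE_mp[OF AE_hyperplane_lborel[OF b]], intro AE_I2 impI)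
    fix y assume y: "y \<bullet> b = 0"
    show "(\<integral>\<^sup>+s. indicator unit_dom (y + s *\<^sub>R b) *
            (indicator graph (radial (y + s *\<^sub>R b)) * f (radial (y + s *\<^sub>R b))) \<partial>lborel)
      = (\<integral>\<^sup>+t. indicator {0<..<1} t * (ennreal (weight t) * ?F (dil (1 / t) y)) \<partial>lborel)"
      unfolding nn_integral_fibre[OF y f]
    proof (rule nn_integral_cong)
      fix t
      show "indicator {0<..<1} t * (indicator U (dil (1 / t) y) * indicator cyl_dom (lift (dil (1 / t) y)) *
          (ennreal (weight t * \<bar>jac (dil (1 / t) y)\<bar>) * f (lift (dil (1 / t) y))))
        = indicator {0<..<1} t * (ennreal (weight t) * ?F (dil (1 / t) y))"
      proof (cases "0 < t \<and> t < 1")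
        case True
        then have "ennreal (weight t * \<bar>jac (dil (1 / t) y)\<bar>) = ennreal (weight t) * ennreal \<bar>jac (dil (1 / t) y)\<bar>"
          by (intro ennreal_mult) (auto simp: weight_def)
        then show ?thesis
          by (auto simp: indicator_def mult_ac f0)
      qed auto
    qed
  qed
  also have "\<dots> = (\<integral>\<^sup>+t. (\<integral>\<^sup>+y. indicator {0<..<1} t * (ennreal (weight t) * ?F (dil (1 / t) y)) \<partial>hyperplane_lborel b) \<partial>lborel)"
    unfolding weight_def by (rule nn_integral_hyperplane_Fubini[OF b]) measurable
  also have "\<dots> = (\<integral>\<^sup>+t. indicator {0<..<1} t * ennreal (t ^ (?n - 1)) * (\<integral>\<^sup>+y. ?F y \<partial>hyperplane_lborel b) \<partial>lborel)"
  proof (rule nn_integral_cong)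
    fix t :: real
    show "(\<integral>\<^sup>+y. indicator {0<..<1} t * (ennreal (weight t) * ?F (dil (1 / t) y)) \<partial>hyperplane_lborel b)
       = indicator {0<..<1} t * ennreal (t ^ (?n - 1)) * (\<integral>\<^sup>+y. ?F y \<partial>hyperplane_lborel b)"
    proof (cases "0 < t \<and> t < 1")
      case True
      then have t: "0 < t" by simp
      \<comment> \<open>Both kinds of direction lead to the same exponent: for \<open>b\<close> in
        \<open>I\<close> the hyperplane already loses one dilated coordinate, and for
        \<open>b\<close> outside \<open>I\<close> the factor 1 / t in \<open>weight\<close> removes
        one power.\<close>
      have w: "weight t * t ^ card (I - {b}) = t ^ (?n - 1)"
      proof (cases "b \<in> I")
        case False
        then have "t ^ ?n = t * t ^ (?n - 1)"
          using card_I by (cases ?n) auto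
        with False t show ?thesis by (simp add: weight_def)
      qed (simp add: weight_def)
      have "(\<integral>\<^sup>+y. indicator {0<..<1} t * (ennreal (weight t) * ?F (dil (1 / t) y)) \<partial>hyperplane_lborel b)
         = ennreal (weight t) * (\<integral>\<^sup>+y. ?F (dil (1 / t) y) \<partial>hyperplane_lborel b)"
        using True by (simp add: nn_integral_cmult)
      also have "(\<integral>\<^sup>+y. ?F (dil (1 / t) y) \<partial>hyperplane_lborel b) =
          ennreal (t ^ card (I - {b})) * (\<integral>\<^sup>+y. ?F y \<partial>hyperplane_lborel b)"
        by (rule nn_integral_hyperplane_dil[OF b t]) measurable
      finally show ?thesis
        using True t ennreal_mult[of "weight t" "t ^ card (I - {b})"]
        by (simp add: w mult.assoc[symmetric]) (simp add: weight_def)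
    qed auto
  qed
  also have "\<dots> = (\<integral>\<^sup>+t. indicator {0<..<1} t * ennreal (t ^ (?n - 1)) \<partial>lborel) * (\<integral>\<^sup>+y. ?F y \<partial>hyperplane_lborel b)"
    by (rule nn_integral_multc) measurable
  finally show ?thesis
    using nn_integral_power_unit[of ?n] card_I by (simp add: mult.assoc[symmetric])
qed

end

section \<open>The surface measure as a density\<close>

lemma real_gradient_inner: "i \<in> Basis \<Longrightarrow> real_gradient f x \<bullet> i = partial_deriv f i x"
  by (simp add: real_gradient_def inner_sum_left_Basis)

lemma norm_real_gradient: "(norm (real_gradient f x))\<^sup>2 = (\<Sum>i\<in>Basis. (partial_deriv f i x)\<^sup>2)"
proof -
  have "(norm (real_gradient f x))\<^sup>2 = real_gradient f x \<bullet> real_gradient f x"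
    by (simp add: power2_norm_eq_inner)
  also have "\<dots> = (\<Sum>i\<in>Basis. (real_gradient f x \<bullet> i) * (real_gradient f x \<bullet> i))"
    by (rule euclidean_inner)
  finally show ?thesis
    by (simp add: real_gradient_inner power2_eq_square)
qed

lemma sets_graph_area_measure [simp]: "sets (graph_area_measure b U g) = sets borel"
  and space_graph_area_measure [simp]: "space (graph_area_measure b U g) = UNIV"
  by (simp_all add: graph_area_measure_def)

lemma graph_patches_nonempty: "graph_patches (S :: 'a::euclidean_space set) \<noteq> {}"
proof -
  obtain b :: 'a where "b \<in> Basis" using nonempty_Basis by blast
  then have "(b, {}, \<lambda>_. 0) \<in> graph_patches S"
    by (simp add: graph_patches_def differentiable_on_def)
  then show ?thesis by blast
qed

lemma sets_hypersurface_measure [simp, measurable_cong]: "sets (hypersurface_measure S) = sets borel"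
  unfolding hypersurface_measure_def
  by (rule sets_SUP) (auto simp: graph_patches_nonempty split: prod.split)

lemma space_hypersurface_measure [simp]: "space (hypersurface_measure S) = UNIV"
  using sets_eq_imp_space_eq[OF sets_hypersurface_measure] by simp

lemma graph_area_measure_le_hypersurface_measure:
  assumes "(b, U, g) \<in> graph_patches S"
  shows "emeasure (graph_area_measure b U g) X \<le> emeasure (hypersurface_measure S) X"
proof -
  have "graph_area_measure b U g \<le> hypersurface_measure S"
    unfolding hypersurface_measure_def using assms by (intro SUP_upper2[where i = "(b, U, g)"]) auto
  then show ?thesis
    by (rule le_measureD3) simp
qed

lemma hypersurface_measure_le:
  assumes sets: "sets N = sets borel"
    and le: "\<And>b U g X. (b, U, g) \<in> graph_patches S \<Longrightarrow> X \<in> sets borel \<Longrightarrow> emeasure (graph_area_measure b U g) X \<le> emeasure N X"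
  shows "emeasure (hypersurface_measure S) X \<le> emeasure N X"
proof -
  have "hypersurface_measure S \<le> N"
    unfolding hypersurface_measure_def
    by (rule SUP_least) (auto simp: le_measure sets le)
  then show ?thesis
    by (rule le_measureD3) (simp add: sets)
qed

context cylindrical begin

lemma partial_deriv_q: "i \<in> I \<Longrightarrow> partial_deriv q i x = 0"
proof -
  assume i: "i \<in> I"
  have "q (x + t *\<^sub>R i) = q x" for t
    using i subsetD[OF I i] by (intro q_cong) (auto simp: inner_add_left inner_Basis)
  then show ?thesis
    by (simp add: partial_deriv_def)
qed

lemma norm_proj: "(norm (proj x))\<^sup>2 = (\<Sum>i\<in>I. (x \<bullet> i)\<^sup>2)"
proof -
  have "(norm (proj x))\<^sup>2 = (\<Sum>i\<in>Basis. (proj x \<bullet> i) * (proj x \<bullet> i))"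
    by (simp add: power2_norm_eq_inner) (rule euclidean_inner)
  also have "\<dots> = (\<Sum>i\<in>I. (x \<bullet> i)\<^sup>2)"
    using I by (intro sum.mono_neutral_cong_right) (auto simp: proj_inner power2_eq_square)
  finally show ?thesis .
qed

lemma rho_eq: "rho x = (\<Sum>i\<in>I. (x \<bullet> i)\<^sup>2) + q x - 1"
  by (simp add: rho_def norm_proj)

lemma rho_has_derivative:
  "(rho has_derivative (\<lambda>v. (\<Sum>i\<in>I. 2 * (x \<bullet> i) * (v \<bullet> i)) + (\<Sum>i\<in>Basis. (v \<bullet> i) *\<^sub>R partial_deriv q i x))) (at x)"
proof -
  have "((\<lambda>x. \<Sum>i\<in>I. (x \<bullet> i)\<^sup>2) has_derivative (\<lambda>v. \<Sum>i\<in>I. 2 * (x \<bullet> i) * (v \<bullet> i))) (at x)"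
    by (rule has_derivative_sum) (auto intro!: derivative_eq_intros simp: power2_eq_square algebra_simps)
  from has_derivative_diff[OF has_derivative_add[OF this has_derivative_partial_deriv[OF q_differentiable]] has_derivative_const[of 1]]
  show ?thesis
    unfolding rho_eq[abs_def] by simp
qed

lemma rho_differentiable: "rho differentiable (at x)"
  using rho_has_derivative differentiableI by blast

lemma partial_deriv_rho:
  "i \<in> Basis \<Longrightarrow> partial_deriv rho i x = (if i \<in> I then 2 * (x \<bullet> i) else 0) + partial_deriv q i x"
proof -
  assume i: "i \<in> Basis"
  have "(\<Sum>j\<in>I. 2 * (x \<bullet> j) * (i \<bullet> j)) = (\<Sum>j\<in>I. if j = i then 2 * (x \<bullet> j) else 0)"
    using i I by (intro sum.cong) (auto simp: inner_Basis)
  moreover have "(\<Sum>j\<in>Basis. (i \<bullet> j) *\<^sub>R partial_deriv q j x) = (\<Sum>j\<in>Basis. if j = i then partial_deriv q j x else 0)"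
    using i by (intro sum.cong) (auto simp: inner_Basis)
  ultimately show ?thesis
    using i by (simp add: partial_deriv_has_derivative[OF rho_has_derivative] finite_I)
qed

lemma partial_deriv_rho_I: "i \<in> I \<Longrightarrow> partial_deriv rho i x = 2 * (x \<bullet> i)"
  using I by (subst partial_deriv_rho) (auto simp: partial_deriv_q)

lemma continuous_on_partial_deriv_rho:
  assumes i: "i \<in> Basis" shows "continuous_on A (partial_deriv rho i)"
proof -
  have "partial_deriv rho i = (\<lambda>x. (if i \<in> I then 2 * (x \<bullet> i) else 0) + partial_deriv q i x)"
    using partial_deriv_rho[OF i] by auto
  moreover have "continuous_on A (partial_deriv q i)"
    using q_partial_continuous[OF i] continuous_on_subset by blast
  ultimately show ?thesis
    by (cases "i \<in> I") (auto intro!: continuous_intros)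
qed

text \<open>The derivative of \<open>rho\<close> along \<open>proj x\<close>, the generator of the
  dilations, is 2 |proj x|^2. The reciprocal of this density is therefore the normal component of
  that generator on the level set, the rate at which the cone over a surface element sweeps out
  volume.\<close>

definition area_density :: "'a \<Rightarrow> real" where
  "area_density x = norm (real_gradient rho x) / (2 * (norm (proj x))\<^sup>2)"

lemma borel_measurable_real_gradient_rho [measurable]: "real_gradient rho \<in> borel_measurable borel"
  unfolding real_gradient_def
  by (intro borel_measurable_sum borel_measurable_scaleR borel_measurable_const
      borel_measurable_continuous_onI continuous_on_partial_deriv_rho)

lemma borel_measurable_area_density [measurable]: "area_density \<in> borel_measurable borel"
  unfolding area_density_def by measurable

end

context cylindrical_patch begin

text \<open>Implicit differentiation: \<open>rho\<close> vanishes identically along the graph, so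
  its derivative along the graph in direction i is zero, and the chain rule expands it.\<close>

lemma partial_deriv_rho_lift:
  assumes x: "x \<in> U" "x \<bullet> b = 0" and i: "i \<in> Basis" "i \<noteq> b"
  shows "partial_deriv rho i (lift x) + partial_deriv rho b (lift x) * slope i x = 0"
proof -
  define L where "L = (\<lambda>v. \<Sum>j\<in>Basis. (v \<bullet> j) *\<^sub>R partial_deriv rho j (lift x))"
  have L: "(rho has_derivative L) (at (x + g x *\<^sub>R b))"
    using has_derivative_partial_deriv[OF rho_differentiable, of "lift x"] x by (simp add: L_def lift_eq)
  have L_Basis: "L j = partial_deriv rho j (lift x)" if "j \<in> Basis" for j
    using partial_deriv_has_derivative[OF L, of j] x by (simp add: lift_eq)
  let ?g' = "\<lambda>v. \<Sum>j\<in>Basis. (v \<bullet> j) *\<^sub>R slope j x"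
  have g'i: "?g' i = slope i x"
  proof -
    have "?g' i = (\<Sum>j\<in>Basis. if j = i then slope j x else 0)"
      using i by (intro sum.cong) (auto simp: inner_Basis)
    then show ?thesis using i by simp
  qed
  have "((\<lambda>v. v + g v *\<^sub>R b) has_derivative (\<lambda>v. v + ?g' v *\<^sub>R b)) (at x)"
    by (rule has_derivative_add[OF has_derivative_ident has_derivative_scaleR_left[OF g_has_derivative[OF x(1)]]])
  from has_derivative_compose[OF this L]
  have "((\<lambda>v. rho (v + g v *\<^sub>R b)) has_derivative (\<lambda>v. L (v + ?g' v *\<^sub>R b))) (at x)" .
  from partial_deriv_has_derivative[OF this, of i]
  have "partial_deriv (\<lambda>v. rho (v + g v *\<^sub>R b)) i x = L (i + slope i x *\<^sub>R b)"
    unfolding g'i .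
  also have "\<dots> = L i + slope i x * L b"
    using has_derivative_linear[OF L] by (simp add: linear_add linear_scale)
  finally have eq: "partial_deriv (\<lambda>v. rho (v + g v *\<^sub>R b)) i x = L i + slope i x * L b" .
  have "((\<lambda>t. x + t *\<^sub>R i) \<longlongrightarrow> x + 0 *\<^sub>R i) (nhds 0)"
    by (intro tendsto_intros) (auto simp: filterlim_ident)
  then have ev: "eventually (\<lambda>t. x + t *\<^sub>R i \<in> U) (nhds 0)"
    using open_U x by (simp add: topological_tendstoD)
  \<comment> \<open>Moving along a basis vector other than \<open>b\<close> stays in the hyperplane
    where the graph lies in the level set.\<close>
  have "eventually (\<lambda>t. rho ((x + t *\<^sub>R i) + g (x + t *\<^sub>R i) *\<^sub>R b) = 0) (nhds 0)"
    using ev by eventually_elim (intro rho_on_patch, use x i b in \<open>auto simp: inner_add_left inner_Basis\<close>)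
  then have "((\<lambda>t. rho ((x + t *\<^sub>R i) + g (x + t *\<^sub>R i) *\<^sub>R b)) has_vector_derivative 0) (at 0) =
     ((\<lambda>t. 0::real) has_vector_derivative 0) (at 0)"
    by (intro has_vector_derivative_cong_ev) (auto dest: eventually_nhds_x_imp_x elim: eventually_mono)
  then have "partial_deriv (\<lambda>v. rho (v + g v *\<^sub>R b)) i x = 0"
    unfolding partial_deriv_def by (intro vector_derivative_at) simp
  with eq show ?thesis
    using i b by (simp add: L_Basis mult.commute)
qed

text \<open>Euler's identity for the dilations.\<close>

lemma partial_deriv_rho_mult_jac:
  assumes x: "x \<in> U" "x \<bullet> b = 0"
  shows "partial_deriv rho b (lift x) * jac x = 2 * (norm (proj (lift x)))\<^sup>2"
proof -
  let ?r = "\<lambda>i. partial_deriv rho i (lift x)"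
  have lift_i: "lift x \<bullet> i = (if i = b then g x else x \<bullet> i)" if "i \<in> Basis" for i
    using that x b by (auto simp: lift_eq inner_add_left inner_Basis)
  have "?r b * jac x = (if b \<in> I then ?r b * g x else 0) - (\<Sum>i\<in>I. (x \<bullet> i) * (?r b * slope i x))"
    using x by (simp add: jac_def ext_def algebra_simps sum_distrib_left)
  also have "\<dots> = (\<Sum>i\<in>I. if i = b then ?r b * g x else 0) - (\<Sum>i\<in>I. (x \<bullet> i) * (?r b * slope i x))"
    by (simp add: finite_I)
  also have "\<dots> = (\<Sum>i\<in>I. (lift x \<bullet> i) * ?r i)"
    unfolding sum_subtractf[symmetric]
  proof (rule sum.cong)
    fix i assume "i \<in> I"
    with I have i: "i \<in> Basis" by blast
    show "(if i = b then ?r b * g x else 0) - (x \<bullet> i) * (?r b * slope i x) = (lift x \<bullet> i) * ?r i"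
    \<comment> \<open>At \<open>b\<close> itself the slope term vanishes because
      \<open>x \<bullet> b = 0\<close>; in the other directions implicit differentiation trades the
      slope of g for a partial derivative of \<open>rho\<close>.\<close>
    proof (cases "i = b")
      case False
      then have "?r b * slope i x = - ?r i"
        using partial_deriv_rho_lift[OF x i] by simp
      with False i show ?thesis by (simp add: lift_i)
    qed (use x b in \<open>simp add: lift_i\<close>)
  qed simp
  also have "\<dots> = (\<Sum>i\<in>I. 2 * (lift x \<bullet> i)\<^sup>2)"
    by (intro sum.cong) (auto simp: partial_deriv_rho_I power2_eq_square)
  also have "\<dots> = 2 * (norm (proj (lift x)))\<^sup>2"
    by (simp add: norm_proj sum_distrib_left)
  finally show ?thesis .
qed

text \<open>With r_b for the partial derivative of \<open>rho\<close> in direction \<open>b\<close>,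
  implicit differentiation makes the gradient length |r_b| sqrt (1 + |grad g|^2), and Euler's
  identity makes |r_b| |jac| equal to 2 |proj|^2. The factor r_b drops out and the area element of a
  graph is left.\<close>

lemma jac_mult_area_density:
  assumes x: "x \<in> U" "x \<bullet> b = 0" and p: "lift x \<in> cyl_dom"
  shows "\<bar>jac x\<bar> * area_density (lift x) = sqrt (1 + (\<Sum>i\<in>Basis - {b}. (partial_deriv g i x)\<^sup>2))"
proof -
  let ?r = "\<lambda>i. partial_deriv rho i (lift x)"
  let ?s = "1 + (\<Sum>i\<in>Basis - {b}. (partial_deriv g i x)\<^sup>2)"
  have "(norm (real_gradient rho (lift x)))\<^sup>2 = (?r b)\<^sup>2 + (\<Sum>i\<in>Basis - {b}. (?r i)\<^sup>2)"
    using b by (simp add: norm_real_gradient sum.remove)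
  also have "(\<Sum>i\<in>Basis - {b}. (?r i)\<^sup>2) = (\<Sum>i\<in>Basis - {b}. (?r b)\<^sup>2 * (partial_deriv g i x)\<^sup>2)"
  proof (rule sum.cong)
    fix i assume "i \<in> Basis - {b}"
    then have "?r i = - (?r b * partial_deriv g i x)"
      using partial_deriv_rho_lift[OF x, of i] x by (simp add: slope_def ext_def)
    then show "(?r i)\<^sup>2 = (?r b)\<^sup>2 * (partial_deriv g i x)\<^sup>2"
      by (simp add: power_mult_distrib)
  qed simp
  finally have "(norm (real_gradient rho (lift x)))\<^sup>2 = (?r b)\<^sup>2 * ?s"
    by (simp add: sum_distrib_left algebra_simps)
  then have norm: "norm (real_gradient rho (lift x)) = \<bar>?r b\<bar> * sqrt ?s"
    by (metis norm_ge_zero real_sqrt_abs real_sqrt_mult real_sqrt_unique)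
  have P: "0 < 2 * (norm (proj (lift x)))\<^sup>2"
    using p by (simp add: cyl_dom_def)
  have "\<bar>?r b\<bar> * \<bar>jac x\<bar> = 2 * (norm (proj (lift x)))\<^sup>2"
    using partial_deriv_rho_mult_jac[OF x] by (simp flip: abs_mult)
  then have "\<bar>jac x\<bar> * norm (real_gradient rho (lift x)) = 2 * (norm (proj (lift x)))\<^sup>2 * sqrt ?s"
    unfolding norm by (simp add: mult_ac)
  then show ?thesis
    unfolding area_density_def using P by (simp add: field_simps)
qed

text \<open>Since \<open>I\<close> has at least two elements, some i in \<open>I\<close> differs
  from \<open>b\<close>. The coordinate i of a graph point is that of its foot, hence nonzero almost
  everywhere, which keeps the point away from the degenerate set of the dilations.\<close>

lemma AE_lift_in_cyl_dom: "AE x in hyperplane_lborel b. x \<in> U \<longrightarrow> lift x \<in> cyl_dom"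
proof -
  have "\<not> I \<subseteq> {b}"
    using card_I card_mono[of "{b}" I] by auto
  then obtain i where "i \<in> I" "i \<noteq> b" by blast
  with I have i: "i \<in> I" "i \<in> Basis" "i \<noteq> b" by auto
  show ?thesis
    using AE_hyperplane_lborel_inner_neq_0[OF b i(2,3)] AE_hyperplane_lborel[OF b]
  proof eventually_elim
    case (elim x)
    have "proj (lift x) \<bullet> i \<noteq> 0"
      using elim i b by (simp add: proj_inner lift_def inner_add_left inner_Basis)
    then show ?case
      using elim rho_lift by (auto intro!: rho_eq_0_imp_cyl_dom)
  qed
qed

text \<open>The factor \<open>jac\<close> from the cone and \<open>area_density\<close> combine to
  the area element of the graph. On the right the patch enters only through the set
  \<open>graph\<close>, so that the areas of any two patches agree on their overlap.\<close>

lemma emeasure_graph_area_measure: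
  assumes B[measurable]: "B \<in> sets borel"
  shows "emeasure (graph_area_measure b U g) B =
    (\<integral>\<^sup>+x. indicator graph x * (ennreal (area_density x) * indicator B x) \<partial>cone_measure)"
proof -
  let ?s = "\<lambda>x. sqrt (1 + (\<Sum>i\<in>Basis - {b}. (partial_deriv g i x)\<^sup>2))"
  let ?M = "restrict_space (hyperplane_lborel b) U"
  have Ucap: "U \<inter> space (hyperplane_lborel b) \<in> sets (hyperplane_lborel b)" by simp
  have sM: "sets ?M = sets (restrict_space borel U)"
    by (rule sets_restrict_space_cong) simp
  have s[measurable]: "(\<lambda>x. ennreal (?s x)) \<in> borel_measurable ?M"
  proof -
    have "partial_deriv g i \<in> borel_measurable ?M" if "i \<in> Basis" for i
      using borel_measurable_continuous_on_restrict[OF g_partial_continuous[OF that]]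
      by (simp add: measurable_cong_sets[OF sM refl])
    then show ?thesis
      by (intro measurable_compose[OF _ measurable_ennreal] borel_measurable_sqrt borel_measurable_add borel_measurable_sum borel_measurable_power) auto
  qed
  have l[measurable]: "(\<lambda>x. x + g x *\<^sub>R b) \<in> measurable ?M borel"
  proof -
    have "continuous_on U (\<lambda>x. x + g x *\<^sub>R b)"
      using g_differentiable by (intro continuous_intros differentiable_imp_continuous_on)
    then show ?thesis
      using borel_measurable_continuous_on_restrict by (simp add: measurable_cong_sets[OF sM refl])
  qed
  have "emeasure (graph_area_measure b U g) B =
      (\<integral>\<^sup>+x. indicator B x \<partial>graph_area_measure b U g)"
    by (simp add: nn_integral_indicator)
  also have "\<dots> = (\<integral>\<^sup>+x. ennreal (?s x) * indicator B (x + g x *\<^sub>R b) \<partial>?M)"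
    unfolding graph_area_measure_def
    by (simp add: nn_integral_distr nn_integral_density del: nn_integral_indicator)
  also have "\<dots> = (\<integral>\<^sup>+x. ennreal (?s x) * indicator B (x + g x *\<^sub>R b) * indicator U x \<partial>hyperplane_lborel b)"
    using Ucap by (rule nn_integral_restrict_space)
  \<comment> \<open>Almost every graph point lies in \<open>cyl_dom\<close>; inserting this
    indicator makes the integrand vanish off \<open>cyl_dom\<close>, as
    \<open>nn_integral_cone_measure_graph\<close> demands.\<close>
  also have "\<dots> = (\<integral>\<^sup>+x. indicator U x * (ennreal \<bar>jac x\<bar> *
      (indicator cyl_dom (lift x) * (ennreal (area_density (lift x)) * indicator B (lift x)))) \<partial>hyperplane_lborel b)"
  proof (rule nn_integral_cong_AE)
    show "AE x in hyperplane_lborel b. ennreal (?s x) * indicator B (x + g x *\<^sub>R b) * indicator U x =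
      indicator U x * (ennreal \<bar>jac x\<bar> * (indicator cyl_dom (lift x) * (ennreal (area_density (lift x)) * indicator B (lift x))))"
      using AE_lift_in_cyl_dom AE_hyperplane_lborel[OF b]
    proof eventually_elim
      case (elim x)
      show ?case
      proof (cases "x \<in> U")
        case True
        then have "ennreal (?s x) = ennreal \<bar>jac x\<bar> * ennreal (area_density (lift x))"
          using elim jac_mult_area_density[of x] by (simp add: ennreal_mult' flip: ennreal_mult')
        with True elim show ?thesis
          by (simp add: lift_eq mult.assoc)
      qed simp
    qed
  qed
  also have "\<dots> = (\<integral>\<^sup>+x. indicator graph x * (indicator cyl_dom x * (ennreal (area_density x) * indicator B x)) \<partial>cone_measure)"
    by (rule nn_integral_cone_measure_graph[symmetric]) auto
  also have "\<dots> = (\<integral>\<^sup>+x. indicator graph x * (ennreal (area_density x) * indicator B x) \<partial>cone_measure)"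
    using AE_cone_measure by (intro nn_integral_cong_AE) (auto elim!: eventually_mono)
  finally show ?thesis .
qed

end

context cylindrical begin

text \<open>Adding s times \<open>b\<close> to a point of the hyperplane, for \<open>b\<close> in
  \<open>I\<close>, raises \<open>rho\<close> by s^2. The heights with \<open>c = 1\<close> and
  \<open>c = - 1\<close> therefore give the two sheets of the level set on either side of the
  hyperplane.\<close>

definition std_graph :: "real \<Rightarrow> 'a \<Rightarrow> real" where
  "std_graph c x = c * sqrt (- rho x)"

lemma rho_add_I:
  assumes b: "b \<in> I" and x: "x \<bullet> b = 0"
  shows "rho (x + s *\<^sub>R b) = rho x + s\<^sup>2"
proof -
  have bB: "b \<in> Basis" using b I by blast
  have "q (x + s *\<^sub>R b) = q x"
    using b bB by (intro q_cong) (auto simp: inner_add_left inner_Basis)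
  moreover have "(\<Sum>i\<in>I. ((x + s *\<^sub>R b) \<bullet> i)\<^sup>2) = (\<Sum>i\<in>I. (x \<bullet> i)\<^sup>2 + (if i = b then s\<^sup>2 else 0))"
    using I bB x by (intro sum.cong) (auto simp: inner_add_left inner_Basis subset_iff)
  ultimately show ?thesis
    using b by (simp add: rho_eq sum.distrib finite_I)
qed

lemma std_patch:
  assumes b: "b \<in> I" and c: "c\<^sup>2 = 1"
  shows "(b, {x. rho x < 0}, std_graph c) \<in> graph_patches {x. rho x = 0}"
proof -
  have bB: "b \<in> Basis" using b I by blast
  have "continuous_on UNIV rho"
    by (intro differentiable_imp_continuous_on) (simp add: differentiable_on_def rho_differentiable)
  then have "open {x. rho x < 0}"
    by (intro open_Collect_less) auto
  have der: "(std_graph c has_derivative (\<lambda>v. (- c / (2 * sqrt (- rho x))) *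
      (\<Sum>i\<in>Basis. (v \<bullet> i) *\<^sub>R partial_deriv rho i x))) (at x)"
    if "rho x < 0" for x
    unfolding std_graph_def[abs_def] using that
    by (auto intro!: derivative_eq_intros has_derivative_partial_deriv[OF rho_differentiable] simp: field_simps)
  have pd: "partial_deriv (std_graph c) i x = (- c / (2 * sqrt (- rho x))) * partial_deriv rho i x"
    if "rho x < 0" "i \<in> Basis" for x i
  proof -
    have "(\<Sum>j\<in>Basis. (i \<bullet> j) *\<^sub>R partial_deriv rho j x) = (\<Sum>j\<in>Basis. if j = i then partial_deriv rho j x else 0)"
      using that by (intro sum.cong) (auto simp: inner_Basis)
    then show ?thesis
      using that by (simp add: partial_deriv_has_derivative[OF der])
  qed
  have "continuous_on {x. rho x < 0} (partial_deriv (std_graph c) i)" if i: "i \<in> Basis" for i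
  proof -
    have "continuous_on {x. rho x < 0} rho"
      using \<open>continuous_on UNIV rho\<close> continuous_on_subset by blast
    then have "continuous_on {x. rho x < 0} (\<lambda>x. (- c / (2 * sqrt (- rho x))) * partial_deriv rho i x)"
      by (intro continuous_intros continuous_on_partial_deriv_rho i) auto
    then show ?thesis
      by (rule continuous_on_eq) (use pd i in auto)
  qed
  moreover have "std_graph c differentiable_on {x. rho x < 0}"
    unfolding differentiable_on_def by (blast intro: differentiable_at_withinI differentiableI der)
  moreover have "rho (x + std_graph c x *\<^sub>R b) = 0" if "rho x < 0" "x \<bullet> b = 0" for x
    using that c by (simp add: rho_add_I[OF b] std_graph_def power_mult_distrib)
  ultimately show ?thesis
    using bB \<open>open {x. rho x < 0}\<close> by (simp add: graph_patches_def)
qed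

text \<open>Every graph area measure is a restriction of the right-hand side, which bounds the
  supremum from above. For the lower bound finitely many explicit sheets suffice: on each of them
  the right-hand side coincides with the area of one patch, and together they cover the level set up
  to a null set of the cone measure.\<close>

theorem hypersurface_measure_eq:
  "hypersurface_measure {x. rho x = 0} = density cone_measure (\<lambda>x. ennreal (area_density x))"
proof (rule measure_eqI)
  fix B assume "B \<in> sets (hypersurface_measure {x. rho x = 0})"
  then have B[measurable]: "B \<in> sets borel" by simp
  let ?\<sigma> = "hypersurface_measure {x. rho x = 0}"
  let ?N = "density cone_measure (\<lambda>x. ennreal (area_density x))"
  have N: "emeasure ?N X = (\<integral>\<^sup>+x. ennreal (area_density x) * indicator X x \<partial>cone_measure)" if "X \<in> sets borel" for X
    using that by (simp add: emeasure_density)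
  have "emeasure ?\<sigma> B \<le> emeasure ?N B"
  proof (rule hypersurface_measure_le)
    fix b U g X assume p: "(b, U, g) \<in> graph_patches {x. rho x = 0}" and X: "X \<in> sets (borel :: 'a measure)"
    interpret cylindrical_patch I q b U g
      by unfold_locales (fact p)
    show "emeasure (graph_area_measure b U g) X \<le> emeasure ?N X"
      unfolding emeasure_graph_area_measure[OF X] N[OF X]
      by (intro nn_integral_mono) (auto simp: indicator_def)
  qed simp
  moreover have "emeasure ?N B \<le> emeasure ?\<sigma> B"
  proof -
    \<comment> \<open>There are two open sheets for each coordinate in \<open>I\<close>, told apart
      by the sign of that coordinate.\<close>
    define cap where "cap = (\<lambda>(b, c). {x. rho x = 0 \<and> 0 < c * (x \<bullet> b)})"
    have cap[measurable]: "cap j \<in> sets borel" for j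
      unfolding cap_def by (cases j) simp
    have local: "emeasure ?N X \<le> emeasure ?\<sigma> X"
      if bc: "b \<in> I" "c \<in> {1, - 1}" and X: "X \<in> sets borel" "X \<subseteq> cap (b, c)" for b c X
    proof -
      have c2: "c\<^sup>2 = 1" using bc by auto
      interpret cylindrical_patch I q b "{x. rho x < 0}" "std_graph c"
        by unfold_locales (rule std_patch[OF bc(1) c2])
      have "X \<subseteq> graph"
      proof
        fix x assume "x \<in> X"
        with X have x: "rho x = 0" "0 < c * (x \<bullet> b)" by (auto simp: cap_def)
        have "hyper_proj b x \<bullet> b = 0"
          using b by (simp add: hyper_proj_inner)
        from rho_add_I[OF bc(1) this, of "x \<bullet> b"]
        have eq: "rho (hyper_proj b x) = - (x \<bullet> b)\<^sup>2"
          using x by (simp add: hyper_proj_def)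
        moreover have "0 < (x \<bullet> b)\<^sup>2"
          using x by auto
        ultimately show "x \<in> graph"
          using x bc(2) by (auto simp: graph_def ext_def std_graph_def)
      qed
      then have "emeasure ?N X = emeasure (graph_area_measure b {x. rho x < 0} (std_graph c)) X"
        unfolding N[OF X(1)] emeasure_graph_area_measure[OF X(1)]
        by (intro nn_integral_cong) (auto simp: indicator_def)
      also have "\<dots> \<le> emeasure ?\<sigma> X"
        by (rule graph_area_measure_le_hypersurface_measure[OF patch])
      finally show ?thesis .
    qed
    have glue: "emeasure ?N (B \<inter> \<Union>(cap ` J)) \<le> emeasure ?\<sigma> (B \<inter> \<Union>(cap ` J))"
      if "finite J" "J \<subseteq> I \<times> {1, - 1}" for J
      using that
    proof (induction J rule: finite_induct)
      case (insert j J)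
      have [measurable]: "\<Union>(cap ` J) \<in> sets borel"
        using insert.hyps(1) by (intro sets.finite_UN) auto
      \<comment> \<open>Removing the caps already treated makes the union disjoint, so both measures
        add up; what is left still lies in the single cap j, where \<open>local\<close>
        applies.\<close>
      let ?X = "B \<inter> cap j - \<Union>(cap ` J)" and ?Y = "B \<inter> \<Union>(cap ` J)"
      have split: "B \<inter> \<Union>(cap ` insert j J) = ?X \<union> ?Y" "?X \<inter> ?Y = {}"
        by auto
      have "emeasure ?N ?X \<le> emeasure ?\<sigma> ?X"
        using insert.prems by (intro local[of "fst j" "snd j"]) auto
      moreover have "emeasure ?N ?Y \<le> emeasure ?\<sigma> ?Y"
        using insert by auto
      ultimately show ?case
        unfolding split(1) using split(2)
        by (subst (1 2) plus_emeasure[symmetric]) (auto intro!: add_mono)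
    qed simp
    let ?C = "\<Union>(cap ` (I \<times> {1, - 1}))"
    have [measurable]: "?C \<in> sets borel"
      using finite_I by (intro sets.finite_UN) auto
    \<comment> \<open>A point of the level set outside all caps has every coordinate in
      \<open>I\<close> equal to zero, which \<open>cyl_dom\<close> excludes.\<close>
    have cover: "x \<in> ?C" if "x \<in> cyl_dom" "rho x = 0" for x
    proof -
      have "0 < (norm (proj x))\<^sup>2"
        using that by (simp add: cyl_dom_def)
      then have "(\<Sum>i\<in>I. (x \<bullet> i)\<^sup>2) \<noteq> 0"
        unfolding norm_proj by simp
      then obtain i where i: "i \<in> I" "x \<bullet> i \<noteq> 0"
        using sum.not_neutral_contains_not_neutral by force
      then have "x \<in> cap (i, 1) \<or> x \<in> cap (i, - 1)"
        using that by (auto simp: cap_def)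
      with i show ?thesis by blast
    qed
    have "AE x in cone_measure. ennreal (area_density x) * indicator B x =
        ennreal (area_density x) * indicator (B \<inter> ?C) x"
      using AE_cone_measure by eventually_elim (use cover in \<open>auto simp: indicator_def\<close>)
    then have "emeasure ?N B = emeasure ?N (B \<inter> ?C)"
      by (simp only: N B sets.Int \<open>?C \<in> sets borel\<close> nn_integral_cong_AE)
    also have "\<dots> \<le> emeasure ?\<sigma> (B \<inter> ?C)"
      using finite_I by (intro glue) auto
    also have "\<dots> \<le> emeasure ?\<sigma> B"
      by (intro emeasure_mono) auto
    finally show ?thesis .
  qed
  ultimately show "emeasure ?\<sigma> B = emeasure ?N B"
    by (rule antisym)
qed simp

end

section \<open>Polar coordinates in the complex plane\<close>

lemma nn_integral_lborel_complex:
  assumes [measurable]: "f \<in> borel_measurable borel"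
  shows "(\<integral>\<^sup>+w. f w \<partial>lborel) = (\<integral>\<^sup>+y. (\<integral>\<^sup>+x. f (Complex x y) \<partial>lborel) \<partial>lborel)"
proof -
  interpret product_sigma_finite "\<lambda>_::complex. lborel :: real measure" ..
  have B: "Basis - {1} = {\<i>}" by (auto simp: Basis_complex_def)
  have C: "t *\<^sub>R \<i> + s *\<^sub>R 1 = Complex s t" for s t
    by (simp add: complex_eq_iff)
  have [measurable]: "(\<lambda>y. \<integral>\<^sup>+s. f (y + s *\<^sub>R 1) \<partial>lborel) \<in> borel_measurable borel"
    by measurable
  have "(\<integral>\<^sup>+w. f w \<partial>lborel) = (\<integral>\<^sup>+y. (\<integral>\<^sup>+s. f (y + s *\<^sub>R 1) \<partial>lborel) \<partial>hyperplane_lborel 1)"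
    by (rule nn_integral_lborel_hyperplane) auto
  also have "\<dots> = (\<integral>\<^sup>+p. (\<integral>\<^sup>+s. f (p \<i> *\<^sub>R \<i> + s *\<^sub>R 1) \<partial>lborel) \<partial>(\<Pi>\<^sub>M i\<in>{\<i>}. lborel))"
    unfolding hyperplane_lborel_def B by (subst nn_integral_distr) auto
  also have "\<dots> = (\<integral>\<^sup>+t. (\<integral>\<^sup>+s. f (t *\<^sub>R \<i> + s *\<^sub>R 1) \<partial>lborel) \<partial>lborel)"
    by (rule product_nn_integral_singleton[where f = "\<lambda>t. \<integral>\<^sup>+s. f (t *\<^sub>R \<i> + s *\<^sub>R 1) \<partial>lborel"]) measurable
  finally show ?thesis
    unfolding C .
qed

lemma measurable_Complex [measurable]:
  "f \<in> borel_measurable M \<Longrightarrow> g \<in> borel_measurable M \<Longrightarrow> (\<lambda>x. Complex (f x) (g x)) \<in> borel_measurable M"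
  unfolding Complex_eq
  by (intro borel_measurable_add borel_measurable_times borel_measurable_const
      measurable_compose[OF _ borel_measurable_continuous_onI[of complex_of_real]]) (auto intro!: continuous_intros)

lemma borel_measurable_cis [measurable]: "cis \<in> borel_measurable borel"
  by (intro borel_measurable_continuous_onI continuous_intros)

text \<open>On the horizontal line at height \<open>y > 0\<close> substitute \<open>x = y * cot \<theta>\<close>; then, for fixed \<open>\<theta>\<close>, \<open>y = r * sin \<theta>\<close>.\<close>

lemma nn_integral_upper_half_plane_polar:
  fixes f :: "complex \<Rightarrow> ennreal"
  assumes f[measurable]: "f \<in> borel_measurable borel"
  shows "(\<integral>\<^sup>+y. indicator {0<..} y * (\<integral>\<^sup>+x. f (Complex x y) \<partial>lborel) \<partial>lborel)
       = (\<integral>\<^sup>+r. indicator {0<..} r * (\<integral>\<^sup>+\<theta>. indicator {0<..<pi} \<theta> * (ennreal r * f (of_real r * cis \<theta>)) \<partial>lborel) \<partial>lborel)"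
proof -
  have line: "(\<integral>\<^sup>+x. f (Complex x y) \<partial>lborel) =
      (\<integral>\<^sup>+\<theta>. indicator {0<..<pi} \<theta> * (ennreal \<bar>- y / (sin \<theta>)\<^sup>2\<bar> * f (Complex (y * cos \<theta> / sin \<theta>) y)) \<partial>lborel)"
    if y: "0 < y" for y
  proof -
    let ?h = "\<lambda>\<theta>. y * cos \<theta> / sin \<theta>"
    have image: "?h ` {0<..<pi} = UNIV"
    proof (intro equalityI subset_UNIV subsetI)
      fix x :: real
      \<comment> \<open>The angle whose cotangent is x / y is the complement of the arctangent of x
        / y.\<close>
      define a where "a = arctan (x / y)"
      have "- (pi / 2) < a" "a < pi / 2"
        using arctan_bounded[of "x / y"] by (auto simp: a_def)
      moreover from this have "0 < cos a"
        by (rule cos_gt_zero_pi)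
      moreover have "tan a = x / y"
        by (simp add: a_def tan_arctan)
      moreover have "cos (pi / 2 - a) = sin a" "sin (pi / 2 - a) = cos a"
        by (simp_all add: cos_diff sin_diff)
      ultimately have "?h (pi / 2 - a) = x" "pi / 2 - a \<in> {0<..<pi}"
        using y by (simp_all add: tan_def field_simps)
      then show "x \<in> ?h ` {0<..<pi}" by force
    qed
    have inj: "inj_on ?h {0<..<pi}"
    proof (rule inj_onI)
      fix s t assume st: "s \<in> {0<..<pi}" "t \<in> {0<..<pi}" and eq: "?h s = ?h t"
      have "0 < sin s" "0 < sin t"
        using st by (auto intro: sin_gt_zero)
      \<comment> \<open>Equality of the cotangents, cross-multiplied, is the subtraction formula for
        the sine.\<close>
      then have "sin (s - t) = 0"
        using eq y by (simp add: sin_diff field_simps)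
      moreover have "- pi < s - t" "s - t < pi"
        using st by auto
      ultimately have "s - t = 0"
        by (metis sin_eq_0_pi)
      then show "s = t" by simp
    qed
    have deriv: "(?h has_field_derivative - y / (sin t)\<^sup>2) (at t within {0<..<pi})" if "t \<in> {0<..<pi}" for t
    proof -
      have "sin t \<noteq> 0"
        using that sin_gt_zero[of t] by auto
      then have "(?h has_field_derivative (y * (- sin t) * sin t - y * cos t * cos t) / (sin t * sin t)) (at t within {0<..<pi})"
        by (auto intro!: derivative_eq_intros)
      moreover have "y * (- sin t) * sin t - y * cos t * cos t = - y * ((sin t)\<^sup>2 + (cos t)\<^sup>2)"
        by (simp only: power2_eq_square) algebra
      ultimately show ?thesis
        by (simp only: sin_cos_squared_add mult_1_right) (simp add: power2_eq_square)
    qed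
    have "(\<integral>\<^sup>+x. f (Complex x y) \<partial>lborel) = (\<integral>\<^sup>+x. indicator (?h ` {0<..<pi}) x * f (Complex x y) \<partial>lborel)"
      by (simp add: image)
    also have "\<dots> = (\<integral>\<^sup>+\<theta>. indicator {0<..<pi} \<theta> * (ennreal \<bar>- y / (sin \<theta>)\<^sup>2\<bar> * f (Complex (?h \<theta>) y)) \<partial>lborel)"
      by (rule nn_integral_differentiable_inj_image[OF _ deriv inj]) (simp_all add: image)
    finally show ?thesis .
  qed
  have ray: "(\<integral>\<^sup>+y. indicator {0<..} y * (ennreal \<bar>- y / (sin \<theta>)\<^sup>2\<bar> * f (Complex (y * cos \<theta> / sin \<theta>) y)) \<partial>lborel)
      = (\<integral>\<^sup>+r. indicator {0<..} r * (ennreal r * f (of_real r * cis \<theta>)) \<partial>lborel)"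
    if "\<theta> \<in> {0<..<pi}" for \<theta>
  proof -
    have s: "0 < sin \<theta>"
      using that by (auto intro: sin_gt_zero)
    have "(\<integral>\<^sup>+y. indicator {0<..} y * (ennreal \<bar>- y / (sin \<theta>)\<^sup>2\<bar> * f (Complex (y * cos \<theta> / sin \<theta>) y)) \<partial>lborel)
      = ennreal \<bar>sin \<theta>\<bar> * (\<integral>\<^sup>+r. indicator {0<..} (0 + sin \<theta> * r) * (ennreal \<bar>- (0 + sin \<theta> * r) / (sin \<theta>)\<^sup>2\<bar> *
          f (Complex ((0 + sin \<theta> * r) * cos \<theta> / sin \<theta>) (0 + sin \<theta> * r))) \<partial>lborel)"
      using s by (intro nn_integral_real_affine) auto
    also have "\<dots> = (\<integral>\<^sup>+r. ennreal \<bar>sin \<theta>\<bar> * (indicator {0<..} (0 + sin \<theta> * r) * (ennreal \<bar>- (0 + sin \<theta> * r) / (sin \<theta>)\<^sup>2\<bar> *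
          f (Complex ((0 + sin \<theta> * r) * cos \<theta> / sin \<theta>) (0 + sin \<theta> * r)))) \<partial>lborel)"
      by (rule nn_integral_cmult[symmetric]) measurable
    also have "\<dots> = (\<integral>\<^sup>+r. indicator {0<..} r * (ennreal r * f (of_real r * cis \<theta>)) \<partial>lborel)"
    proof (rule nn_integral_cong)
      fix r
      show "ennreal \<bar>sin \<theta>\<bar> * (indicator {0<..} (0 + sin \<theta> * r) * (ennreal \<bar>- (0 + sin \<theta> * r) / (sin \<theta>)\<^sup>2\<bar> *
          f (Complex ((0 + sin \<theta> * r) * cos \<theta> / sin \<theta>) (0 + sin \<theta> * r))))
        = indicator {0<..} r * (ennreal r * f (of_real r * cis \<theta>))"
      proof (cases "0 < r")
        case True
        have "Complex ((0 + sin \<theta> * r) * cos \<theta> / sin \<theta>) (0 + sin \<theta> * r) = of_real r * cis \<theta>"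
          using s by (simp add: complex_eq_iff)
        moreover have "ennreal \<bar>sin \<theta>\<bar> * ennreal \<bar>- (0 + sin \<theta> * r) / (sin \<theta>)\<^sup>2\<bar> = ennreal r"
          using s True by (simp add: abs_mult power2_eq_square flip: ennreal_mult)
        ultimately show ?thesis
          using s True by (simp add: mult.assoc[symmetric])
      qed (use s in \<open>simp add: zero_less_mult_iff\<close>)
    qed
    finally show ?thesis .
  qed
  have "(\<integral>\<^sup>+y. indicator {0<..} y * (\<integral>\<^sup>+x. f (Complex x y) \<partial>lborel) \<partial>lborel) =
    (\<integral>\<^sup>+y. (\<integral>\<^sup>+\<theta>. indicator {0<..<pi} \<theta> * (indicator {0<..} y * (ennreal \<bar>- y / (sin \<theta>)\<^sup>2\<bar> * f (Complex (y * cos \<theta> / sin \<theta>) y))) \<partial>lborel) \<partial>lborel)"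
    by (intro nn_integral_cong) (auto simp: indicator_def line)
  also have "\<dots> = (\<integral>\<^sup>+\<theta>. (\<integral>\<^sup>+y. indicator {0<..<pi} \<theta> * (indicator {0<..} y * (ennreal \<bar>- y / (sin \<theta>)\<^sup>2\<bar> * f (Complex (y * cos \<theta> / sin \<theta>) y))) \<partial>lborel) \<partial>lborel)"
    by (rule lborel_pair.Fubini') measurable
  also have "\<dots> = (\<integral>\<^sup>+\<theta>. (\<integral>\<^sup>+r. indicator {0<..<pi} \<theta> * (indicator {0<..} r * (ennreal r * f (of_real r * cis \<theta>))) \<partial>lborel) \<partial>lborel)"
  proof (rule nn_integral_cong)
    fix \<theta>
    show "(\<integral>\<^sup>+y. indicator {0<..<pi} \<theta> * (indicator {0<..} y * (ennreal \<bar>- y / (sin \<theta>)\<^sup>2\<bar> * f (Complex (y * cos \<theta> / sin \<theta>) y))) \<partial>lborel)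
      = (\<integral>\<^sup>+r. indicator {0<..<pi} \<theta> * (indicator {0<..} r * (ennreal r * f (of_real r * cis \<theta>))) \<partial>lborel)"
      using ray[of \<theta>] by (cases "\<theta> \<in> {0<..<pi}") simp_all
  qed
  also have "\<dots> = (\<integral>\<^sup>+r. (\<integral>\<^sup>+\<theta>. indicator {0<..<pi} \<theta> * (indicator {0<..} r * (ennreal r * f (of_real r * cis \<theta>))) \<partial>lborel) \<partial>lborel)"
    by (rule lborel_pair.Fubini') measurable
  also have "\<dots> = (\<integral>\<^sup>+r. indicator {0<..} r * (\<integral>\<^sup>+\<theta>. indicator {0<..<pi} \<theta> * (ennreal r * f (of_real r * cis \<theta>)) \<partial>lborel) \<partial>lborel)"
    by (intro nn_integral_cong) (auto simp: indicator_def)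
  finally show ?thesis .
qed

text \<open>The half-turn w to - w carries the lower half-plane to the upper one and shifts the
  angle by pi. The real axis and the angles 0 and pi are null and drop out.\<close>

lemma nn_integral_complex_polar:
  fixes f :: "complex \<Rightarrow> ennreal"
  assumes f[measurable]: "f \<in> borel_measurable borel"
  shows "(\<integral>\<^sup>+w. f w \<partial>lborel) =
    (\<integral>\<^sup>+r. indicator {0<..} r * (\<integral>\<^sup>+\<theta>. indicator {0..<2 * pi} \<theta> * (ennreal r * f (of_real r * cis \<theta>)) \<partial>lborel) \<partial>lborel)"
proof -
  let ?g = "\<lambda>y. \<integral>\<^sup>+x. f (Complex x y) \<partial>lborel"
  have minus: "Complex (- x) (- y) = - Complex x y" for x y
    by (simp add: complex_eq_iff)
  have lower: "(\<integral>\<^sup>+y. indicator {..<0} y * ?g y \<partial>lborel) =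
      (\<integral>\<^sup>+r. indicator {0<..} r * (\<integral>\<^sup>+\<theta>. indicator {pi<..<2 * pi} \<theta> * (ennreal r * f (of_real r * cis \<theta>)) \<partial>lborel) \<partial>lborel)"
  proof -
    have g: "?g (- y) = (\<integral>\<^sup>+x. f (- Complex x y) \<partial>lborel)" for y
      using nn_integral_real_affine[where c = "- 1" and t = 0 and f = "\<lambda>x. f (Complex x (- y))"]
      by (simp add: minus)
    have "(\<integral>\<^sup>+y. indicator {..<0} y * ?g y \<partial>lborel) = (\<integral>\<^sup>+y. indicator {..<0} (- y) * ?g (- y) \<partial>lborel)"
      using nn_integral_real_affine[where c = "- 1" and t = 0 and f = "\<lambda>y. indicator {..<0} y * ?g y"] by simp
    also have "\<dots> = (\<integral>\<^sup>+y. indicator {0<..} y * (\<integral>\<^sup>+x. f (- Complex x y) \<partial>lborel) \<partial>lborel)"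
      by (intro nn_integral_cong) (simp add: g indicator_def)
    also have "\<dots> = (\<integral>\<^sup>+r. indicator {0<..} r * (\<integral>\<^sup>+\<theta>. indicator {0<..<pi} \<theta> * (ennreal r * f (- (of_real r * cis \<theta>))) \<partial>lborel) \<partial>lborel)"
      by (rule nn_integral_upper_half_plane_polar) measurable
    also have "\<dots> = (\<integral>\<^sup>+r. indicator {0<..} r * (\<integral>\<^sup>+\<theta>. indicator {pi<..<2 * pi} \<theta> * (ennreal r * f (of_real r * cis \<theta>)) \<partial>lborel) \<partial>lborel)"
    proof (rule nn_integral_cong)
      fix r :: real
      have "(\<integral>\<^sup>+\<theta>. indicator {pi<..<2 * pi} \<theta> * (ennreal r * f (of_real r * cis \<theta>)) \<partial>lborel)
        = (\<integral>\<^sup>+\<theta>. indicator {pi<..<2 * pi} (pi + \<theta>) * (ennreal r * f (of_real r * cis (pi + \<theta>))) \<partial>lborel)"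
      proof (subst nn_integral_real_affine[where c = 1 and t = pi])
        have "{pi<..<2 * pi} \<in> sets borel" by simp
        then show "(\<lambda>\<theta>. indicator {pi<..<2 * pi} \<theta> * (ennreal r * f (of_real r * cis \<theta>))) \<in> borel_measurable borel"
          by measurable
      qed simp_all
      also have "\<dots> = (\<integral>\<^sup>+\<theta>. indicator {0<..<pi} \<theta> * (ennreal r * f (- (of_real r * cis \<theta>))) \<partial>lborel)"
        by (intro nn_integral_cong) (auto simp: indicator_def cis_mult[symmetric])
      finally show "indicator {0<..} r * (\<integral>\<^sup>+\<theta>. indicator {0<..<pi} \<theta> * (ennreal r * f (- (of_real r * cis \<theta>))) \<partial>lborel)
        = indicator {0<..} r * (\<integral>\<^sup>+\<theta>. indicator {pi<..<2 * pi} \<theta> * (ennreal r * f (of_real r * cis \<theta>)) \<partial>lborel)"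
        by simp
    qed
    finally show ?thesis .
  qed
  have "(\<integral>\<^sup>+w. f w \<partial>lborel) = (\<integral>\<^sup>+y. ?g y \<partial>lborel)"
    by (rule nn_integral_lborel_complex) measurable
  also have "\<dots> = (\<integral>\<^sup>+y. indicator {0<..} y * ?g y + indicator {..<0} y * ?g y \<partial>lborel)"
  proof (rule nn_integral_cong_AE)
    show "AE y in lborel. ?g y = indicator {0<..} y * ?g y + indicator {..<0} y * ?g y"
      using AE_lborel_singleton[of "0::real"] by eventually_elim (auto simp: indicator_def)
  qed
  also have "\<dots> = (\<integral>\<^sup>+y. indicator {0<..} y * ?g y \<partial>lborel) + (\<integral>\<^sup>+y. indicator {..<0} y * ?g y \<partial>lborel)"
    by (rule nn_integral_add) measurable
  also have "\<dots> = (\<integral>\<^sup>+r. indicator {0<..} r * (\<integral>\<^sup>+\<theta>. indicator {0<..<pi} \<theta> * (ennreal r * f (of_real r * cis \<theta>)) \<partial>lborel)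
     + indicator {0<..} r * (\<integral>\<^sup>+\<theta>. indicator {pi<..<2 * pi} \<theta> * (ennreal r * f (of_real r * cis \<theta>)) \<partial>lborel) \<partial>lborel)"
    unfolding lower nn_integral_upper_half_plane_polar[OF f] by (rule nn_integral_add[symmetric]) measurable
  also have "\<dots> = (\<integral>\<^sup>+r. indicator {0<..} r * (\<integral>\<^sup>+\<theta>. indicator {0..<2 * pi} \<theta> * (ennreal r * f (of_real r * cis \<theta>)) \<partial>lborel) \<partial>lborel)"
  proof (rule nn_integral_cong)
    fix r :: real
    have "(\<integral>\<^sup>+\<theta>. indicator {0..<2 * pi} \<theta> * (ennreal r * f (of_real r * cis \<theta>)) \<partial>lborel)
      = (\<integral>\<^sup>+\<theta>. indicator {0<..<pi} \<theta> * (ennreal r * f (of_real r * cis \<theta>)) +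
          indicator {pi<..<2 * pi} \<theta> * (ennreal r * f (of_real r * cis \<theta>)) \<partial>lborel)"
    proof (rule nn_integral_cong_AE)
      show "AE \<theta> in lborel. indicator {0..<2 * pi} \<theta> * (ennreal r * f (of_real r * cis \<theta>)) =
          indicator {0<..<pi} \<theta> * (ennreal r * f (of_real r * cis \<theta>)) +
          indicator {pi<..<2 * pi} \<theta> * (ennreal r * f (of_real r * cis \<theta>))"
        using AE_lborel_singleton[of "0::real"] AE_lborel_singleton[of pi]
        by eventually_elim (auto simp: indicator_def)
    qed
    also have "\<dots> = (\<integral>\<^sup>+\<theta>. indicator {0<..<pi} \<theta> * (ennreal r * f (of_real r * cis \<theta>)) \<partial>lborel)
         + (\<integral>\<^sup>+\<theta>. indicator {pi<..<2 * pi} \<theta> * (ennreal r * f (of_real r * cis \<theta>)) \<partial>lborel)"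
      by (rule nn_integral_add) measurable
    finally show "indicator {0<..} r * (\<integral>\<^sup>+\<theta>. indicator {0<..<pi} \<theta> * (ennreal r * f (of_real r * cis \<theta>)) \<partial>lborel)
     + indicator {0<..} r * (\<integral>\<^sup>+\<theta>. indicator {pi<..<2 * pi} \<theta> * (ennreal r * f (of_real r * cis \<theta>)) \<partial>lborel)
      = indicator {0<..} r * (\<integral>\<^sup>+\<theta>. indicator {0..<2 * pi} \<theta> * (ennreal r * f (of_real r * cis \<theta>)) \<partial>lborel)"
      by (simp add: distrib_left)
  qed
  finally show ?thesis .
qed

section \<open>The sphere and the egg as level sets\<close>

lemma cylindrical_sphere:
  assumes "2 \<le> DIM('a::euclidean_space)"
  shows "cylindrical (Basis :: 'a set) (\<lambda>_. 0)"
proof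
  have "partial_deriv (\<lambda>_::'a. 0::real) i = (\<lambda>_. 0)" for i
    by (auto simp: partial_deriv_def)
  then show "continuous_on UNIV (partial_deriv (\<lambda>_::'a. 0::real) i)" for i
    by simp
qed (use assms in auto)

text \<open>With all coordinates dilated the gradient of \<open>rho\<close> is 2 x, so
  \<open>area_density\<close> is 1 on the sphere and surface measure is the cone measure
  itself.\<close>

lemma nn_integral_hypersurface_measure_sphere:
  fixes f :: "'a::euclidean_space \<Rightarrow> ennreal"
  assumes dim: "2 \<le> DIM('a)" and f[measurable]: "f \<in> borel_measurable borel"
  shows "(\<integral>\<^sup>+x. f x \<partial>hypersurface_measure (sphere 0 1)) =
    of_nat DIM('a) * (\<integral>\<^sup>+x. indicator {x. x \<noteq> 0 \<and> norm x < 1} x * f ((1 / norm x) *\<^sub>R x) \<partial>lborel)"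
proof -
  interpret cylindrical "Basis :: 'a set" "\<lambda>_. 0"
    by (rule cylindrical_sphere[OF dim])
  have proj: "proj x = x" for x
    by (simp add: proj_def euclidean_representation)
  have sphere: "sphere 0 1 = {x. rho x = 0}"
    by (auto simp: rho_def proj power2_eq_1_iff) (metis norm_ge_zero neg_0_le_iff_le not_one_le_zero)
  have rad: "radial x = (1 / norm x) *\<^sub>R x" for x
    by (simp add: radial_def dil_def cyl_gauge_def proj)
  have dom: "unit_dom = {x. x \<noteq> 0 \<and> norm x < 1}"
    by (auto simp: unit_dom_def cyl_dom_def cyl_gauge_def proj)
  have grad: "real_gradient rho x = 2 *\<^sub>R x" for x
    by (rule euclidean_eqI) (simp add: real_gradient_inner partial_deriv_rho_I)
  have area: "area_density x = 1" if "rho x = 0" for x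
  proof -
    have "norm x = 1"
      using that sphere by (metis mem_Collect_eq mem_sphere_0)
    then show ?thesis
      by (simp add: area_density_def grad proj)
  qed
  have ae: "AE x in cone_measure. ennreal (area_density x) * f x = f x"
    using AE_cone_measure by eventually_elim (simp add: area)
  have "(\<integral>\<^sup>+x. f x \<partial>hypersurface_measure (sphere 0 1)) = (\<integral>\<^sup>+x. f x \<partial>cone_measure)"
    unfolding sphere hypersurface_measure_eq by (simp add: nn_integral_density nn_integral_cong_AE[OF ae])
  also have "\<dots> = of_nat DIM('a) * (\<integral>\<^sup>+x. indicator {x. x \<noteq> 0 \<and> norm x < 1} x * f ((1 / norm x) *\<^sub>R x) \<partial>lborel)"
    by (simp add: nn_integral_cone_measure rad dom)
  finally show ?thesis .
qed

text \<open>Scaling by \<open>R\<close> leaves the direction of x unchanged and contributes the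
  power of \<open>R\<close>. The slices of the cone over the boundary of the egg at fixed w are such
  balls.\<close>

lemma nn_integral_punctured_ball_normalize:
  fixes f :: "'a::euclidean_space \<Rightarrow> ennreal"
  assumes dim: "2 \<le> DIM('a)" and f[measurable]: "f \<in> borel_measurable borel" and R: "0 < R"
  shows "of_nat DIM('a) * (\<integral>\<^sup>+x. indicator {x. x \<noteq> 0 \<and> norm x < R} x * f ((1 / norm x) *\<^sub>R x) \<partial>lborel)
    = ennreal (R ^ DIM('a)) * (\<integral>\<^sup>+x. f x \<partial>hypersurface_measure (sphere 0 1))"
proof -
  have "(\<integral>\<^sup>+x. indicator {x. x \<noteq> 0 \<and> norm x < R} x * f ((1 / norm x) *\<^sub>R x) \<partial>(lborel :: 'a measure))
    = (\<integral>\<^sup>+x. ennreal (R ^ DIM('a)) * (indicator {x. x \<noteq> 0 \<and> norm x < R} (0 + R *\<^sub>R x) *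
        f ((1 / norm (0 + R *\<^sub>R x)) *\<^sub>R (0 + R *\<^sub>R x))) \<partial>lborel)"
    using R by (subst lborel_affine[of R 0]) (simp_all add: nn_integral_density nn_integral_distr)
  also have "\<dots> = ennreal (R ^ DIM('a)) * (\<integral>\<^sup>+x. indicator {x. x \<noteq> 0 \<and> norm x < R} (0 + R *\<^sub>R x) *
        f ((1 / norm (0 + R *\<^sub>R x)) *\<^sub>R (0 + R *\<^sub>R x)) \<partial>(lborel :: 'a measure))"
    by (rule nn_integral_cmult) measurable
  also have "(\<integral>\<^sup>+x. indicator {x. x \<noteq> 0 \<and> norm x < R} (0 + R *\<^sub>R x) *
        f ((1 / norm (0 + R *\<^sub>R x)) *\<^sub>R (0 + R *\<^sub>R x)) \<partial>(lborel :: 'a measure))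
     = (\<integral>\<^sup>+x. indicator {x. x \<noteq> 0 \<and> norm x < 1} x * f ((1 / norm x) *\<^sub>R x) \<partial>lborel)"
    using R by (intro nn_integral_cong) (auto simp: indicator_def)
  finally show ?thesis
    by (simp add: nn_integral_hypersurface_measure_sphere[OF dim f] mult_ac)
qed

text \<open>The total mass is the dimension times the volume of the punctured unit ball. Finiteness
  is what makes Fubini available with the sphere as a factor.\<close>

lemma finite_measure_hypersurface_measure_sphere:
  assumes dim: "2 \<le> DIM('a::euclidean_space)"
  shows "finite_measure (hypersurface_measure (sphere (0::'a) 1))"
proof
  have "emeasure (hypersurface_measure (sphere (0::'a) 1)) UNIV = (\<integral>\<^sup>+x. 1 \<partial>hypersurface_measure (sphere (0::'a) 1))"
    by simp
  also have "\<dots> = of_nat DIM('a) * (\<integral>\<^sup>+x. indicator {x. x \<noteq> 0 \<and> norm x < 1} x \<partial>(lborel :: 'a measure))"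
    by (subst nn_integral_hypersurface_measure_sphere[OF dim]) auto
  also have "(\<integral>\<^sup>+x. indicator {x. x \<noteq> 0 \<and> norm x < 1} x \<partial>(lborel :: 'a measure)) = emeasure lborel {x::'a. x \<noteq> 0 \<and> norm x < 1}"
    by (rule nn_integral_indicator) simp
  finally have "emeasure (hypersurface_measure (sphere (0::'a) 1)) UNIV = of_nat DIM('a) * emeasure lborel {x::'a. x \<noteq> 0 \<and> norm x < 1}" .
  moreover have "emeasure lborel {x::'a. x \<noteq> 0 \<and> norm x < 1} < \<infinity>"
    by (rule emeasure_bounded_finite) (auto intro!: boundedI[of _ 1])
  ultimately show "emeasure (hypersurface_measure (sphere (0::'a) 1)) (space (hypersurface_measure (sphere (0::'a) 1))) \<noteq> \<infinity>"
    by (simp add: ennreal_mult_eq_top_iff)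
qed

lemma AE_hypersurface_measure_sphere:
  assumes dim: "2 \<le> DIM('a::euclidean_space)"
  shows "AE x in hypersurface_measure (sphere (0::'a) 1). x \<in> sphere 0 1"
proof -
  have "(\<integral>\<^sup>+x. indicator (- sphere 0 1) x \<partial>hypersurface_measure (sphere (0::'a) 1)) = 0"
    unfolding nn_integral_hypersurface_measure_sphere[OF dim borel_measurable_indicator[OF borel_comp[OF borel_closed[OF closed_sphere]]]]
    by (subst nn_integral_0_iff_AE[THEN iffD2]) (auto simp: indicator_def intro!: AE_I2)
  then show ?thesis
    by (subst (asm) nn_integral_0_iff_AE) (auto elim!: eventually_mono simp: indicator_def)
qed

text \<open>A power of an inner product is differentiable everywhere, whereas the norm is not at w =
  0.\<close>

definition egg_q :: "nat \<Rightarrow> (complex ^ 'k::finite) \<times> complex \<Rightarrow> real" where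
  "egg_q m x = (snd x \<bullet> snd x) ^ m"

definition egg_I :: "((complex ^ 'k::finite) \<times> complex) set" where
  "egg_I = (\<lambda>i. (i, 0)) ` Basis"

lemma egg_q_eq: "egg_q m x = norm (snd x) ^ (2 * m)"
  by (simp add: egg_q_def power_mult power2_norm_eq_inner)

lemma card_egg_I: "card (egg_I :: ((complex ^ 'k::finite) \<times> complex) set) = 2 * CARD('k)"
  by (simp add: egg_I_def card_image inj_on_def)

lemma egg_q_has_derivative:
  "(egg_q m has_derivative (\<lambda>v. real m * (snd x \<bullet> snd x) ^ (m - 1) * (2 * (snd x \<bullet> snd v)))) (at x)"
  unfolding egg_q_def[abs_def]
  by (auto intro!: derivative_eq_intros simp: inner_commute algebra_simps)

lemma cylindrical_egg: "cylindrical (egg_I :: ((complex ^ 'k::finite) \<times> complex) set) (egg_q m)"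
proof
  show "egg_I \<subseteq> (Basis :: ((complex ^ 'k) \<times> complex) set)"
    by (auto simp: egg_I_def Basis_prod_def)
  have "0 < CARD('k)" by simp
  then show "2 \<le> card (egg_I :: ((complex ^ 'k) \<times> complex) set)"
    unfolding card_egg_I by linarith
  show "egg_q m x = egg_q m y" if "\<And>i. i \<in> Basis - egg_I \<Longrightarrow> x \<bullet> i = y \<bullet> i" for x y :: "(complex ^ 'k) \<times> complex"
  proof -
    have "snd x \<bullet> j = snd y \<bullet> j" if "j \<in> Basis" for j
    proof -
      have "(0, j) \<in> Basis - (egg_I :: ((complex ^ 'k) \<times> complex) set)"
        using that by (auto simp: egg_I_def Basis_prod_def)
      from \<open>\<And>i. i \<in> Basis - egg_I \<Longrightarrow> x \<bullet> i = y \<bullet> i\<close>[OF this] show ?thesis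
        by (simp add: inner_prod_def)
    qed
    then have "snd x = snd y"
      by (rule euclidean_eqI)
    then show ?thesis
      by (simp add: egg_q_def)
  qed
  show "egg_q m differentiable (at x)" for x :: "(complex ^ 'k) \<times> complex"
    using egg_q_has_derivative differentiableI by blast
  show "continuous_on UNIV (partial_deriv (egg_q m :: (complex ^ 'k) \<times> complex \<Rightarrow> real) i)" for i
    unfolding partial_deriv_has_derivative[OF egg_q_has_derivative, abs_def]
    by (intro continuous_intros)
qed

section \<open>The bordered Hessian\<close>

text \<open>Subtracting multiples of the diagonal rows clears the border row, and the same on
  columns clears the border column. What remains is diagonal.\<close>

lemma det_bordered_diagonal:
  fixes d u v :: "'i::finite \<Rightarrow> complex"
  assumes d: "\<And>i. d i \<noteq> 0"
  shows "det (\<chi> r c. case (r, c) of (None, None) \<Rightarrow> 0 | (None, Some j) \<Rightarrow> v j | (Some i, None) \<Rightarrow> u i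
            | (Some i, Some j) \<Rightarrow> if i = j then d j else 0)
       = - (\<Sum>i\<in>UNIV. u i * v i / d i) * (\<Prod>i\<in>UNIV. d i)"
    (is "det ?A = _")
proof -
  \<comment> \<open>The Schur complement of the diagonal block, which ends up in the corner.\<close>
  define c where "c = - (\<Sum>i\<in>UNIV. u i * v i / d i)"
  define B where "B = (\<chi> k. if k = None then row None ?A + (\<Sum>i\<in>UNIV. (- v i / d i) *s row (Some i) ?A) else row k ?A)"
  \<comment> \<open>The rows of the transpose are the columns of \<open>B\<close>, so the same row
    operation now clears the border column.\<close>
  define D where "D = (\<chi> k. if k = None then row None (transpose B) + (\<Sum>i\<in>UNIV. (- u i / d i) *s row (Some i) (transpose B))
      else row k (transpose B))"
  have delta: "(\<Sum>i\<in>UNIV. f i * (if i = j then d j else 0)) = f j * d j" for f :: "'i \<Rightarrow> complex" and j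
    by (simp add: if_distrib cong: if_cong)
  have B: "B $ r $ s = (case (r, s) of (None, None) \<Rightarrow> c | (None, Some j) \<Rightarrow> 0 | (Some i, None) \<Rightarrow> u i
            | (Some i, Some j) \<Rightarrow> if i = j then d j else 0)" for r s
  proof (cases r)
    case None
    show ?thesis
    proof (cases s)
      case (Some a)
      have "B $ None $ Some a = v a + (\<Sum>i\<in>UNIV. (- v i / d i) * (if i = a then d a else 0))"
        by (simp add: B_def row_def)
      also have "\<dots> = 0"
        using d unfolding delta by simp
      finally show ?thesis
        using None Some by simp
    qed (use None in \<open>simp add: B_def row_def c_def mult_ac flip: sum_negf\<close>)
  qed (auto simp: B_def row_def split: option.split)
  have D: "D $ r $ s = (case (r, s) of (None, None) \<Rightarrow> c | (Some i, Some j) \<Rightarrow> if i = j then d j else 0 | _ \<Rightarrow> 0)" for r s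
  proof (cases r)
    case None
    show ?thesis
    proof (cases s)
      case (Some a)
      have "D $ None $ Some a = u a + (\<Sum>i\<in>UNIV. (- u i / d i) * (if i = a then d a else 0))"
        by (auto simp: D_def row_def transpose_def B intro!: sum.cong)
      also have "\<dots> = 0"
        using d unfolding delta by simp
      finally show ?thesis
        using None Some by simp
    qed (use None in \<open>simp add: D_def row_def transpose_def B\<close>)
  qed (auto simp: D_def row_def transpose_def B split: option.split)
  have "det B = det ?A"
    unfolding B_def
    by (rule det_row_span, rule vec.span_sum, rule vec.span_scale, rule vec.span_base) auto
  moreover have "det D = det (transpose B)"
    unfolding D_def
    by (rule det_row_span, rule vec.span_sum, rule vec.span_scale, rule vec.span_base) auto
  moreover have "det D = (\<Prod>r\<in>UNIV. D $ r $ r)"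
    by (rule det_diagonal) (auto simp: D split: option.split)
  moreover have "(\<Prod>r\<in>UNIV. D $ r $ r) = c * (\<Prod>i\<in>UNIV. d i)"
    by (simp add: UNIV_option_conv prod.reindex D)
  ultimately show ?thesis
    by (simp add: det_transpose c_def)
qed

lemma d_hol_has_derivative:
  "(f has_derivative f') (at p) \<Longrightarrow> d_hol i f p = (f' (coord_vec i 1) - \<i> * f' (coord_vec i \<i>)) / 2"
  by (simp add: d_hol_def partial_deriv_has_derivative)

lemma d_antihol_has_derivative:
  "(f has_derivative f') (at p) \<Longrightarrow> d_antihol i f p = (f' (coord_vec i 1) + \<i> * f' (coord_vec i \<i>)) / 2"
  by (simp add: d_antihol_def partial_deriv_has_derivative)

text \<open>As a polynomial in the coordinates and their conjugates, the defining function can be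
  differentiated by the product rule at every point, including w = 0.\<close>

lemma of_real_egg_rho:
  "complex_of_real (egg_rho m p) = (\<Sum>j\<in>UNIV. (fst p $ j) * cnj (fst p $ j)) + (snd p * cnj (snd p)) ^ m - 1"
proof -
  have "(norm (fst p))\<^sup>2 = (\<Sum>j\<in>UNIV. (norm (fst p $ j))\<^sup>2)"
    by (simp add: norm_vec_def L2_set_def sum_nonneg)
  then have "complex_of_real ((norm (fst p))\<^sup>2) = (\<Sum>j\<in>UNIV. (fst p $ j) * cnj (fst p $ j))"
    by (simp add: complex_norm_square del: of_real_power)
  moreover have "complex_of_real (norm (snd p) ^ (2 * m)) = (snd p * cnj (snd p)) ^ m"
    by (simp add: power_mult complex_norm_square[symmetric])
  ultimately show ?thesis
    by (simp add: egg_rho_def case_prod_beta)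
qed

lemma of_real_egg_rho_has_derivative:
  "((\<lambda>p. complex_of_real (egg_rho m p)) has_derivative
     (\<lambda>v. (\<Sum>j\<in>UNIV. (fst p $ j) * cnj (fst v $ j) + (fst v $ j) * cnj (fst p $ j)) +
          of_nat m * (snd p * cnj (snd v) + snd v * cnj (snd p)) * (snd p * cnj (snd p)) ^ (m - 1))) (at p)"
proof -
  have nth: "((\<lambda>p. fst p $ j) has_derivative (\<lambda>v. fst v $ j)) (at p)" for j and p :: "(complex ^ 'k) \<times> complex"
    by (rule bounded_linear_imp_has_derivative)
       (rule bounded_linear_compose[OF bounded_linear_vec_nth bounded_linear_fst])
  have 1: "((\<lambda>p. \<Sum>j\<in>UNIV. (fst p $ j) * cnj (fst p $ j)) has_derivative
     (\<lambda>v. \<Sum>j\<in>UNIV. (fst p $ j) * cnj (fst v $ j) + (fst v $ j) * cnj (fst p $ j))) (at p)"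
    by (intro has_derivative_sum has_derivative_mult has_derivative_cnj nth)
  have 2: "((\<lambda>p. (snd p * cnj (snd p)) ^ m) has_derivative
      (\<lambda>v. of_nat m * (snd p * cnj (snd v) + snd v * cnj (snd p)) * (snd p * cnj (snd p)) ^ (m - 1))) (at p)"
    by (intro has_derivative_power has_derivative_mult has_derivative_cnj has_derivative_snd has_derivative_ident)
  from has_derivative_diff[OF has_derivative_add[OF 1 2] has_derivative_const[of 1]]
  show ?thesis
    unfolding of_real_egg_rho by (simp only: diff_zero)
qed

lemma sum_axis:
  fixes f :: "'k::finite \<Rightarrow> complex"
  shows "(\<Sum>j\<in>UNIV. f j * cnj (axis i c $ j) + axis i c $ j * cnj (f j)) = f i * cnj c + c * cnj (f i)"
proof -
  have "(\<Sum>j\<in>UNIV. f j * cnj (axis i c $ j) + axis i c $ j * cnj (f j)) =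
      (\<Sum>j\<in>UNIV. if j = i then f j * cnj c + c * cnj (f j) else 0)"
    by (intro sum.cong) (auto simp: axis_def)
  then show ?thesis by simp
qed

lemma d_antihol_egg_rho:
  "d_antihol i (\<lambda>p. complex_of_real (egg_rho m p)) p =
     (case i of Some j \<Rightarrow> fst p $ j | None \<Rightarrow> of_nat m * (snd p * cnj (snd p)) ^ (m - 1) * snd p)"
  unfolding d_antihol_has_derivative[OF of_real_egg_rho_has_derivative]
  by (cases i; simp only: coord_vec.simps fst_conv snd_conv sum_axis; simp add: algebra_simps)

lemma d_hol_egg_rho:
  "d_hol i (\<lambda>p. complex_of_real (egg_rho m p)) p =
     (case i of Some j \<Rightarrow> cnj (fst p $ j) | None \<Rightarrow> of_nat m * (snd p * cnj (snd p)) ^ (m - 1) * cnj (snd p))"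
  unfolding d_hol_has_derivative[OF of_real_egg_rho_has_derivative]
  by (cases i; simp only: coord_vec.simps fst_conv snd_conv sum_axis; simp add: algebra_simps)

lemma d_hol_d_antihol_egg_rho:
  assumes m: "1 \<le> m"
  shows "d_hol i (d_antihol j (\<lambda>p. complex_of_real (egg_rho m p))) p =
     (if i = j then case j of Some _ \<Rightarrow> 1 | None \<Rightarrow> (of_nat m)\<^sup>2 * (snd p * cnj (snd p)) ^ (m - 1) else 0)"
proof (cases j)
  case (Some l)
  have "((\<lambda>p. fst p $ l) has_derivative (\<lambda>v. fst v $ l)) (at p)"
    by (rule bounded_linear_imp_has_derivative)
       (rule bounded_linear_compose[OF bounded_linear_vec_nth bounded_linear_fst])
  moreover have "d_antihol j (\<lambda>p. complex_of_real (egg_rho m p)) = (\<lambda>p. fst p $ l)"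
    using Some by (simp add: d_antihol_egg_rho fun_eq_iff)
  ultimately show ?thesis
    using Some by (cases i) (auto simp: d_hol_has_derivative axis_def)
next
  case None
  let ?W = "snd p * cnj (snd p)"
  define f where "f = (\<lambda>v :: (complex ^ 'a) \<times> complex. of_nat m * ?W ^ (m - 1) * snd v +
    of_nat m * (of_nat (m - 1) * (snd p * cnj (snd v) + snd v * cnj (snd p)) * ?W ^ (m - 1 - 1)) * snd p)"
  have snd: "(snd has_derivative snd) (at p)"
    by (intro has_derivative_snd has_derivative_ident)
  have "((\<lambda>p. of_nat m * (snd p * cnj (snd p)) ^ (m - 1) * snd p) has_derivative f) (at p)"
    using has_derivative_mult[OF has_derivative_mult[OF has_derivative_const[of "of_nat m"]
        has_derivative_power[OF has_derivative_mult[OF snd has_derivative_cnj[OF snd]]]] snd]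
    by (simp only: f_def mult_zero_left add_0_right)
  moreover have "d_antihol j (\<lambda>p. complex_of_real (egg_rho m p)) = (\<lambda>p. of_nat m * (snd p * cnj (snd p)) ^ (m - 1) * snd p)"
    using None by (simp add: d_antihol_egg_rho fun_eq_iff)
  ultimately have eq: "d_hol i (d_antihol j (\<lambda>p. complex_of_real (egg_rho m p))) p =
     (f (coord_vec i 1) - \<i> * f (coord_vec i \<i>)) / 2"
    by (simp only: d_hol_has_derivative)
  \<comment> \<open>The combination of the derivatives in directions 1 and \<open>\<i>\<close>
    cancels the terms that come from \<open>cnj\<close> of the direction; the letters keep the
    powers opaque to the simplifier.\<close>
  have f_w: "(M * X * 1 + M * (N * (w * cnj 1 + 1 * cnj w) * Y) * w -
      \<i> * (M * X * \<i> + M * (N * (w * cnj \<i> + \<i> * cnj w) * Y) * w)) / 2 = M * (N * (Y * (w * cnj w)) + X)"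
    for M N X Y w :: complex
    by (simp add: algebra_simps)
  show ?thesis
  proof (cases i)
    case (Some l)
    with None show ?thesis
      unfolding eq by (simp add: f_def)
  next
    case i: None
    have "d_hol i (d_antihol j (\<lambda>p. complex_of_real (egg_rho m p))) p =
      of_nat m * (of_nat (m - 1) * (?W ^ (m - 1 - 1) * ?W) + ?W ^ (m - 1))"
      unfolding eq unfolding f_def i coord_vec.simps snd_conv by (rule f_w)
    \<comment> \<open>For m = 1 the exponent \<open>m - 1 - 1\<close> is truncated to 0 and the
      powers on the two sides differ, but the coefficient \<open>m - 1\<close> vanishes.\<close>
    also have "of_nat (m - 1) * (?W ^ (m - 1 - 1) * ?W) = of_nat (m - 1) * ?W ^ (m - 1)"
    proof (cases "m - 1")
      case (Suc l)
      then have "?W ^ (m - 1 - 1) * ?W = ?W ^ (m - 1)"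
        by (simp only: diff_Suc_1 power_Suc mult.commute)
      then show ?thesis by simp
    qed simp
    also have "of_nat m * (of_nat (m - 1) * ?W ^ (m - 1) + ?W ^ (m - 1)) = (of_nat m)\<^sup>2 * ?W ^ (m - 1)"
      using m by (simp add: of_nat_diff power2_eq_square algebra_simps)
    finally show ?thesis
      using i None by simp
  qed
qed

text \<open>The complex Hessian is diagonal, with entry 1 for each coordinate of z and m^2
  |w|^(2m-2) for w. The determinant formula multiplies the product of these entries by the sum of u
  v / d, which is |z|^2 + |w|^(2m) and hence 1 on the boundary.\<close>

lemma fefferman_M_egg_rho:
  fixes p :: "(complex ^ 'k::finite) \<times> complex"
  assumes m: "1 \<le> m" and p: "egg_rho m p = 0"
  shows "fefferman_M (egg_rho m) p = of_real ((real m)\<^sup>2 * norm (snd p) ^ (2 * m - 2))"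
proof -
  let ?W = "snd p * cnj (snd p)"
  define d :: "'k option \<Rightarrow> complex" where
    "d = (\<lambda>i. case i of Some _ \<Rightarrow> 1 | None \<Rightarrow> (of_nat m)\<^sup>2 * ?W ^ (m - 1))"
  define u :: "'k option \<Rightarrow> complex" where
    "u = (\<lambda>i. d_hol i (\<lambda>p. complex_of_real (egg_rho m p)) p)"
  define v :: "'k option \<Rightarrow> complex" where
    "v = (\<lambda>i. d_antihol i (\<lambda>p. complex_of_real (egg_rho m p)) p)"
  have H: "bordered_hessian (egg_rho m) p = (\<chi> r c. case (r, c) of (None, None) \<Rightarrow> 0 | (None, Some j) \<Rightarrow> v j | (Some i, None) \<Rightarrow> u i
            | (Some i, Some j) \<Rightarrow> if i = j then d j else 0)"
    unfolding bordered_hessian_def Let_def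
    by (simp add: vec_eq_iff u_def v_def d_def d_hol_d_antihol_egg_rho[OF m] split: option.split)
  have W: "?W = of_real ((norm (snd p))\<^sup>2)"
    by (rule complex_norm_square[symmetric])
  have norm: "of_real ((real m)\<^sup>2 * norm (snd p) ^ (2 * m - 2)) = (of_nat m)\<^sup>2 * ?W ^ (m - 1)"
  proof -
    have "2 * m - 2 = 2 * (m - 1)" by simp
    then show ?thesis
      unfolding W by (simp add: power_mult)
  qed
  show ?thesis
  proof (cases "d None = 0")
    \<comment> \<open>Division by \<open>d None\<close> is impossible here. This happens for w = 0
      and m > 1; the border entry of that row then vanishes too, so the matrix has a zero
      row.\<close>
    case True
    then have "?W ^ (m - 1) = 0"
      using m by (simp add: d_def)
    then have "u None = 0"
      by (simp add: u_def d_hol_egg_rho)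
    then have "row (Some None) (bordered_hessian (egg_rho m) p) = 0"
      using True by (simp add: H row_def vec_eq_iff split: option.split)
    then have "det (bordered_hessian (egg_rho m) p) = 0"
      by (rule det_zero_row(1)[rotated -1])
    then show ?thesis
      using True unfolding fefferman_M_def norm by (simp add: d_def)
  next
    case False
    then have d: "d i \<noteq> 0" for i
      by (cases i) (simp_all add: d_def)
    then have W0: "?W ^ (m - 1) \<noteq> 0" "of_nat m \<noteq> (0::complex)"
      using d[of None] by (simp_all add: d_def)
    have "u None * v None / d None = ?W ^ (m - 1) * ?W"
      using W0 by (simp add: u_def v_def d_def d_hol_egg_rho d_antihol_egg_rho power2_eq_square field_simps)
    also have "\<dots> = ?W ^ m"
      using m by (simp add: power_eq_if)
    finally have "(\<Sum>i\<in>UNIV. u i * v i / d i) = ?W ^ m + (\<Sum>j\<in>UNIV. (fst p $ j) * cnj (fst p $ j))"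
      by (simp add: UNIV_option_conv sum.reindex) (simp add: u_def v_def d_def d_hol_egg_rho d_antihol_egg_rho mult.commute)
    also have "\<dots> = 1"
      using of_real_egg_rho[of m p] p by (simp add: algebra_simps)
    finally have "det (bordered_hessian (egg_rho m) p) = - (\<Prod>i\<in>UNIV. d i)"
      unfolding H det_bordered_diagonal[OF d] by simp
    also have "(\<Prod>i\<in>UNIV. d i) = d None"
      by (simp add: UNIV_option_conv prod.reindex) (simp add: d_def)
    finally show ?thesis
      unfolding fefferman_M_def norm by (simp add: d_def)
  qed
qed

section \<open>The Fefferman measure in coordinates\<close>

text \<open>No measurability is needed, which spares a proof that the Fefferman determinant is measurable.\<close>

lemma density_cong_AE:
  assumes "AE x in M. f x = g x"
  shows "density M f = density M g"
proof -
  have "(\<integral>\<^sup>+x. f x * indicator A x \<partial>M) = (\<integral>\<^sup>+x. g x * indicator A x \<partial>M)" for A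
    using assms by (intro nn_integral_cong_AE) (auto elim!: eventually_mono)
  then show ?thesis
    unfolding density_def by simp
qed

lemma borel_measurable_fst [measurable]:
  "(fst :: 'a::topological_space \<times> 'b::topological_space \<Rightarrow> 'a) \<in> borel_measurable borel"
  by (intro borel_measurable_continuous_onI continuous_intros)

lemma borel_measurable_snd [measurable]:
  "(snd :: 'a::topological_space \<times> 'b::topological_space \<Rightarrow> 'b) \<in> borel_measurable borel"
  by (intro borel_measurable_continuous_onI continuous_intros)

section \<open>The boundary of the egg as a cylindrical level set\<close>

locale egg_setting =
  fixes m k :: nat and bE :: "((complex ^ 'k::finite) \<times> complex) set"
  assumes m: "1 \<le> m" and k: "CARD('k) = k" and frontier: "bE = frontier (egg m)"
begin

sublocale cylindrical "egg_I :: ((complex ^ 'k) \<times> complex) set" "egg_q m"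
  by (rule cylindrical_egg)

definition R :: "real \<Rightarrow> real" where "R r = sqrt (1 - r ^ (2 * m))"

lemma proj_eq: "proj (x :: (complex ^ 'k) \<times> complex) = (fst x, 0)"
proof -
  have "proj x = (\<Sum>j\<in>Basis. ((fst x \<bullet> j) *\<^sub>R j, 0))"
    unfolding proj_def by (simp add: egg_I_def sum.reindex inj_on_def inner_prod_def)
  also have "\<dots> = (fst x, 0)"
    by (simp add: prod_eq_iff fst_sum snd_sum euclidean_representation)
  finally show ?thesis .
qed

lemma rho_eq_egg_rho: "rho = egg_rho m"
  by (auto simp: rho_def egg_rho_def proj_eq egg_q_eq fun_eq_iff)

text \<open>Points of the level set are limits of t x with t increasing to 1. These lie in the egg,
  since t^(2m) is at most t^2 for t in the unit interval and so the two terms sum to at most t^2 <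
  1.\<close>

lemma bE_eq: "bE = {x. egg_rho m x = 0}"
proof -
  have egg: "egg m = {x :: (complex ^ 'k) \<times> complex. egg_rho m x < 0}"
    by (auto simp: egg_def egg_rho_def)
  have cont: "continuous_on UNIV (egg_rho m :: (complex ^ 'k) \<times> complex \<Rightarrow> real)"
    unfolding egg_rho_def case_prod_beta by (intro continuous_intros)
  have "open (egg m :: ((complex ^ 'k) \<times> complex) set)"
    unfolding egg using cont by (intro open_Collect_less) auto
  then have int: "interior (egg m) = (egg m :: ((complex ^ 'k) \<times> complex) set)"
    by (rule interior_open)
  have "closed {x :: (complex ^ 'k) \<times> complex. egg_rho m x \<le> 0}"
    using cont by (intro closed_Collect_le) auto
  then have "closure (egg m) \<subseteq> {x :: (complex ^ 'k) \<times> complex. egg_rho m x \<le> 0}"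
    by (rule closure_minimal[rotated]) (auto simp: egg)
  moreover have "x \<in> closure (egg m)" if x: "egg_rho m x = 0" for x :: "(complex ^ 'k) \<times> complex"
  proof (rule closure_sequential[THEN iffD2], intro exI conjI allI)
    show "(\<lambda>i. (real i / (1 + real i)) *\<^sub>R x) \<longlonglongrightarrow> x"
    proof -
      have "(\<lambda>i. real i / (1 + real i)) \<longlonglongrightarrow> 1"
        using LIMSEQ_n_over_Suc_n[where 'a = real] by simp
      from tendsto_scaleR[OF this tendsto_const[of x]] show ?thesis by simp
    qed
    have "t *\<^sub>R x \<in> egg m" if t: "0 \<le> t" "t < 1" for t
    proof -
      have sum: "(norm (fst x))\<^sup>2 + norm (snd x) ^ (2 * m) = 1"
        using x by (simp add: egg_rho_def case_prod_beta)
      have "t ^ (2 * m) \<le> t\<^sup>2"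
        using t m by (intro power_decreasing) auto
      then have "t ^ (2 * m) * norm (snd x) ^ (2 * m) \<le> t\<^sup>2 * norm (snd x) ^ (2 * m)"
        by (intro mult_right_mono) auto
      then have "t\<^sup>2 * (norm (fst x))\<^sup>2 + t ^ (2 * m) * norm (snd x) ^ (2 * m)
          \<le> t\<^sup>2 * ((norm (fst x))\<^sup>2 + norm (snd x) ^ (2 * m))"
        unfolding distrib_left by simp
      also have "\<dots> < 1"
        unfolding sum using t by (simp add: power_less_one_iff)
      finally show ?thesis
        using t(1) by (simp add: egg_def case_prod_beta power_mult_distrib)
    qed
    then show "(real i / (1 + real i)) *\<^sub>R x \<in> egg m" for i
      by simp
  qed
  ultimately show ?thesis
    unfolding frontier frontier_def int by (auto simp: egg less_le)
qed

lemma cyl_dom_eq: "cyl_dom = {x :: (complex ^ 'k) \<times> complex. fst x \<noteq> 0 \<and> norm (snd x) < 1}"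
  using m by (auto simp: cyl_dom_def proj_eq egg_q_eq power_less_one_iff zero_prod_def)

lemma R_pos: "0 \<le> r \<Longrightarrow> r < 1 \<Longrightarrow> 0 < R r"
  using m by (simp add: R_def power_less_one_iff)

lemma R_squared: "0 \<le> r \<Longrightarrow> r \<le> 1 \<Longrightarrow> (R r)\<^sup>2 = 1 - r ^ (2 * m)"
  by (simp add: R_def power_le_one)

lemma borel_measurable_R [measurable]: "R \<in> borel_measurable borel"
  unfolding R_def by measurable

lemma cyl_gauge_eq: "cyl_gauge (x :: (complex ^ 'k) \<times> complex) = norm (fst x) / R (norm (snd x))"
  by (simp add: cyl_gauge_def proj_eq egg_q_eq R_def)

lemma unit_dom_eq: "unit_dom = {x :: (complex ^ 'k) \<times> complex. norm (snd x) < 1 \<and> fst x \<noteq> 0 \<and> norm (fst x) < R (norm (snd x))}"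
proof (rule set_eqI)
  fix x :: "(complex ^ 'k) \<times> complex"
  show "x \<in> unit_dom \<longleftrightarrow> x \<in> {x. norm (snd x) < 1 \<and> fst x \<noteq> 0 \<and> norm (fst x) < R (norm (snd x))}"
    using R_pos[of "norm (snd x)"] by (auto simp: unit_dom_def cyl_dom_eq cyl_gauge_eq)
qed

lemma radial_eq: "radial (x :: (complex ^ 'k) \<times> complex) = (R (norm (snd x)) *\<^sub>R ((1 / norm (fst x)) *\<^sub>R fst x), snd x)"
  by (auto simp: radial_def dil_def cyl_gauge_eq proj_eq prod_eq_iff)

text \<open>The gradient components in the z-directions are twice the coordinates of z, and z is
  nonzero on \<open>cyl_dom\<close>. This rules out the default value of division by zero in the
  Fefferman density.\<close>

lemma norm_real_gradient_pos: "x \<in> cyl_dom \<Longrightarrow> 0 < norm (real_gradient rho (x :: (complex ^ 'k) \<times> complex))"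
proof -
  assume x: "x \<in> cyl_dom"
  have "4 * (norm (proj x))\<^sup>2 = (\<Sum>i\<in>egg_I. (partial_deriv rho i x)\<^sup>2)"
    by (simp add: norm_proj partial_deriv_rho_I power_mult_distrib sum_distrib_left)
  also have "\<dots> \<le> (norm (real_gradient rho x))\<^sup>2"
    unfolding norm_real_gradient using I by (intro sum_mono2) auto
  finally show ?thesis
    using x by (auto simp: cyl_dom_def)
qed

section \<open>The Fefferman measure as a density over the cone measure\<close>

lemma hypersurface_measure_bE: "hypersurface_measure bE = density cone_measure (\<lambda>x. ennreal (area_density x))"
  using hypersurface_measure_eq by (simp add: bE_eq rho_eq_egg_rho)

lemma AE_hypersurface_measure_bE: "AE x in hypersurface_measure bE. x \<in> cyl_dom \<and> x \<in> bE"
proof -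
  have "AE x in cone_measure. 0 < ennreal (area_density x) \<longrightarrow> x \<in> cyl_dom \<and> x \<in> bE"
    using AE_cone_measure by eventually_elim (simp add: bE_eq rho_eq_egg_rho)
  then show ?thesis
    unfolding hypersurface_measure_bE by (subst AE_density) auto
qed

text \<open>The power of M in the Fefferman measure at |w| = r; the exponent is 1 / (n + 1) with n =
  k + 1.\<close>

definition M_power :: "real \<Rightarrow> real" where
  "M_power r = ((real m)\<^sup>2 * r ^ (2 * m - 2)) powr (1 / (real k + 2))"

lemma M_power_nonneg: "0 \<le> M_power r"
  by (simp add: M_power_def)

lemma borel_measurable_M_power [measurable]: "M_power \<in> borel_measurable borel"
  unfolding M_power_def by measurable

text \<open>The gradient length in \<open>area_density\<close> cancels the one in the Fefferman
  density, so it never has to be computed.\<close>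

lemma fefferman_measure_bE:
  "fefferman_measure bE (egg_rho m) =
    density cone_measure (\<lambda>x. ennreal (M_power (norm (snd x)) / (2 * (norm (fst x))\<^sup>2)))"
proof -
  have "fefferman_measure bE (egg_rho m) = density (hypersurface_measure bE)
      (\<lambda>x. ennreal (M_power (norm (snd x)) / norm (real_gradient rho x)))"
    unfolding fefferman_measure_def
  proof (rule density_cong_AE)
    show "AE p in hypersurface_measure bE. ennreal (Re (fefferman_M (egg_rho m) p) powr (1 / (real CARD('k option) + 1)) /
        norm (real_gradient (egg_rho m) p)) = ennreal (M_power (norm (snd p)) / norm (real_gradient rho p))"
      using AE_hypersurface_measure_bE
      by eventually_elim (simp add: bE_eq fefferman_M_egg_rho[OF m] M_power_def rho_eq_egg_rho k add.commute)
  qed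
  also have "\<dots> = density cone_measure (\<lambda>x. ennreal (area_density x) * ennreal (M_power (norm (snd x)) / norm (real_gradient rho x)))"
    unfolding hypersurface_measure_bE by (rule density_density_eq) measurable
  also have "\<dots> = density cone_measure (\<lambda>x. ennreal (M_power (norm (snd x)) / (2 * (norm (fst x))\<^sup>2)))"
  proof (rule density_cong_AE)
    show "AE x in cone_measure. ennreal (area_density x) * ennreal (M_power (norm (snd x)) / norm (real_gradient rho x)) =
        ennreal (M_power (norm (snd x)) / (2 * (norm (fst x))\<^sup>2))"
      using AE_cone_measure
    proof eventually_elim
      case (elim x)
      then have "0 < norm (real_gradient rho x)"
        using norm_real_gradient_pos by blast
      then have "area_density x * (M_power (norm (snd x)) / norm (real_gradient rho x)) =
          M_power (norm (snd x)) / (2 * (norm (fst x))\<^sup>2)"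
        by (simp add: area_density_def proj_eq norm_Pair)
      moreover have "0 \<le> area_density x"
        by (simp add: area_density_def)
      ultimately show ?case
        by (simp add: M_power_nonneg flip: ennreal_mult)
    qed
  qed
  finally show ?thesis .
qed

lemma dim_ge_2: "2 \<le> DIM(complex ^ 'k)"
proof -
  have "0 < CARD('k)" by simp
  then show ?thesis by simp
qed

text \<open>The factor r is the Jacobian of polar coordinates in w, \<open>R r ^ (2 * k)\<close> the
  volume scaling of the slice in z-space of real dimension 2 k, and the last factor the density over
  the cone measure at |z| = \<open>R r\<close>.\<close>

definition weight :: "real \<Rightarrow> real" where
  "weight r = r * (R r ^ (2 * k) * (M_power r / (2 * (R r)\<^sup>2)))"

lemma borel_measurable_weight [measurable]: "weight \<in> borel_measurable borel"
  unfolding weight_def by measurable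

abbreviation sphere_measure :: "(complex ^ 'k) measure" where
  "sphere_measure \<equiv> hypersurface_measure (sphere 0 1)"

lemma finite_sphere_measure: "finite_measure sphere_measure"
  using dim_ge_2 by (rule finite_measure_hypersurface_measure_sphere)

text \<open>At fixed w, \<open>unit_dom\<close> is a punctured ball of radius
  \<open>R (norm w)\<close> in z, on which the integrand depends only on the direction of z. Each
  slice is therefore a sphere integral, and polar coordinates treat the remaining integral over
  w.\<close>

lemma nn_integral_fefferman_measure:
  assumes h[measurable]: "h \<in> borel_measurable borel"
  shows "(\<integral>\<^sup>+p. h p \<partial>fefferman_measure bE (egg_rho m)) =
    (\<integral>\<^sup>+r. indicator {0<..<1} r * (\<integral>\<^sup>+\<theta>. indicator {0..<2 * pi} \<theta> *
       (\<integral>\<^sup>+\<xi>. ennreal (weight r) * h (egg_param m (\<xi>, r, \<theta>)) \<partial>sphere_measure) \<partial>lborel) \<partial>lborel)"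
proof -
  interpret S: finite_measure sphere_measure
    by (rule finite_sphere_measure)
  define C where "C = (\<lambda>r. ennreal (M_power r / (2 * (R r)\<^sup>2)))"
  have C[measurable]: "C \<in> borel_measurable borel"
    unfolding C_def by measurable
  \<comment> \<open>The number 2 k normalizes the cone measure of the egg and is also the real
    dimension of z-space, so it is absorbed when a slice becomes a sphere integral.\<close>
  let ?n = "of_nat (2 * k) :: ennreal"
  have n: "?n = of_nat (card (egg_I :: ((complex ^ 'k) \<times> complex) set))"
    by (simp add: card_egg_I k)
  define G where "G = (\<lambda>w. C (norm w) * (\<integral>\<^sup>+\<xi>. h (R (norm w) *\<^sub>R \<xi>, w) \<partial>sphere_measure))"
  have G[measurable]: "G \<in> borel_measurable borel"
    unfolding G_def by measurable
  have "(\<integral>\<^sup>+p. h p \<partial>fefferman_measure bE (egg_rho m)) =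
      (\<integral>\<^sup>+x. ennreal (M_power (norm (snd x)) / (2 * (norm (fst x))\<^sup>2)) * h x \<partial>cone_measure)"
    unfolding fefferman_measure_bE by (rule nn_integral_density) measurable
  also have "\<dots> = ?n * (\<integral>\<^sup>+x. indicator unit_dom x * (ennreal (M_power (norm (snd (radial x))) / (2 * (norm (fst (radial x)))\<^sup>2)) *
      h (radial x)) \<partial>lborel)"
    unfolding n by (rule nn_integral_cone_measure) measurable
  also have "(\<integral>\<^sup>+x. indicator unit_dom x * (ennreal (M_power (norm (snd (radial x))) / (2 * (norm (fst (radial x)))\<^sup>2)) * h (radial x)) \<partial>lborel)
    = (\<integral>\<^sup>+x. indicator unit_dom x * (C (norm (snd x)) * h (R (norm (snd x)) *\<^sub>R ((1 / norm (fst x)) *\<^sub>R fst x), snd x)) \<partial>lborel)"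
  proof (rule nn_integral_cong)
    fix x
    show "indicator unit_dom x * (ennreal (M_power (norm (snd (radial x))) / (2 * (norm (fst (radial x)))\<^sup>2)) * h (radial x))
      = indicator unit_dom x * (C (norm (snd x)) * h (R (norm (snd x)) *\<^sub>R ((1 / norm (fst x)) *\<^sub>R fst x), snd x))"
    proof (cases "x \<in> unit_dom")
      case True
      then have "norm (fst (radial x)) = R (norm (snd x))"
        using R_pos[of "norm (snd x)"] by (simp add: unit_dom_eq radial_eq)
      with True show ?thesis
        by (simp add: C_def radial_eq)
    qed simp
  qed
  also have "\<dots> = (\<integral>\<^sup>+w. (\<integral>\<^sup>+z. indicator unit_dom (z, w) * (C (norm w) * h (R (norm w) *\<^sub>R ((1 / norm z) *\<^sub>R z), w)) \<partial>lborel) \<partial>lborel)"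
  proof -
    let ?J = "\<lambda>x. indicator unit_dom x * (C (norm (snd x)) * h (R (norm (snd x)) *\<^sub>R ((1 / norm (fst x)) *\<^sub>R fst x), snd x))"
    have "?J \<in> borel_measurable borel" by measurable
    then have "?J \<in> borel_measurable (lborel \<Otimes>\<^sub>M lborel)"
      by (simp only: lborel_prod measurable_lborel2)
    from lborel_pair.nn_integral_snd[OF this] show ?thesis
      unfolding lborel_prod fst_conv snd_conv by (rule sym)
  qed
  also have "?n * \<dots> = (\<integral>\<^sup>+w. ?n * (\<integral>\<^sup>+z. indicator unit_dom (z, w) * (C (norm w) * h (R (norm w) *\<^sub>R ((1 / norm z) *\<^sub>R z), w)) \<partial>lborel) \<partial>lborel)"
    by (rule nn_integral_cmult[symmetric]) measurable
  also have "\<dots> = (\<integral>\<^sup>+w. indicator {w. norm w < 1} w * (ennreal (R (norm w) ^ (2 * k)) * G w) \<partial>lborel)"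
  proof (rule nn_integral_cong)
    fix w
    show "?n * (\<integral>\<^sup>+z. indicator unit_dom (z, w) * (C (norm w) * h (R (norm w) *\<^sub>R ((1 / norm z) *\<^sub>R z), w)) \<partial>lborel)
      = indicator {w. norm w < 1} w * (ennreal (R (norm w) ^ (2 * k)) * G w)"
    proof (cases "norm w < 1")
      case True
      have "(\<integral>\<^sup>+z. indicator unit_dom (z, w) * (C (norm w) * h (R (norm w) *\<^sub>R ((1 / norm z) *\<^sub>R z), w)) \<partial>lborel)
        = (\<integral>\<^sup>+z. indicator {z. z \<noteq> 0 \<and> norm z < R (norm w)} z * (C (norm w) * h (R (norm w) *\<^sub>R ((1 / norm z) *\<^sub>R z), w)) \<partial>lborel)"
        using True by (intro nn_integral_cong) (simp add: unit_dom_eq indicator_def)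
      moreover have "?n * \<dots> = ennreal (R (norm w) ^ (2 * k)) * (\<integral>\<^sup>+\<xi>. C (norm w) * h (R (norm w) *\<^sub>R \<xi>, w) \<partial>sphere_measure)"
        using nn_integral_punctured_ball_normalize[OF dim_ge_2, of "\<lambda>\<xi>. C (norm w) * h (R (norm w) *\<^sub>R \<xi>, w)" "R (norm w)"]
          R_pos[of "norm w"] True k by (simp add: mult.commute[of 2])
      ultimately show ?thesis
        using True by (simp add: G_def nn_integral_cmult)
    qed (simp add: unit_dom_eq)
  qed
  also have "\<dots> = (\<integral>\<^sup>+r. indicator {0<..} r * (\<integral>\<^sup>+\<theta>. indicator {0..<2 * pi} \<theta> * (ennreal r *
      (indicator {w. norm w < 1} (of_real r * cis \<theta>) * (ennreal (R (norm (of_real r * cis \<theta>)) ^ (2 * k)) * G (of_real r * cis \<theta>)))) \<partial>lborel) \<partial>lborel)"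
    by (rule nn_integral_complex_polar) measurable
  also have "\<dots> = (\<integral>\<^sup>+r. indicator {0<..<1} r * (\<integral>\<^sup>+\<theta>. indicator {0..<2 * pi} \<theta> *
       (\<integral>\<^sup>+\<xi>. ennreal (weight r) * h (egg_param m (\<xi>, r, \<theta>)) \<partial>sphere_measure) \<partial>lborel) \<partial>lborel)"
  proof (rule nn_integral_cong)
    fix r :: real
    show "indicator {0<..} r * (\<integral>\<^sup>+\<theta>. indicator {0..<2 * pi} \<theta> * (ennreal r *
      (indicator {w. norm w < 1} (of_real r * cis \<theta>) * (ennreal (R (norm (of_real r * cis \<theta>)) ^ (2 * k)) * G (of_real r * cis \<theta>)))) \<partial>lborel)
      = indicator {0<..<1} r * (\<integral>\<^sup>+\<theta>. indicator {0..<2 * pi} \<theta> *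
       (\<integral>\<^sup>+\<xi>. ennreal (weight r) * h (egg_param m (\<xi>, r, \<theta>)) \<partial>sphere_measure) \<partial>lborel)"
    proof (cases "0 < r \<and> r < 1")
      case True
      have w: "ennreal r * (ennreal (R r ^ (2 * k)) * C r) = ennreal (weight r)"
        using True R_pos[of r] M_power_nonneg[of r] by (simp add: weight_def C_def flip: ennreal_mult)
      have "ennreal r * (indicator {w. norm w < 1} (of_real r * cis \<theta>) * (ennreal (R (norm (of_real r * cis \<theta>)) ^ (2 * k)) * G (of_real r * cis \<theta>)))
        = (\<integral>\<^sup>+\<xi>. ennreal (weight r) * h (egg_param m (\<xi>, r, \<theta>)) \<partial>sphere_measure)" for \<theta>
      proof -
        have "ennreal r * (indicator {w. norm w < 1} (of_real r * cis \<theta>) * (ennreal (R (norm (of_real r * cis \<theta>)) ^ (2 * k)) * G (of_real r * cis \<theta>)))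
          = ennreal r * (ennreal (R r ^ (2 * k)) * C r) * (\<integral>\<^sup>+\<xi>. h (R r *\<^sub>R \<xi>, of_real r * cis \<theta>) \<partial>sphere_measure)"
          using True by (simp add: norm_mult G_def mult.assoc)
        also have "\<dots> = (\<integral>\<^sup>+\<xi>. ennreal (weight r) * h (R r *\<^sub>R \<xi>, of_real r * cis \<theta>) \<partial>sphere_measure)"
          unfolding w by (rule nn_integral_cmult[symmetric]) measurable
        finally show ?thesis
          by (simp add: egg_param_def R_def)
      qed
      with True show ?thesis by simp
    qed (auto simp: norm_mult indicator_def)
  qed
  finally show ?thesis .
qed

section \<open>Integration over the parameter space\<close>

abbreviation sphere_space :: "(complex ^ 'k) measure" where
  "sphere_space \<equiv> restrict_space sphere_measure (sphere 0 1)"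
abbreviation angle_space :: "real measure" where
  "angle_space \<equiv> restrict_space lborel {0..<2 * pi}"
abbreviation radius_space :: "real measure" where
  "radius_space \<equiv> restrict_space lborel {0..1}"
abbreviation param_space :: "((complex ^ 'k) \<times> real \<times> real) measure" where
  "param_space \<equiv> egg_param_measure"

lemma space_param_space: "space param_space = sphere 0 1 \<times> {0..1} \<times> {0..<2 * pi}"
  by (simp add: egg_param_measure_def space_pair_measure space_restrict_space)

lemma measurable_param_space [measurable]:
  "fst \<in> borel_measurable param_space"
  "(\<lambda>p. fst (snd p)) \<in> borel_measurable param_space"
  "(\<lambda>p. snd (snd p)) \<in> borel_measurable param_space"
proof -
  have id: "(\<lambda>x. x) \<in> borel_measurable sphere_space" "(\<lambda>x. x) \<in> borel_measurable angle_space"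
    "(\<lambda>x. x) \<in> borel_measurable radius_space"
    by (auto intro!: measurable_restrict_space1)
  show "fst \<in> borel_measurable param_space" "(\<lambda>p. fst (snd p)) \<in> borel_measurable param_space"
    "(\<lambda>p. snd (snd p)) \<in> borel_measurable param_space"
    unfolding egg_param_measure_def
    by (rule measurable_compose[OF measurable_fst id(1)]
        measurable_compose[OF measurable_compose[OF measurable_snd measurable_fst] id(3)]
        measurable_compose[OF measurable_compose[OF measurable_snd measurable_snd] id(2)])+
qed

lemma egg_param_eq: "egg_param m p = (R (fst (snd p)) *\<^sub>R fst p, of_real (fst (snd p)) * cis (snd (snd p)))"
  by (simp add: egg_param_def R_def case_prod_beta)

lemma borel_measurable_egg_param [measurable]: "egg_param m \<in> borel_measurable param_space"
  unfolding egg_param_eq[abs_def]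
  by (intro borel_measurable_Pair borel_measurable_scaleR borel_measurable_times
      measurable_compose[OF _ borel_measurable_R] measurable_compose[OF _ borel_measurable_cis]
      measurable_compose[OF _ borel_measurable_continuous_onI[of complex_of_real]] measurable_param_space)
     (auto intro!: continuous_intros)

text \<open>The sphere variable is put innermost to match
  \<open>nn_integral_fefferman_measure\<close>.\<close>

lemma nn_integral_param_space:
  assumes H[measurable]: "H \<in> borel_measurable param_space"
  shows "(\<integral>\<^sup>+p. H p \<partial>param_space) =
    (\<integral>\<^sup>+r. indicator {0..1} r * (\<integral>\<^sup>+\<theta>. indicator {0..<2 * pi} \<theta> * (\<integral>\<^sup>+\<xi>. H (\<xi>, r, \<theta>) \<partial>sphere_space) \<partial>lborel) \<partial>lborel)"
proof -
  interpret S: finite_measure sphere_measure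
    by (rule finite_sphere_measure)
  interpret S': finite_measure sphere_space
    by (rule finite_measure_restrict_space[OF S.finite_measure_axioms]) simp
  interpret A: sigma_finite_measure angle_space
    by (rule sigma_finite_measure_restrict_space[OF lborel.sigma_finite_measure_axioms]) simp
  interpret B: sigma_finite_measure radius_space
    by (rule sigma_finite_measure_restrict_space[OF lborel.sigma_finite_measure_axioms]) simp
  interpret BA: pair_sigma_finite radius_space angle_space ..
  interpret SBA: pair_sigma_finite sphere_space "radius_space \<Otimes>\<^sub>M angle_space" ..
  have H'[measurable]: "H \<in> borel_measurable (sphere_space \<Otimes>\<^sub>M (radius_space \<Otimes>\<^sub>M angle_space))"
    using H unfolding egg_param_measure_def .
  have "(\<integral>\<^sup>+p. H p \<partial>param_space) = (\<integral>\<^sup>+q. (\<integral>\<^sup>+\<xi>. H (\<xi>, q) \<partial>sphere_space) \<partial>(radius_space \<Otimes>\<^sub>M angle_space))"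
    unfolding egg_param_measure_def by (rule SBA.nn_integral_snd[OF H', symmetric])
  also have "\<dots> = (\<integral>\<^sup>+r. (\<integral>\<^sup>+\<theta>. (\<integral>\<^sup>+\<xi>. H (\<xi>, r, \<theta>) \<partial>sphere_space) \<partial>angle_space) \<partial>radius_space)"
    by (rule A.nn_integral_fst[symmetric]) measurable
  also have "\<dots> = (\<integral>\<^sup>+r. indicator {0..1} r * (\<integral>\<^sup>+\<theta>. indicator {0..<2 * pi} \<theta> * (\<integral>\<^sup>+\<xi>. H (\<xi>, r, \<theta>) \<partial>sphere_space) \<partial>lborel) \<partial>lborel)"
    by (simp add: nn_integral_restrict_space mult.commute)
  finally show ?thesis .
qed

lemma nn_integral_sphere_space: "(\<integral>\<^sup>+\<xi>. f \<xi> \<partial>sphere_space) = (\<integral>\<^sup>+\<xi>. f \<xi> \<partial>sphere_measure)"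
proof -
  have "(\<integral>\<^sup>+\<xi>. f \<xi> \<partial>sphere_space) = (\<integral>\<^sup>+\<xi>. f \<xi> * indicator (sphere 0 1) \<xi> \<partial>sphere_measure)"
    by (rule nn_integral_restrict_space) simp
  also have "\<dots> = (\<integral>\<^sup>+\<xi>. f \<xi> \<partial>sphere_measure)"
  proof (rule nn_integral_cong_AE)
    show "AE \<xi> in sphere_measure. f \<xi> * indicator (sphere 0 1) \<xi> = f \<xi>"
      using AE_hypersurface_measure_sphere[OF dim_ge_2] by eventually_elim simp
  qed
  finally show ?thesis .
qed

lemma nn_integral_fefferman_measure_param:
  assumes h[measurable]: "h \<in> borel_measurable borel"
  shows "(\<integral>\<^sup>+p. h p \<partial>fefferman_measure bE (egg_rho m)) =
    (\<integral>\<^sup>+p. indicator {0<..<1} (fst (snd p)) * (ennreal (weight (fst (snd p))) * h (egg_param m p)) \<partial>param_space)"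
proof -
  have "(\<integral>\<^sup>+p. indicator {0<..<1} (fst (snd p)) * (ennreal (weight (fst (snd p))) * h (egg_param m p)) \<partial>param_space)
    = (\<integral>\<^sup>+r. indicator {0..1} r * (\<integral>\<^sup>+\<theta>. indicator {0..<2 * pi} \<theta> *
        (\<integral>\<^sup>+\<xi>. indicator {0<..<1} r * (ennreal (weight r) * h (egg_param m (\<xi>, r, \<theta>))) \<partial>sphere_measure) \<partial>lborel) \<partial>lborel)"
    by (subst nn_integral_param_space) (simp_all add: nn_integral_sphere_space)
  also have "\<dots> = (\<integral>\<^sup>+r. indicator {0<..<1} r * (\<integral>\<^sup>+\<theta>. indicator {0..<2 * pi} \<theta> *
       (\<integral>\<^sup>+\<xi>. ennreal (weight r) * h (egg_param m (\<xi>, r, \<theta>)) \<partial>sphere_measure) \<partial>lborel) \<partial>lborel)"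
    by (intro nn_integral_cong) (simp add: indicator_def)
  finally show ?thesis
    by (simp add: nn_integral_fefferman_measure[OF h])
qed

text \<open>The excluded radii are those where fibres collapse: the angle is lost at r = 0 and the
  sphere variable at r = 1.\<close>

lemma AE_param_space: "AE p in param_space. 0 < fst (snd p) \<and> fst (snd p) < 1"
proof -
  let ?N = "{p \<in> space param_space. \<not> (0 < fst (snd p) \<and> fst (snd p) < 1)}"
  have N[measurable]: "?N \<in> sets param_space" by measurable
  have "emeasure param_space ?N = (\<integral>\<^sup>+p. indicator (- {0<..<1}) (fst (snd p)) \<partial>param_space)"
    by (subst nn_integral_indicator[OF N, symmetric]) (intro nn_integral_cong, auto simp: indicator_def)
  also have "\<dots> = (\<integral>\<^sup>+r. indicator {0..1} r * (\<integral>\<^sup>+\<theta>. indicator {0..<2 * pi} \<theta> *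
      (\<integral>\<^sup>+\<xi>. indicator (- {0<..<1}) r \<partial>sphere_space) \<partial>lborel) \<partial>(lborel :: real measure))"
    by (subst nn_integral_param_space) simp_all
  also have "\<dots> = (\<integral>\<^sup>+r. 0 \<partial>(lborel :: real measure))"
  proof (rule nn_integral_cong_AE)
    show "AE r in (lborel :: real measure). indicator {0..1} r * (\<integral>\<^sup>+\<theta>. indicator {0..<2 * pi} \<theta> *
      (\<integral>\<^sup>+\<xi>. indicator (- {0<..<1}) r \<partial>sphere_space) \<partial>lborel) = 0"
      using AE_lborel_singleton[of "0::real"] AE_lborel_singleton[of "1::real"]
      by eventually_elim (simp add: indicator_def)
  qed
  finally have "?N \<in> null_sets param_space"
    by (intro null_setsI) auto
  then show ?thesis
    by (rule AE_I') auto
qed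

text \<open>Dividing \<open>R r ^ (2 * k)\<close> by \<open>(R r)\<^sup>2\<close> leaves k - 1
  factors 1 - r^(2m); here r < 1 keeps \<open>R r\<close> nonzero. Positivity of r turns its powers
  into \<open>powr\<close>, and the factor r from polar coordinates adds 1 to the exponent.\<close>

lemma weight_eq:
  assumes r: "0 < r" "r < 1"
  shows "weight r = real m powr (2 / (real k + 2)) / 2 * r powr (2 * (real m - 1) / (real k + 2) + 1) * (1 - r ^ (2 * m)) ^ (k - 1)"
proof -
  have R0: "R r \<noteq> 0"
    using R_pos[of r] r by simp
  have R: "(R r)\<^sup>2 = 1 - r ^ (2 * m)"
    using R_squared[of r] r by simp
  have "R r ^ (2 * k) = ((R r)\<^sup>2) ^ (k - 1) * (R r)\<^sup>2"
  proof -
    have "0 < k"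
      unfolding k[symmetric] by simp
    then show ?thesis
      by (simp only: power_mult power_minus_mult)
  qed
  then have Rk: "R r ^ (2 * k) / (R r)\<^sup>2 = (1 - r ^ (2 * m)) ^ (k - 1)"
    using R R0 power_not_zero[OF R0, of 2] by simp
  have "r ^ (2 * m - 2) = r powr (2 * (real m - 1))"
    using r m by (simp add: of_nat_diff algebra_simps flip: powr_realpow)
  moreover have "(real m)\<^sup>2 = real m powr 2"
    using m by simp
  ultimately have M: "M_power r = real m powr (2 / (real k + 2)) * r powr (2 * (real m - 1) / (real k + 2))"
    unfolding M_power_def by (simp only: powr_mult powr_powr times_divide_eq_right mult_1_right)
  have "weight r = M_power r / 2 * r * (R r ^ (2 * k) / (R r)\<^sup>2)"
    by (simp add: weight_def)
  also have "\<dots> = real m powr (2 / (real k + 2)) / 2 * (r powr (2 * (real m - 1) / (real k + 2)) * r) * (1 - r ^ (2 * m)) ^ (k - 1)"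
    unfolding M Rk by simp
  also have "r powr (2 * (real m - 1) / (real k + 2)) * r = r powr (2 * (real m - 1) / (real k + 2) + 1)"
    using r by (simp add: powr_add)
  finally show ?thesis .
qed

section \<open>The inverse chart, the null fibres and the pullback\<close>

definition chart :: "(complex ^ 'k) \<times> complex \<Rightarrow> (complex ^ 'k) \<times> real \<times> real" where
  "chart x = ((1 / norm (fst x)) *\<^sub>R fst x, norm (snd x), Arg2pi (snd x))"

text \<open>Both collapsed loci are removed: at z = 0 the sphere variable is undetermined, at w = 0
  the angle.\<close>

definition chart_dom :: "((complex ^ 'k) \<times> complex) set" where
  "chart_dom = {x \<in> bE. fst x \<noteq> 0 \<and> snd x \<noteq> 0}"

lemma bE_iff: "x \<in> bE \<longleftrightarrow> (norm (fst x))\<^sup>2 + norm (snd x) ^ (2 * m) = 1"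
  by (auto simp: bE_eq egg_rho_def case_prod_beta)

lemma egg_param_in_bE:
  assumes "\<xi> \<in> sphere 0 1" "0 \<le> r" "r \<le> 1"
  shows "egg_param m (\<xi>, r, \<theta>) \<in> bE"
  using assms by (simp add: bE_iff egg_param_eq norm_mult power_mult_distrib R_squared)

lemma norm_bE:
  assumes "x \<in> bE"
  shows "norm (snd x) \<le> 1" "R (norm (snd x)) = norm (fst x)" "fst x \<noteq> 0 \<Longrightarrow> norm (snd x) < 1"
proof -
  have eq: "1 - norm (snd x) ^ (2 * m) = (norm (fst x))\<^sup>2"
    using assms by (simp add: bE_iff)
  then show "R (norm (snd x)) = norm (fst x)"
    by (simp add: R_def)
  have "norm (snd x) ^ (2 * m) \<le> 1"
    using eq zero_le_power2[of "norm (fst x)"] by linarith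
  then show "norm (snd x) \<le> 1"
    using m by (simp add: power_le_one_iff)
  assume "fst x \<noteq> 0"
  then have "0 < (norm (fst x))\<^sup>2" by simp
  with eq have "norm (snd x) ^ (2 * m) < 1" by linarith
  then show "norm (snd x) < 1"
    using m by (simp add: power_less_one_iff)
qed

lemma Arg2pi_cis: "of_real (norm w) * cis (Arg2pi w) = w"
  using Arg2pi_eq[of w] by (simp add: cis_conv_exp)

lemma egg_param_chart:
  assumes "x \<in> bE" "fst x \<noteq> 0"
  shows "egg_param m (chart x) = x"
  using norm_bE[OF assms(1)] assms(2) by (simp add: egg_param_eq chart_def Arg2pi_cis)

lemma chart_in:
  assumes "x \<in> bE" "fst x \<noteq> 0"
  shows "chart x \<in> sphere 0 1 \<times> {0..<1} \<times> {0..<2 * pi}"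
  using norm_bE[OF assms(1)] assms(2) Arg2pi[of "snd x"] by (simp add: chart_def)

lemma chart_egg_param:
  assumes "\<xi> \<in> sphere 0 1" "0 < r" "r < 1" "\<theta> \<in> {0..<2 * pi}"
  shows "chart (egg_param m (\<xi>, r, \<theta>)) = (\<xi>, r, \<theta>)"
proof -
  have "Arg2pi (of_real r * cis \<theta>) = \<theta>"
    using assms by (intro Arg2pi_unique[of r]) (auto simp: cis_conv_exp)
  then show ?thesis
    using assms R_pos[of r] by (simp add: chart_def egg_param_eq norm_mult)
qed

lemma egg_param_image: "egg_param m ` (sphere 0 1 \<times> {0..<1} \<times> {0..<2 * pi}) = {x \<in> bE. fst x \<noteq> 0}"
proof (intro subset_antisym subsetI)
  fix x :: "(complex ^ 'k) \<times> complex" assume "x \<in> egg_param m ` (sphere 0 1 \<times> {0..<1} \<times> {0..<2 * pi})"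
  then obtain \<xi> r \<theta> where x: "x = egg_param m (\<xi>, r, \<theta>)" "\<xi> \<in> sphere 0 1" "0 \<le> r" "r < 1" by auto
  moreover have "\<xi> \<noteq> 0" using x by auto
  ultimately show "x \<in> {x \<in> bE. fst x \<noteq> 0}"
    using R_pos[of r] egg_param_in_bE[of \<xi> r \<theta>] by (simp add: egg_param_eq)
next
  fix x assume "x \<in> {x \<in> bE. fst x \<noteq> 0}"
  then show "x \<in> egg_param m ` (sphere 0 1 \<times> {0..<1} \<times> {0..<2 * pi})"
    using egg_param_chart[of x] chart_in[of x] by (metis (mono_tags, lifting) image_eqI mem_Collect_eq)
qed

lemma inj_on_egg_param: "inj_on (egg_param m :: _ \<Rightarrow> (complex ^ 'k) \<times> complex) (sphere 0 1 \<times> {0<..<1} \<times> {0..<2 * pi})"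
  by (rule inj_on_inverseI[where g = chart]) (auto simp del: mem_sphere simp: chart_egg_param)

lemma closed_bE: "closed bE"
  unfolding frontier by (rule frontier_closed)

lemma null_sets_pole: "{x \<in> bE. fst x = 0} \<in> null_sets (hypersurface_measure bE)"
proof -
  have "closed (bE \<inter> {x. fst x = 0})"
    by (intro closed_Int closed_bE closed_Collect_eq continuous_intros)
  moreover have "bE \<inter> {x. fst x = 0} = {x \<in> bE. fst x = 0}" by auto
  ultimately have "{x \<in> bE. fst x = 0} \<in> sets borel"
    by (simp add: borel_closed)
  then show ?thesis
    using AE_hypersurface_measure_bE
    by (intro AE_iff_null_sets[THEN iffD2]) (auto elim!: eventually_mono simp: cyl_dom_eq)
qed

lemma sets_chart_dom [measurable]: "chart_dom \<in> sets borel"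
proof -
  have [measurable]: "bE \<in> sets borel" using closed_bE by (rule borel_closed)
  have "chart_dom = bE \<inter> {x. fst x \<noteq> 0 \<and> snd x \<noteq> 0}"
    by (auto simp: chart_dom_def)
  then show ?thesis by simp
qed

text \<open>\<open>Arg2pi\<close> is continuous off the nonnegative real axis and equals 0 on that
  axis, including the origin.\<close>

lemma borel_measurable_Arg2pi: "Arg2pi \<in> borel_measurable borel"
proof -
  have "(\<lambda>z. if z \<in> \<real>\<^sub>\<ge>\<^sub>0 then 0 else Arg2pi z) \<in> borel_measurable borel"
  proof (subst measurable_If_restrict_space_iff)
    have cont: "continuous_on (- \<real>\<^sub>\<ge>\<^sub>0) Arg2pi"
      by (intro continuous_at_imp_continuous_on) (auto intro: continuous_at_Arg2pi)
    show "(\<lambda>x. 0) \<in> borel_measurable (restrict_space borel {x::complex. x \<in> \<real>\<^sub>\<ge>\<^sub>0}) \<and>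
        Arg2pi \<in> borel_measurable (restrict_space borel {x. x \<notin> \<real>\<^sub>\<ge>\<^sub>0})"
      using borel_measurable_continuous_on_restrict[OF cont] by (simp add: Compl_eq)
  qed (simp add: borel_closed)
  moreover have "(\<lambda>z. if z \<in> \<real>\<^sub>\<ge>\<^sub>0 then 0 else Arg2pi z) = Arg2pi"
    by (auto simp: fun_eq_iff Arg2pi_eq_0 complex_nonneg_Reals_iff complex_is_Real_iff)
  ultimately show ?thesis by simp
qed

text \<open>The image of a measurable set under \<open>egg_param m\<close> is, within
  \<open>chart_dom\<close>, a preimage under \<open>chart\<close>; this is how it is seen to be
  Borel there.\<close>

lemma measurable_chart: "chart \<in> measurable (restrict_space borel chart_dom) param_space"
proof -
  have sp: "x \<in> chart_dom \<Longrightarrow> chart x \<in> sphere 0 1 \<times> {0..1} \<times> {0..<2 * pi}" for x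
    using chart_in[of x] by (cases "chart x") (auto simp: chart_dom_def)
  have 1: "(\<lambda>x :: (complex ^ 'k) \<times> complex. (1 / norm (fst x)) *\<^sub>R fst x) \<in> borel_measurable borel"
    by measurable
  have 2: "(\<lambda>x :: (complex ^ 'k) \<times> complex. norm (snd x)) \<in> borel_measurable borel" 
    by measurable
  have 3: "(\<lambda>x :: (complex ^ 'k) \<times> complex. Arg2pi (snd x)) \<in> borel_measurable borel" 
    by (rule measurable_compose[OF borel_measurable_snd borel_measurable_Arg2pi])
  show ?thesis
    unfolding chart_def[abs_def] egg_param_measure_def
  proof (intro measurable_Pair measurable_restrict_space2)
    show "(\<lambda>x. (1 / norm (fst x)) *\<^sub>R fst x) \<in> measurable (restrict_space borel chart_dom) sphere_measure"
      using measurable_restrict_space1[OF 1] by simp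
    show "(\<lambda>x. norm (snd x)) \<in> measurable (restrict_space borel chart_dom) lborel"
      using measurable_restrict_space1[OF 2] by simp
    show "(\<lambda>x. Arg2pi (snd x)) \<in> measurable (restrict_space borel chart_dom) lborel"
      using measurable_restrict_space1[OF 3] by simp
  qed (use sp in \<open>auto simp: space_restrict_space chart_def\<close>)
qed

text \<open>The image of a measurable A consists of a Borel part inside \<open>chart_dom\<close> and
  a part of the collapsed loci, which may fail to be Borel but lies in a null set. The completion
  ignores the second part, and the integral formula in parameters evaluates the first.\<close>

lemma pullback_fefferman_measure:
  "pullback_measure (egg_param m) param_space (fefferman_measure bE (egg_rho m)) =
    density param_space (\<lambda>(\<xi>, r, \<theta>). ennreal (real m powr (2 / (real k + 2)) / 2
             * r powr (2 * (real m - 1) / (real k + 2) + 1) * (1 - r ^ (2 * m)) ^ (k - 1)))"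
    (is "_ = density _ ?d")
proof -
  let ?\<mu> = "fefferman_measure bE (egg_rho m)"
  let ?r = "\<lambda>p :: (complex ^ 'k) \<times> real \<times> real. fst (snd p)"
  have sets_\<mu>: "sets ?\<mu> = sets borel"
    by (simp add: fefferman_measure_def)
  have d[measurable]: "?d \<in> borel_measurable param_space"
    unfolding case_prod_beta by measurable
  have key: "emeasure (completion ?\<mu>) (egg_param m ` A) = emeasure (density param_space ?d) A"
    if A[measurable]: "A \<in> sets param_space" for A
  proof -
    have A_space: "A \<subseteq> sphere 0 1 \<times> {0..1} \<times> {0..<2 * pi}"
      using sets.sets_into_space[OF A] space_param_space by auto
    define X where "X = {x \<in> chart_dom. chart x \<in> A}"
    define E where "E = {x \<in> bE. fst x = 0 \<or> snd x = 0}"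
    have "X = chart -` A \<inter> space (restrict_space borel chart_dom)"
      by (auto simp: X_def space_restrict_space)
    then have "X \<in> sets (restrict_space borel chart_dom)"
      using measurable_sets[OF measurable_chart A] by simp
    then have X[measurable]: "X \<in> sets borel"
      by (subst (asm) sets_restrict_space_iff) auto
    have "E = bE \<inter> {x. fst x = 0 \<or> snd x = 0}"
      by (auto simp: E_def)
    then have E[measurable]: "E \<in> sets borel"
      using borel_closed[OF closed_bE] by simp
    have inner: "egg_param m p \<in> chart_dom" "chart (egg_param m p) = p"
      if "p \<in> space param_space" "0 < ?r p" "?r p < 1" for p
    proof -
      obtain \<xi> r \<theta> where p: "p = (\<xi>, r, \<theta>)" by (cases p)
      with that have p': "\<xi> \<in> sphere 0 1" "0 < r" "r < 1" "\<theta> \<in> {0..<2 * pi}"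
        by (auto simp: space_param_space)
      then show "chart (egg_param m p) = p"
        unfolding p by (rule chart_egg_param)
      have "\<xi> \<noteq> 0" using p' by auto
      then show "egg_param m p \<in> chart_dom"
        using p' R_pos[of r] egg_param_in_bE[of \<xi> r \<theta>] unfolding p
        by (simp add: chart_dom_def) (simp add: egg_param_eq)
    qed
    \<comment> \<open>For 0 < r < 1 the parametrization never meets \<open>E\<close>, so the
      integral formula assigns it measure zero.\<close>
    have E_null: "E \<in> null_sets ?\<mu>"
    proof (rule null_setsI)
      have "emeasure ?\<mu> E = (\<integral>\<^sup>+p. indicator E p \<partial>?\<mu>)"
        by (simp add: sets_\<mu>)
      also have "\<dots> = (\<integral>\<^sup>+p. indicator {0<..<1} (?r p) * (ennreal (weight (?r p)) * indicator E (egg_param m p)) \<partial>param_space)"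
        by (rule nn_integral_fefferman_measure_param) measurable
      also have "\<dots> = (\<integral>\<^sup>+p. 0 \<partial>param_space)"
      proof (rule nn_integral_cong)
        fix p assume "p \<in> space param_space"
        with inner[of p] show "indicator {0<..<1} (?r p) * (ennreal (weight (?r p)) * indicator E (egg_param m p)) = 0"
          by (auto simp: indicator_def E_def chart_dom_def)
      qed
      finally show "emeasure ?\<mu> E = 0" by simp
    qed (simp add: sets_\<mu>)
    \<comment> \<open>Parameters with r = 0 or r = 1 are mapped into \<open>E\<close>; all others
      are recovered by \<open>chart\<close>.\<close>
    have union: "egg_param m ` A = X \<union> (egg_param m ` A \<inter> E)"
    proof (intro subset_antisym subsetI)
      fix x assume "x \<in> egg_param m ` A"
      then obtain p where p: "p \<in> A" "x = egg_param m p" by auto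
      then have sp: "p \<in> space param_space"
        using A_space space_param_space by auto
      obtain \<xi> r \<theta> where p': "p = (\<xi>, r, \<theta>)" by (cases p)
      with sp have "\<xi> \<in> sphere 0 1" "0 \<le> r" "r \<le> 1"
        by (auto simp: space_param_space)
      then have bE: "x \<in> bE"
        using egg_param_in_bE p p' by simp
      show "x \<in> X \<union> (egg_param m ` A \<inter> E)"
      proof (cases "0 < ?r p \<and> ?r p < 1")
        case True
        with inner[OF sp] p show ?thesis by (simp add: X_def)
      next
        case False
        with \<open>0 \<le> r\<close> \<open>r \<le> 1\<close> p' have "r = 0 \<or> r = 1" by auto
        then have "x \<in> E"
          using bE p p' m by (auto simp: E_def egg_param_eq R_def)
        with p show ?thesis by auto
      qed
    next
      fix x assume "x \<in> X \<union> (egg_param m ` A \<inter> E)"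
      then show "x \<in> egg_param m ` A"
      proof
        assume "x \<in> X"
        then have "chart x \<in> A" "egg_param m (chart x) = x"
          using egg_param_chart[of x] by (auto simp: X_def chart_dom_def)
        then show ?thesis by (metis image_eqI)
      qed auto
    qed
    \<comment> \<open>Only the inclusion in the null set \<open>E\<close> is available here, which
      suffices for measurability in the completion.\<close>
    have "egg_param m ` A \<inter> E \<in> null_sets (completion ?\<mu>)"
      by (rule null_sets_completion_subset[OF _ null_sets_completionI[OF E_null]]) auto
    then have "emeasure (completion ?\<mu>) (X \<union> (egg_param m ` A \<inter> E)) = emeasure (completion ?\<mu>) X"
      by (rule emeasure_Un_null_set[rotated]) (simp add: sets_\<mu> sets_completionI_sets)
    then have "emeasure (completion ?\<mu>) (egg_param m ` A) = emeasure (completion ?\<mu>) X"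
      by (simp only: union[symmetric])
    also have "\<dots> = emeasure ?\<mu> X"
      by (simp add: sets_\<mu>)
    also have "\<dots> = (\<integral>\<^sup>+p. indicator X p \<partial>?\<mu>)"
      by (simp add: sets_\<mu>)
    also have "\<dots> = (\<integral>\<^sup>+p. indicator {0<..<1} (?r p) * (ennreal (weight (?r p)) * indicator X (egg_param m p)) \<partial>param_space)"
      by (rule nn_integral_fefferman_measure_param) measurable
    also have "\<dots> = (\<integral>\<^sup>+p. ?d p * indicator A p \<partial>param_space)"
    proof (rule nn_integral_cong_AE)
      show "AE p in param_space. indicator {0<..<1} (?r p) * (ennreal (weight (?r p)) * indicator X (egg_param m p))
          = ?d p * indicator A p"
        using AE_param_space AE_space
      proof eventually_elim
        case (elim p)
        then have "egg_param m p \<in> X \<longleftrightarrow> p \<in> A"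
          using inner[of p] by (simp add: X_def)
        with elim show ?case
          by (simp add: weight_eq case_prod_beta indicator_def)
      qed
    qed
    also have "\<dots> = emeasure (density param_space ?d) A"
      by (simp add: emeasure_density)
    finally show ?thesis .
  qed
  \<comment> \<open>\<open>measure_of\<close> depends only on the values on the generated
    sigma-algebra. Agreement there with a density also shows that the set function in
    \<open>pullback_measure\<close> is countably additive.\<close>
  have "pullback_measure (egg_param m) param_space ?\<mu> =
      measure_of (space param_space) (sets param_space) (emeasure (density param_space ?d))"
    unfolding pullback_measure_def
  proof (rule measure_of_eq)
    show "sets param_space \<subseteq> Pow (space param_space)"
      by (rule sets.space_closed)
    show "emeasure (completion ?\<mu>) (egg_param m ` A) = emeasure (density param_space ?d) A"
      if "A \<in> sigma_sets (space param_space) (sets param_space)" for A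
      using that key by (simp add: sets.sigma_sets_eq)
  qed
  also have "\<dots> = density param_space ?d"
    using measure_of_of_measure[of "density param_space ?d"] by simp
  finally show ?thesis .
qed

end

theorem proposition2p1:
  fixes n m k :: nat and a :: real
    and bE :: "((complex ^ 'k::finite) \<times> complex) set"
    and \<rho> :: "(complex ^ 'k) \<times> complex \<Rightarrow> real"
    and \<Phi> :: "(complex ^ 'k) \<times> real \<times> real \<Rightarrow> (complex ^ 'k) \<times> complex"
  assumes "n \<ge> 2" and "m \<ge> 1" and "k = n - 1" and "CARD('k) = k"
    and "a = 2 * (real m - 1) / (real n + 1)"
    and "bE = frontier (egg m)" and "\<rho> = egg_rho m" and "\<Phi> = egg_param m"
  shows "(\<forall>(z, w) \<in> bE. fefferman_M \<rho> (z, w) = of_real ((real m)\<^sup>2 * norm w ^ (2 * m - 2)))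
    \<and> \<Phi> ` (sphere 0 1 \<times> {0..<1} \<times> {0..<2 * pi}) = {(z, w) \<in> bE. z \<noteq> 0}
    \<and> inj_on \<Phi> (sphere 0 1 \<times> {0<..<1} \<times> {0..<2 * pi})
    \<and> {(z, w) \<in> bE. z = 0} \<in> null_sets (hypersurface_measure bE)
    \<and> pullback_measure \<Phi> egg_param_measure (fefferman_measure bE \<rho>) =
        density egg_param_measure
          (\<lambda>(\<xi>, r, \<theta>). ennreal (real m powr (2 / (real n + 1)) / 2
             * r powr (a + 1) * (1 - r ^ (2 * m)) ^ (k - 1)))"
proof -
  interpret egg_setting m k bE
    by unfold_locales (use assms in auto)
  \<comment> \<open>The truncated subtraction in k = n - 1 is harmless because n is at least
    2.\<close>
  have n: "real n + 1 = real k + 2"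
    using assms(1,3) by simp
  have "\<forall>(z, w) \<in> bE. fefferman_M \<rho> (z, w) = of_real ((real m)\<^sup>2 * norm w ^ (2 * m - 2))"
    using fefferman_M_egg_rho[OF m] by (auto simp: bE_eq assms(7))
  moreover have "{(z, w) \<in> bE. z \<noteq> 0} = {x \<in> bE. fst x \<noteq> 0}" "{(z, w) \<in> bE. z = 0} = {x \<in> bE. fst x = 0}"
    by auto
  ultimately show ?thesis
    using egg_param_image inj_on_egg_param null_sets_pole pullback_fefferman_measure
    unfolding assms(5,7,8) n by simp
qed

end
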